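(* Let $X$ and $Y$ be $C^1$ Finsler manifolds, where $X$ is complete and $Y$ has smooth norm, and let $f:X\to Y$ be a locally Lipschitz map. Suppose that $Jf$ is a strong pseudo-Jacobian mapping for $f$ and that $f$ is $Jf$-regular at every point $x\in X$. If $f$ is a weighted strong submersion, then $f$ is a covering map, and the set-valued inverse map $f^{-1}$ has the pseudo-Lipschitz property around $(y,x)$ for every $y\in Y$ and $x\in f^{-1}(y)$, with $$\operatorname{lip} f^{-1}(y|x)\le C(Jf(x))^{-1}.$$
   Context: **Manifolds and charts.** Manifolds are $C^1$ manifolds modeled on (possibly infinite-dimensional) real Banach spaces. A chart $(W,\varphi)$ at $x\in X$ is an open set $W\ni x$ with a chart map $\varphi$ from $W$ onto an open subset of the model space $E$; $d\varphi^{-1}(\varphi(x)):E\to T_xX$ is the induced linear isomorphism. $\mathcal L(E,F)$ denotes the bounded linear operators. **Finsler manifolds.** A Finsler structure on $X$ (modeled on $(E,|\cdot|_E)$) is a continuous map $\|\cdot\|:TX\to[0,\infty)$ such that: (1) for each $x$, its restriction $\|\cdot\|_x$ to $T_xX$ is a norm such that for every chart $(W,\varphi)$ at $x$, $\|d\varphi^{-1}(\varphi(x))(\cdot)\|_x$ is a norm on $E$ equivalent to $|\cdot|_E$; (2) for each $x_0\in X$, chart $(W,\varphi)$ at $x_0$ and $\varepsilon>0$ there is an open neighborhood $U\subset W$ of $x_0$ with $\frac1{1+\varepsilon}\|d\varphi^{-1}(\varphi(x_0))\mathbf v\|_{x_0}\le\|d\varphi^{-1}(\varphi(x))\mathbf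 v\|_x\le(1+\varepsilon)\|d\varphi^{-1}(\varphi(x_0))\mathbf v\|_{x_0}$ for all $x\in U$, $\mathbf v\in E$. A Finsler manifold is a $C^1$ Banach manifold with a Finsler structure; all Finsler manifolds are assumed connected. $d_X(u,u')$ is the infimum of the lengths $\int_a^b\|\dot\sigma(t)\|_{\sigma(t)}dt$ of $C^1$ paths $\sigma$ joining $u$ to $u'$; $B_X(x;r)$ is the open $d_X$-ball; $X$ is complete if $(X,d_X)$ is. $X$ has smooth norm if each $\|\cdot\|_x$ is Fréchet differentiable away from $0$. Locally Lipschitz means with respect to $d_X,d_Y$ (equivalently, in charts). **Pseudo-Jacobians.** For Banach spaces $E,F$, $U\subset E$ open and $\mathbf f:U\to F$ continuous, a nonempty set $J\mathbf f(\mathbf x)\subset\mathcal L(E,F)$ is a pseudo-Jacobian of $\mathbf f$ at $\mathbf x\in U$ if for all $y^*\in F^*$, $v\in E$: $\limsup_{t\to0^+}\frac{y^*(\mathbf f(\mathbf x+tv))-y^*(\mathbf f(\mathbf x))}{t}\le\sup\{\langle y^*,T(v)\rangle:T\in J\mathbf f(\mathbf x)\}$. A set-valued map $J\mathbf f:U\to2^{\mathcal L(E,F)}$ is a pseudo-Jacobian mapping if this holds at every point; it is locally bounded if each point has a ball $B\subset U$ around it with $\bigcup_{\mathbf z\in B}J\mathbf f(\mathbf z)$ norm bounded. Let $f:X\to Y$ be locally Lipschitz between $C^1$ manifolds modeled on $E,F$. An assignment $x\mapsto Jf(x)$, with $Jf(x)$ a set of linear operators $T_xX\to T_{f(x)}Y$,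 is a pseudo-Jacobian mapping for $f$ if for each $x\in X$ there are charts $(W,\varphi)$ at $x$ and $(V,\psi)$ at $f(x)$ with $f(W)\subset V$ and a locally bounded pseudo-Jacobian mapping $J\mathbf f:\varphi(W)\to2^{\mathcal L(E,F)}$ of $\mathbf f=\psi\circ f\circ\varphi^{-1}$ such that $Jf(u)=d\psi^{-1}(\psi(f(u)))\,J\mathbf f(\varphi(u))\,[d\varphi^{-1}(\varphi(u))]^{-1}$ for all $u\in W$. It is strong if in addition the charts can be chosen so that each $J\mathbf f(\mathbf u)$, $\mathbf u\in\varphi(W)$, is convex and compact in the weak operator topology. **Finsler regularity index.** For $T\in\mathcal L(T_xX,T_{f(x)}Y)$ let $C_{\rm Finsler}(T)=\inf_{|y^*|_{f(x)}=1}|T^*y^*|_x$, with $|\cdot|_x,|\cdot|_{f(x)}$ the dual norms of $\|\cdot\|_x,\|\cdot\|_{f(x)}$. Set $C(Jf(x)):=\sup_{R>0}\inf\{C_{\rm Finsler}(T):T\in\mathrm{co}\,Jf(B_X(x;R))\}$, where co is the convex hull and $Jf(B_X(x;R))=\bigcup_{u\in B_X(x;R)}Jf(u)$ is regarded (for small $R$) as a subset of $\mathcal L(T_xX,T_{f(x)}Y)$ by means of a pair of charts $(W,\varphi)$ at $x$ and $(V,\psi)$ at $f(x)$ with $f(W)\subset V$ for which there is a locally bounded pseudo-Jacobian mapping $J\mathbf f:\varphi(W)\to2^{\mathcal L(E,F)}$ of $\mathbf f=\psi\circ f\circ\varphi^{-1}$ such that $Jf(u)=d\psi^{-1}(\psi(f(u)))\,J\mathbf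 f(\varphi(u))\,[d\varphi^{-1}(\varphi(u))]^{-1}$ for all $u\in W$: the operator of $Jf(u)$ represented by $\mathbf T\in J\mathbf f(\varphi(u))$ is identified with $d\psi^{-1}(\psi(f(x)))\,\mathbf T\,[d\varphi^{-1}(\varphi(x))]^{-1}$. (The value does not depend on the charts.) **$Jf$-regularity.** $f$ is $Jf$-regular at $x$ if $C(Jf(x))>0$ and there is $R>0$ such that every $T\in\mathrm{co}\,Jf(B_X(x;R))$ is a linear isomorphism. **Weighted strong submersion.** A weight is a nondecreasing map (not necessarily continuous) $\omega:[0,\infty)\to(0,\infty)$ with $\int_0^\infty\frac{d\rho}{\omega(\rho)}=\infty$. $f$ is a weighted strong submersion if for some $x^*\in X$ and some weight $\omega$ there is no sequence $\{x_n\}$ in $X$ with $f(x_n)\to y$ for some $y\in Y$ and $C(Jf(x_n))\,\omega(d_X(x^*,x_n))\to0$. **Pseudo-Lipschitz property.** A set-valued map $g:Y\to2^X$ has the pseudo-Lipschitz property around $(y,x)$ if there are neighborhoods $V_y$, $W_x$ and $\mu>0$ with $d_X(u,g(z))\le\mu\,d_Y(w,z)$ whenever $w,z\in V_y$, $u\in W_x$ and $u\in g(w)$; the infimum of such $\mu$ is $\operatorname{lip} g(y|x)$. *)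

theory Defs
  imports "HOL-Analysis.Analysis" "HOL-Library.Function_Algebras"
begin

section \<open>Pointwise vector space structure on functions\<close>

text \<open>
  Tangent vectors and operators between tangent spaces are functions below; this instance supplies
  their vector space operations, so that \<^const>\<open>subspace\<close> and \<^term>\<open>convex hull S\<close> apply to them.
\<close>

instantiation "fun" :: (type, real_vector) real_vector
begin

definition scaleR_fun :: "real \<Rightarrow> ('a \<Rightarrow> 'b) \<Rightarrow> 'a \<Rightarrow> 'b"
  where "scaleR_fun r f = (\<lambda>x. r *\<^sub>R f x)"

instance
  by standard (auto simp: scaleR_fun_def fun_eq_iff algebra_simps)

end


definition linear_between ::
    "'v::real_vector set \<Rightarrow> 'w::real_vector set \<Rightarrow> ('v \<Rightarrow> 'w) \<Rightarrow> bool"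
  where "linear_between S R h \<longleftrightarrow> h ` S \<subseteq> R \<and>
           (\<forall>u\<in>S. \<forall>v\<in>S. h (u + v) = h u + h v) \<and> (\<forall>u\<in>S. \<forall>r. h (r *\<^sub>R u) = r *\<^sub>R h u)"

definition linear_isomorphism ::
    "'v::real_vector set \<Rightarrow> 'w::real_vector set \<Rightarrow> ('v \<Rightarrow> 'w) \<Rightarrow> bool"
  where "linear_isomorphism S R h \<longleftrightarrow> linear_between S R h \<and> bij_betw h S R"


section \<open>Manifolds modeled on a Banach space\<close>

text \<open>
  A manifold is a whole Hausdorff type \<open>'x\<close> together with an atlas. A chart is a pair of its domain
  and a chart map, whose values off the domain are irrelevant.
\<close>

type_synonym ('x, 'e) chart = "'x set \<times> ('x \<Rightarrow> 'e)"

abbreviation chart_dom :: "('x, 'e) chart \<Rightarrow> 'x set"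
  where "chart_dom \<equiv> fst"

abbreviation chart_map :: "('x, 'e) chart \<Rightarrow> 'x \<Rightarrow> 'e"
  where "chart_map \<equiv> snd"

definition chart_ran :: "('x, 'e) chart \<Rightarrow> 'e set"
  where "chart_ran c = chart_map c ` chart_dom c"

definition chart_inv :: "('x, 'e) chart \<Rightarrow> 'e \<Rightarrow> 'x"
  where "chart_inv c = inv_into (chart_dom c) (chart_map c)"

definition is_chart :: "('x::topological_space, 'e::banach) chart \<Rightarrow> bool"
  where "is_chart c \<longleftrightarrow> open (chart_dom c) \<and> open (chart_ran c) \<and>
           homeomorphism (chart_dom c) (chart_ran c) (chart_map c) (chart_inv c)"

definition C1_on :: "('e::banach) set \<Rightarrow> ('e \<Rightarrow> 'f::banach) \<Rightarrow> bool"
  where "C1_on S g \<longleftrightarrow>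
           (\<exists>D :: 'e \<Rightarrow> 'e \<Rightarrow>\<^sub>L 'f. continuous_on S D \<and>
              (\<forall>z\<in>S. (g has_derivative blinfun_apply (D z)) (at z)))"

definition transition :: "('x, 'e) chart \<Rightarrow> ('x, 'e) chart \<Rightarrow> 'e \<Rightarrow> 'e"
  where "transition c c' = chart_map c' \<circ> chart_inv c"

definition C1_compatible ::
    "('x::topological_space, 'e::banach) chart \<Rightarrow> ('x, 'e) chart \<Rightarrow> bool"
  where "C1_compatible c c' \<longleftrightarrow>
           C1_on (chart_map c ` (chart_dom c \<inter> chart_dom c')) (transition c c') \<and>
           C1_on (chart_map c' ` (chart_dom c \<inter> chart_dom c')) (transition c' c)"

record ('x, 'e) finsler =
  atlas :: "('x, 'e) chart set"
  fnorm :: "'x \<Rightarrow> (('x, 'e) chart \<Rightarrow> 'e) \<Rightarrow> real"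

definition C1_manifold :: "('x::t2_space, 'e::banach) finsler \<Rightarrow> bool"
  where "C1_manifold X \<longleftrightarrow>
           (\<forall>c\<in>atlas X. is_chart c) \<and> (\<Union>c\<in>atlas X. chart_dom c) = UNIV \<and>
           (\<forall>c\<in>atlas X. \<forall>c'\<in>atlas X. C1_compatible c c')"

definition charts :: "('x::topological_space, 'e::banach) finsler \<Rightarrow> ('x, 'e) chart set"
  where "charts X = {c. is_chart c \<and> (\<forall>a\<in>atlas X. C1_compatible c a)}"

definition charts_at ::
    "('x::topological_space, 'e::banach) finsler \<Rightarrow> 'x \<Rightarrow> ('x, 'e) chart set"
  where "charts_at X x = {c \<in> charts X. x \<in> chart_dom c}"


section \<open>Tangent spaces\<close>

text \<open>
  A tangent vector at \<open>x\<close> is the family of its coordinate vectors in all charts at \<open>x\<close>, related by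
  the derivatives of the transition maps, and extended by \<open>0\<close> to pairs that are not charts at \<open>x\<close>.
  The coordinate \<open>\<xi> c\<close> of \<open>\<xi>\<close> in the chart \<open>c = (W, \<phi>)\<close> is \<open>d\<phi>(x) \<xi>\<close>.
\<close>

type_synonym ('x, 'e) tvec = "('x, 'e) chart \<Rightarrow> 'e"

definition d_transition :: "('x, 'e::banach) chart \<Rightarrow> ('x, 'e) chart \<Rightarrow> 'x \<Rightarrow> 'e \<Rightarrow> 'e"
  where "d_transition c c' x = frechet_derivative (transition c c') (at (chart_map c x))"

definition tangent_space ::
    "('x::topological_space, 'e::banach) finsler \<Rightarrow> 'x \<Rightarrow> ('x, 'e) tvec set"
  where "tangent_space X x =
           {\<xi>. (\<forall>c\<in>charts_at X x. \<forall>c'\<in>charts_at X x. \<xi> c' = d_transition c c' x (\<xi> c)) \<and>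
               (\<forall>c. c \<notin> charts_at X x \<longrightarrow> \<xi> c = 0)}"

text \<open>\<open>d_chart_inv X c x\<close> is \<open>d\<phi>\<^sup>-\<^sup>1(\<phi>(x)) : E \<rightarrow> T\<^sub>x X\<close> for \<open>c = (W, \<phi>)\<close>.\<close>

definition d_chart_inv ::
    "('x::topological_space, 'e::banach) finsler \<Rightarrow> ('x, 'e) chart \<Rightarrow> 'x \<Rightarrow> 'e \<Rightarrow> ('x, 'e) tvec"
  where "d_chart_inv X c x v = (\<lambda>c'. if c' \<in> charts_at X x then d_transition c c' x v else 0)"


lemma charts_at_D:
  assumes "c \<in> charts_at X x"
  shows "is_chart c" "x \<in> chart_dom c" "\<And>a. a \<in> atlas X \<Longrightarrow> C1_compatible c a"
  using assms by (auto simp: charts_at_def charts_def)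

lemma chart_inv_map: "is_chart c \<Longrightarrow> x \<in> chart_dom c \<Longrightarrow> chart_inv c (chart_map c x) = x"
  by (auto simp: is_chart_def homeomorphism_def)

lemma overlap_open:
  assumes "is_chart c" "open W"
  shows "open (chart_map c ` (chart_dom c \<inter> W))"
proof -
  have h: "homeomorphism (chart_dom c) (chart_ran c) (chart_map c) (chart_inv c)"
    "open (chart_dom c)" "open (chart_ran c)" using assms by (auto simp: is_chart_def)
  have "openin (top_of_set (chart_dom c)) (chart_dom c \<inter> W)" using assms by auto
  then have "openin (top_of_set (chart_ran c)) (chart_map c ` (chart_dom c \<inter> W))"
    using h(1) homeomorphism_imp_open_map by blast
  then show ?thesis using h(3) openin_open_trans by blast
qed

lemma C1_differentiable: "C1_on S g \<Longrightarrow> z \<in> S \<Longrightarrow> g differentiable (at z)"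
  by (auto simp: C1_on_def differentiable_def)

lemma transition_comp_has_derivative:
  assumes c: "is_chart c" "x \<in> chart_dom c" and a: "is_chart a" "x \<in> chart_dom a"
    and c': "is_chart c'" "x \<in> chart_dom c'"
    and 1: "transition c a differentiable (at (chart_map c x))"
    and 2: "transition a c' differentiable (at (chart_map a x))"
  shows "(transition c c' has_derivative d_transition a c' x \<circ> d_transition c a x) (at (chart_map c x))"
proof -
  let ?S = "chart_map c ` (chart_dom c \<inter> (chart_dom a \<inter> chart_dom c'))"
  have o: "open ?S" using a c' c by (intro overlap_open) (auto simp: is_chart_def)
  have e: "transition c a (chart_map c x) = chart_map a x"
    using c by (simp add: transition_def chart_inv_map)
  have "(transition a c' \<circ> transition c a has_derivative d_transition a c' x \<circ> d_transition c a x) (at (chart_map c x))"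
    unfolding d_transition_def
    by (rule diff_chain_at) (use 1 2 e in \<open>auto simp: frechet_derivative_works[symmetric]\<close>)
  then show ?thesis
    apply (rule has_derivative_transform_within_open[OF _ o])
    using c a c' by (auto simp: transition_def chart_inv_map)
qed

lemma transition_differentiable:
  assumes X: "C1_manifold X" and c: "c \<in> charts_at X x" and c': "c' \<in> charts_at X x"
  shows "transition c c' differentiable (at (chart_map c x))"
proof -
  have "x \<in> (\<Union>c\<in>atlas X. chart_dom c)" using X unfolding C1_manifold_def by blast
  then obtain a where a: "a \<in> atlas X" "x \<in> chart_dom a" by blast
  have ia: "is_chart a" using X a by (auto simp: C1_manifold_def)
  have "transition c a differentiable (at (chart_map c x))"
    using charts_at_D(3)[OF c a(1)] charts_at_D(2)[OF c] a by (auto simp: C1_compatible_def intro: C1_differentiable)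
  moreover have "transition a c' differentiable (at (chart_map a x))"
    using charts_at_D(3)[OF c' a(1)] charts_at_D(2)[OF c'] a by (auto simp: C1_compatible_def intro: C1_differentiable)
  ultimately show ?thesis
    using transition_comp_has_derivative[OF charts_at_D(1,2)[OF c] ia a(2) charts_at_D(1,2)[OF c']]
    by (auto simp: differentiable_def)
qed

lemma d_transition_comp:
  assumes X: "C1_manifold X" and c: "c \<in> charts_at X x" and a: "a \<in> charts_at X x" and c': "c' \<in> charts_at X x"
  shows "d_transition a c' x (d_transition c a x v) = d_transition c c' x v"
proof -
  note h = transition_comp_has_derivative[OF charts_at_D(1,2)[OF c] charts_at_D(1,2)[OF a] charts_at_D(1,2)[OF c']
      transition_differentiable[OF X c a] transition_differentiable[OF X a c']]
  have "d_transition c c' x = d_transition a c' x \<circ> d_transition c a x"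
    unfolding d_transition_def[of c c'] using frechet_derivative_at[OF h] by (rule sym)
  then show ?thesis by simp
qed

lemma d_transition_self:
  assumes c: "c \<in> charts_at X x" shows "d_transition c c x v = v"
proof -
  note d = charts_at_D(1,2)[OF c]
  have "open (chart_ran c)" using d by (auto simp: is_chart_def)
  have "(transition c c has_derivative id) (at (chart_map c x))"
    apply (rule has_derivative_transform_within_open[OF has_derivative_id \<open>open (chart_ran c)\<close>])
    using d by (auto simp: chart_ran_def transition_def chart_inv_map)
  from frechet_derivative_at[OF this] show ?thesis by (simp add: d_transition_def)
qed

lemma d_chart_inv_coord: "c \<in> charts_at X x \<Longrightarrow> d_chart_inv X c x v c = v"
  by (simp add: d_chart_inv_def d_transition_self)

lemma d_chart_inv_of_coord:
  "c \<in> charts_at X x \<Longrightarrow> \<xi> \<in> tangent_space X x \<Longrightarrow> d_chart_inv X c x (\<xi> c) = \<xi>"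
proof -
  assume c: "c \<in> charts_at X x" and x: "\<xi> \<in> tangent_space X x"
  show "d_chart_inv X c x (\<xi> c) = \<xi>"
  proof
    fix c' show "d_chart_inv X c x (\<xi> c) c' = \<xi> c'"
    proof (cases "c' \<in> charts_at X x")
      case True
      then have "\<xi> c' = d_transition c c' x (\<xi> c)" using x c unfolding tangent_space_def by blast
      then show ?thesis using True by (simp add: d_chart_inv_def)
    next
      case False
      then have "\<xi> c' = 0" using x unfolding tangent_space_def by blast
      then show ?thesis using False by (simp add: d_chart_inv_def)
    qed
  qed
qed

lemma d_chart_inv_tangent:
  assumes "C1_manifold X" "c \<in> charts_at X x" shows "d_chart_inv X c x v \<in> tangent_space X x"
  unfolding tangent_space_def
proof (intro CollectI conjI ballI allI impI)
  fix c1 c2 assume "c1 \<in> charts_at X x" "c2 \<in> charts_at X x"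
  then show "d_chart_inv X c x v c2 = d_transition c1 c2 x (d_chart_inv X c x v c1)"
    using d_transition_comp[OF assms] by (simp add: d_chart_inv_def)
qed (simp add: d_chart_inv_def)

lemma linear_d_transition:
  assumes X: "C1_manifold X" and c: "c \<in> charts_at X x" "c' \<in> charts_at X x"
  shows "linear (d_transition c c' x)"
  using linear_frechet_derivative[OF transition_differentiable[OF assms]]
  by (simp add: d_transition_def[abs_def])

lemma d_chart_inv_linear:
  assumes "C1_manifold X" "c \<in> charts_at X x"
  shows "d_chart_inv X c x (u + v) = d_chart_inv X c x u + d_chart_inv X c x v"
    and "d_chart_inv X c x (r *\<^sub>R v) = r *\<^sub>R d_chart_inv X c x v"
proof -
  have "d_chart_inv X c x (u + v) c' = d_chart_inv X c x u c' + d_chart_inv X c x v c'" for c'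
    using linear_add[OF linear_d_transition[OF assms, of c']] by (simp add: d_chart_inv_def)
  then show "d_chart_inv X c x (u + v) = d_chart_inv X c x u + d_chart_inv X c x v"
    by (intro ext) (simp only: plus_fun_apply)
  have "d_chart_inv X c x (r *\<^sub>R v) c' = r *\<^sub>R d_chart_inv X c x v c'" for c'
    using linear_scale[OF linear_d_transition[OF assms, of c']] by (simp add: d_chart_inv_def)
  then show "d_chart_inv X c x (r *\<^sub>R v) = r *\<^sub>R d_chart_inv X c x v"
    by (intro ext) (simp only: scaleR_fun_def)
qed

lemma charts_at_nonempty:
  assumes "C1_manifold X" shows "charts_at X x \<noteq> {}"
proof -
  have "x \<in> (\<Union>c\<in>atlas X. chart_dom c)" using assms unfolding C1_manifold_def by blast
  then obtain a where "a \<in> atlas X" "x \<in> chart_dom a" by blast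
  then have "a \<in> charts_at X x" using assms unfolding C1_manifold_def charts_at_def charts_def by blast
  then show ?thesis by blast
qed

lemma tangent_space_eq_range:
  assumes "C1_manifold X" "c \<in> charts_at X x"
  shows "tangent_space X x = range (d_chart_inv X c x)"
  using d_chart_inv_tangent[OF assms] d_chart_inv_of_coord[OF assms(2)] by (metis image_subset_iff rangeI subsetI subset_antisym)

lemma subspace_tangent_space:
  assumes "C1_manifold X" shows "subspace (tangent_space X x)"
proof -
  obtain c where c: "c \<in> charts_at X x" using charts_at_nonempty[OF assms] by blast
  have "linear (d_chart_inv X c x)" by (rule linearI) (rule d_chart_inv_linear[OF assms c])+
  then show ?thesis unfolding tangent_space_eq_range[OF assms c] by (rule linear_subspace_image) simp
qed

lemma d_chart_inv_isomorphism:
  assumes "C1_manifold X" "c \<in> charts_at X x"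
  shows "linear_isomorphism UNIV (tangent_space X x) (d_chart_inv X c x)"
  unfolding linear_isomorphism_def linear_between_def bij_betw_def tangent_space_eq_range[OF assms]
proof (intro conjI ballI allI)
  show "inj (d_chart_inv X c x)" by (rule injI) (metis d_chart_inv_coord[OF assms(2)])
qed (use d_chart_inv_linear[OF assms] in simp_all)


section \<open>Finsler manifolds\<close>

definition norm_on :: "'v::real_vector set \<Rightarrow> ('v \<Rightarrow> real) \<Rightarrow> bool"
  where "norm_on S n \<longleftrightarrow>
           (\<forall>u\<in>S. 0 \<le> n u \<and> (n u = 0 \<longleftrightarrow> u = 0)) \<and>
           (\<forall>u\<in>S. \<forall>r. n (r *\<^sub>R u) = \<bar>r\<bar> * n u) \<and>
           (\<forall>u\<in>S. \<forall>v\<in>S. n (u + v) \<le> n u + n v)"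

definition equivalent_norm :: "('e::real_normed_vector \<Rightarrow> real) \<Rightarrow> bool"
  where "equivalent_norm n \<longleftrightarrow>
           norm_on UNIV n \<and> (\<exists>m>0. \<exists>M. \<forall>v. m * norm v \<le> n v \<and> n v \<le> M * norm v)"

text \<open>
  Continuity on the tangent bundle is expressed in the bundle charts \<open>W \<times> E\<close>, which generate its
  topology.
\<close>

definition finsler_structure :: "('x::t2_space, 'e::banach) finsler \<Rightarrow> bool"
  where "finsler_structure X \<longleftrightarrow>
           (\<forall>c\<in>charts X. continuous_on (chart_ran c \<times> UNIV)
              (\<lambda>(z, v). fnorm X (chart_inv c z) (d_chart_inv X c (chart_inv c z) v))) \<and>
           (\<forall>x. norm_on (tangent_space X x) (fnorm X x)) \<and>
           (\<forall>x. \<forall>c\<in>charts_at X x. equivalent_norm (\<lambda>v. fnorm X x (d_chart_inv X c x v))) \<and>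
           (\<forall>x\<^sub>0. \<forall>c\<in>charts_at X x\<^sub>0. \<forall>\<epsilon>>0. \<exists>U. open U \<and> x\<^sub>0 \<in> U \<and> U \<subseteq> chart_dom c \<and>
              (\<forall>x\<in>U. \<forall>v.
                 1 / (1 + \<epsilon>) * fnorm X x\<^sub>0 (d_chart_inv X c x\<^sub>0 v) \<le> fnorm X x (d_chart_inv X c x v) \<and>
                 fnorm X x (d_chart_inv X c x v) \<le> (1 + \<epsilon>) * fnorm X x\<^sub>0 (d_chart_inv X c x\<^sub>0 v)))"

definition finsler_manifold :: "('x::t2_space, 'e::banach) finsler \<Rightarrow> bool"
  where "finsler_manifold X \<longleftrightarrow>
           C1_manifold X \<and> finsler_structure X \<and> connected (UNIV :: 'x set)"

definition smooth_norm :: "('x::t2_space, 'e::banach) finsler \<Rightarrow> bool"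
  where "smooth_norm X \<longleftrightarrow>
           (\<forall>x. \<forall>c\<in>charts_at X x. \<forall>v. v \<noteq> 0 \<longrightarrow>
              (\<lambda>w. fnorm X x (d_chart_inv X c x w)) differentiable (at v))"

definition C1_path ::
    "('x::t2_space, 'e::banach) finsler \<Rightarrow> real \<Rightarrow> real \<Rightarrow> (real \<Rightarrow> 'x) \<Rightarrow> bool"
  where "C1_path X a b \<sigma> \<longleftrightarrow> a < b \<and> continuous_on {a..b} \<sigma> \<and>
           (\<forall>c\<in>charts X.
              (\<forall>t\<in>{t\<in>{a..b}. \<sigma> t \<in> chart_dom c}.
                 (chart_map c \<circ> \<sigma>) differentiable (at t within {a..b})) \<and>
              continuous_on {t\<in>{a..b}. \<sigma> t \<in> chart_dom c}
                (\<lambda>t. vector_derivative (chart_map c \<circ> \<sigma>) (at t within {a..b})))"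

definition velocity ::
    "('x::t2_space, 'e::banach) finsler \<Rightarrow> real \<Rightarrow> real \<Rightarrow> (real \<Rightarrow> 'x) \<Rightarrow> real \<Rightarrow> ('x, 'e) tvec"
  where "velocity X a b \<sigma> t = (\<lambda>c. if c \<in> charts_at X (\<sigma> t)
           then vector_derivative (chart_map c \<circ> \<sigma>) (at t within {a..b}) else 0)"

lemma velocity_tangent:
  assumes X: "C1_manifold X" and p: "C1_path X a b \<sigma>" and t: "t \<in> {a..b}"
  shows "velocity X a b \<sigma> t \<in> tangent_space X (\<sigma> t)"
proof -
  have *: "vector_derivative (chart_map c' \<circ> \<sigma>) (at t within {a..b}) =
      d_transition c c' (\<sigma> t) (vector_derivative (chart_map c \<circ> \<sigma>) (at t within {a..b}))"
    if c: "c \<in> charts_at X (\<sigma> t)" and c': "c' \<in> charts_at X (\<sigma> t)" for c c'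
  proof -
    have ab: "a < b" and cont: "continuous_on {a..b} \<sigma>" using p by (auto simp: C1_path_def)
    have "c \<in> charts X" "\<sigma> t \<in> chart_dom c" using c by (auto simp: charts_at_def)
    then have "(chart_map c \<circ> \<sigma>) differentiable (at t within {a..b})"
      using p t by (auto simp: C1_path_def)
    then have 1: "(chart_map c \<circ> \<sigma> has_vector_derivative vector_derivative (chart_map c \<circ> \<sigma>) (at t within {a..b})) (at t within {a..b})"
      by (simp add: vector_derivative_works)
    have 2: "(transition c c' has_derivative d_transition c c' (\<sigma> t)) (at ((chart_map c \<circ> \<sigma>) t))"
      using transition_differentiable[OF X c c'] by (simp add: d_transition_def frechet_derivative_works)
    have 3: "((transition c c' \<circ> (chart_map c \<circ> \<sigma>)) has_vector_derivative d_transition c c' (\<sigma> t) (vector_derivative (chart_map c \<circ> \<sigma>) (at t within {a..b}))) (at t within {a..b})"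
      using vector_derivative_diff_chain_within[OF 1 has_derivative_at_withinI[OF 2]] .
    have "open (chart_dom c)" using charts_at_D(1)[OF c] by (simp add: is_chart_def)
    then have "\<forall>\<^sub>F s in at t within {a..b}. \<sigma> s \<in> chart_dom c"
      using topological_tendstoD[of \<sigma> "\<sigma> t" "at t within {a..b}" "chart_dom c"] cont t \<open>\<sigma> t \<in> chart_dom c\<close>
      unfolding continuous_on_def by blast
    then have ev: "\<forall>\<^sub>F s in at t within {a..b}. (transition c c' \<circ> (chart_map c \<circ> \<sigma>)) s = (chart_map c' \<circ> \<sigma>) s"
      by eventually_elim (use charts_at_D(1)[OF c] in \<open>simp add: transition_def chart_inv_map\<close>)
    have "(chart_map c' \<circ> \<sigma> has_vector_derivative d_transition c c' (\<sigma> t) (vector_derivative (chart_map c \<circ> \<sigma>) (at t within {a..b}))) (at t within {a..b})"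
      using 3 ev t charts_at_D(1,2)[OF c] unfolding has_vector_derivative_def
      by (elim has_derivative_transform_eventually) (auto simp: transition_def chart_inv_map)
    then show ?thesis using ab t by (intro vector_derivative_within) (auto simp: trivial_limit_within)
  qed
  have "\<forall>c\<in>charts_at X (\<sigma> t). \<forall>c'\<in>charts_at X (\<sigma> t). velocity X a b \<sigma> t c' = d_transition c c' (\<sigma> t) (velocity X a b \<sigma> t c)"
  proof (intro ballI)
    fix c c' assume c: "c \<in> charts_at X (\<sigma> t)" "c' \<in> charts_at X (\<sigma> t)"
    show "velocity X a b \<sigma> t c' = d_transition c c' (\<sigma> t) (velocity X a b \<sigma> t c)"
      unfolding velocity_def if_P[OF c(1)] if_P[OF c(2)] by (rule *[OF c])
  qed
  moreover have "\<forall>c. c \<notin> charts_at X (\<sigma> t) \<longrightarrow> velocity X a b \<sigma> t c = 0"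
    by (simp add: velocity_def)
  ultimately show ?thesis unfolding tangent_space_def by blast
qed

definition path_len ::
    "('x::t2_space, 'e::banach) finsler \<Rightarrow> real \<Rightarrow> real \<Rightarrow> (real \<Rightarrow> 'x) \<Rightarrow> real"
  where "path_len X a b \<sigma> = integral {a..b} (\<lambda>t. fnorm X (\<sigma> t) (velocity X a b \<sigma> t))"

definition fdist :: "('x::t2_space, 'e::banach) finsler \<Rightarrow> 'x \<Rightarrow> 'x \<Rightarrow> real"
  where "fdist X u u' = Inf {path_len X a b \<sigma> |a b \<sigma>. C1_path X a b \<sigma> \<and> \<sigma> a = u \<and> \<sigma> b = u'}"

definition fball :: "('x::t2_space, 'e::banach) finsler \<Rightarrow> 'x \<Rightarrow> real \<Rightarrow> 'x set"
  where "fball X x r = {u. fdist X x u < r}"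

definition finsler_complete :: "('x::t2_space, 'e::banach) finsler \<Rightarrow> bool"
  where "finsler_complete X \<longleftrightarrow> Metric_space.mcomplete UNIV (fdist X)"

definition locally_lipschitz ::
    "('x::t2_space, 'e::banach) finsler \<Rightarrow> ('y::t2_space, 'f::banach) finsler \<Rightarrow> ('x \<Rightarrow> 'y) \<Rightarrow> bool"
  where "locally_lipschitz X Y f \<longleftrightarrow>
           (\<forall>x. \<exists>r>0. \<exists>L. \<forall>u\<in>fball X x r. \<forall>v\<in>fball X x r. fdist Y (f u) (f v) \<le> L * fdist X u v)"


section \<open>Pseudo-Jacobians\<close>

definition pseudo_jacobian_at ::
    "('e::banach \<Rightarrow> 'f::banach) \<Rightarrow> 'e \<Rightarrow> ('e \<Rightarrow>\<^sub>L 'f) set \<Rightarrow> bool"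
  where "pseudo_jacobian_at f x J \<longleftrightarrow> J \<noteq> {} \<and>
           (\<forall>(l :: 'f \<Rightarrow>\<^sub>L real) v.
              Limsup (at_right 0) (\<lambda>t. ereal ((blinfun_apply l (f (x + t *\<^sub>R v)) - blinfun_apply l (f x)) / t))
                \<le> (SUP T\<in>J. ereal (blinfun_apply l (blinfun_apply T v))))"

definition pseudo_jacobian_mapping ::
    "'e::banach set \<Rightarrow> ('e \<Rightarrow> 'f::banach) \<Rightarrow> ('e \<Rightarrow> ('e \<Rightarrow>\<^sub>L 'f) set) \<Rightarrow> bool"
  where "pseudo_jacobian_mapping U f J \<longleftrightarrow>
           open U \<and> continuous_on U f \<and> (\<forall>x\<in>U. pseudo_jacobian_at f x (J x))"

definition locally_bounded_mapping ::
    "'e::banach set \<Rightarrow> ('e \<Rightarrow> ('e \<Rightarrow>\<^sub>L 'f::banach) set) \<Rightarrow> bool"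
  where "locally_bounded_mapping U J \<longleftrightarrow>
           (\<forall>x\<in>U. \<exists>r>0. ball x r \<subseteq> U \<and> bounded (\<Union>z\<in>ball x r. J z))"

definition weak_operator_topology :: "('e::banach \<Rightarrow>\<^sub>L 'f::banach) topology"
  where "weak_operator_topology =
           pullback_topology UNIV
             (\<lambda>T (v, l :: 'f \<Rightarrow>\<^sub>L real). blinfun_apply l (blinfun_apply T v)) euclidean"

text \<open>
  Operators between tangent spaces are functions that vanish off \<open>T\<^sub>x X\<close>. \<open>tangent_op X Y c d x y T\<close>
  is \<open>d\<psi>\<^sup>-\<^sup>1(\<psi>(y)) T [d\<phi>\<^sup>-\<^sup>1(\<phi>(x))]\<^sup>-\<^sup>1\<close> for \<open>c = (W, \<phi>)\<close>, \<open>d = (V, \<psi>)\<close>: the inverse of \<^const>\<open>d_chart_inv\<close>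
  on the tangent space is evaluation at the chart.
\<close>

definition tangent_op ::
    "('x::t2_space, 'e::banach) finsler \<Rightarrow> ('y::t2_space, 'f::banach) finsler \<Rightarrow>
     ('x, 'e) chart \<Rightarrow> ('y, 'f) chart \<Rightarrow> 'x \<Rightarrow> 'y \<Rightarrow> ('e \<Rightarrow>\<^sub>L 'f) \<Rightarrow> ('x, 'e) tvec \<Rightarrow> ('y, 'f) tvec"
  where "tangent_op X Y c d x y T =
           (\<lambda>\<xi>. if \<xi> \<in> tangent_space X x then d_chart_inv Y d y (blinfun_apply T (\<xi> c)) else 0)"

definition local_rep ::
    "('x::t2_space, 'e::banach) finsler \<Rightarrow> ('y::t2_space, 'f::banach) finsler \<Rightarrow> ('x \<Rightarrow> 'y) \<Rightarrow>
     ('x \<Rightarrow> (('x, 'e) tvec \<Rightarrow> ('y, 'f) tvec) set) \<Rightarrow> 'x \<Rightarrow>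
     ('x, 'e) chart \<Rightarrow> ('y, 'f) chart \<Rightarrow> ('e \<Rightarrow> ('e \<Rightarrow>\<^sub>L 'f) set) \<Rightarrow> bool"
  where "local_rep X Y f Jf x c d J \<longleftrightarrow>
           c \<in> charts_at X x \<and> d \<in> charts_at Y (f x) \<and> f ` chart_dom c \<subseteq> chart_dom d \<and>
           pseudo_jacobian_mapping (chart_ran c) (chart_map d \<circ> f \<circ> chart_inv c) J \<and>
           locally_bounded_mapping (chart_ran c) J \<and>
           (\<forall>u\<in>chart_dom c. Jf u = tangent_op X Y c d u (f u) ` J (chart_map c u))"

definition strong_pseudo_jacobian ::
    "('x::t2_space, 'e::banach) finsler \<Rightarrow> ('y::t2_space, 'f::banach) finsler \<Rightarrow> ('x \<Rightarrow> 'y) \<Rightarrow>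
     ('x \<Rightarrow> (('x, 'e) tvec \<Rightarrow> ('y, 'f) tvec) set) \<Rightarrow> bool"
  where "strong_pseudo_jacobian X Y f Jf \<longleftrightarrow>
           (\<forall>x. \<exists>c d J. local_rep X Y f Jf x c d J \<and>
              (\<forall>z\<in>chart_ran c. convex (J z) \<and> compactin weak_operator_topology (J z)))"


section \<open>Regularity index\<close>

definition dual_norm :: "'v::real_vector set \<Rightarrow> ('v \<Rightarrow> real) \<Rightarrow> ('v \<Rightarrow> real) \<Rightarrow> ennreal"
  where "dual_norm S n l = (SUP u\<in>{u\<in>S. n u \<le> 1}. ennreal \<bar>l u\<bar>)"

text \<open>
  The infimum is taken in \<^typ>\<open>ennreal\<close>, so that it is \<open>\<infinity>\<close> if the target space is trivial. A functional
  of dual norm 1 is automatically bounded.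
\<close>

definition C_finsler ::
    "('x::t2_space, 'e::banach) finsler \<Rightarrow> ('y::t2_space, 'f::banach) finsler \<Rightarrow> 'x \<Rightarrow> 'y \<Rightarrow>
     (('x, 'e) tvec \<Rightarrow> ('y, 'f) tvec) \<Rightarrow> ennreal"
  where "C_finsler X Y x y T =
           (INF l\<in>{l. linear_between (tangent_space Y y) UNIV l \<and>
                      dual_norm (tangent_space Y y) (fnorm Y y) l = 1}.
              dual_norm (tangent_space X x) (fnorm X x) (l \<circ> T))"

text \<open>
  The charts used to identify the operators in \<open>Jf u\<close>, \<open>u\<close> near \<open>x\<close>, with operators
  \<open>T\<^sub>x X \<rightarrow> T\<^bsub>f x\<^esub> Y\<close> are an arbitrary choice; neither the regularity index nor regularity depends on it.
\<close>

definition some_rep ::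
    "('x::t2_space, 'e::banach) finsler \<Rightarrow> ('y::t2_space, 'f::banach) finsler \<Rightarrow> ('x \<Rightarrow> 'y) \<Rightarrow>
     ('x \<Rightarrow> (('x, 'e) tvec \<Rightarrow> ('y, 'f) tvec) set) \<Rightarrow> 'x \<Rightarrow>
     ('x, 'e) chart \<times> ('y, 'f) chart \<times> ('e \<Rightarrow> ('e \<Rightarrow>\<^sub>L 'f) set)"
  where "some_rep X Y f Jf x = (SOME (c, d, J). local_rep X Y f Jf x c d J)"

definition small_radius ::
    "('x::t2_space, 'e::banach) finsler \<Rightarrow> ('y::t2_space, 'f::banach) finsler \<Rightarrow> ('x \<Rightarrow> 'y) \<Rightarrow>
     ('x \<Rightarrow> (('x, 'e) tvec \<Rightarrow> ('y, 'f) tvec) set) \<Rightarrow> 'x \<Rightarrow> real \<Rightarrow> bool"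
  where "small_radius X Y f Jf x R \<longleftrightarrow>
           R > 0 \<and> (case some_rep X Y f Jf x of (c, d, J) \<Rightarrow> fball X x R \<subseteq> chart_dom c)"

definition Jf_ball ::
    "('x::t2_space, 'e::banach) finsler \<Rightarrow> ('y::t2_space, 'f::banach) finsler \<Rightarrow> ('x \<Rightarrow> 'y) \<Rightarrow>
     ('x \<Rightarrow> (('x, 'e) tvec \<Rightarrow> ('y, 'f) tvec) set) \<Rightarrow> 'x \<Rightarrow> real \<Rightarrow>
     (('x, 'e) tvec \<Rightarrow> ('y, 'f) tvec) set"
  where "Jf_ball X Y f Jf x R =
           (case some_rep X Y f Jf x of (c, d, J) \<Rightarrow>
              \<Union>u\<in>fball X x R. tangent_op X Y c d x (f x) ` J (chart_map c u))"

definition reg_index ::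
    "('x::t2_space, 'e::banach) finsler \<Rightarrow> ('y::t2_space, 'f::banach) finsler \<Rightarrow> ('x \<Rightarrow> 'y) \<Rightarrow>
     ('x \<Rightarrow> (('x, 'e) tvec \<Rightarrow> ('y, 'f) tvec) set) \<Rightarrow> 'x \<Rightarrow> ennreal"
  where "reg_index X Y f Jf x =
           (SUP R\<in>{R. small_radius X Y f Jf x R}.
              INF T\<in>convex hull (Jf_ball X Y f Jf x R). C_finsler X Y x (f x) T)"

definition Jf_regular_at ::
    "('x::t2_space, 'e::banach) finsler \<Rightarrow> ('y::t2_space, 'f::banach) finsler \<Rightarrow> ('x \<Rightarrow> 'y) \<Rightarrow>
     ('x \<Rightarrow> (('x, 'e) tvec \<Rightarrow> ('y, 'f) tvec) set) \<Rightarrow> 'x \<Rightarrow> bool"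
  where "Jf_regular_at X Y f Jf x \<longleftrightarrow>
           reg_index X Y f Jf x > 0 \<and>
           (\<exists>R. small_radius X Y f Jf x R \<and>
              (\<forall>T\<in>convex hull (Jf_ball X Y f Jf x R).
                 linear_isomorphism (tangent_space X x) (tangent_space Y (f x)) T))"


section \<open>Weighted strong submersions and the pseudo-Lipschitz property\<close>

definition weight :: "(real \<Rightarrow> real) \<Rightarrow> bool"
  where "weight \<omega> \<longleftrightarrow> mono_on {0..} \<omega> \<and> (\<forall>\<rho>\<ge>0. \<omega> \<rho> > 0) \<and>
           (\<integral>\<^sup>+\<rho>\<in>{0..}. ennreal (1 / \<omega> \<rho>) \<partial>lborel) = \<infinity>"

definition weighted_strong_submersion ::
    "('x::t2_space, 'e::banach) finsler \<Rightarrow> ('y::t2_space, 'f::banach) finsler \<Rightarrow> ('x \<Rightarrow> 'y) \<Rightarrow>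
     ('x \<Rightarrow> (('x, 'e) tvec \<Rightarrow> ('y, 'f) tvec) set) \<Rightarrow> bool"
  where "weighted_strong_submersion X Y f Jf \<longleftrightarrow>
           (\<exists>x' \<omega>. weight \<omega> \<and>
              \<not> (\<exists>(s :: nat \<Rightarrow> 'x) y. (\<lambda>n. f (s n)) \<longlonglongrightarrow> y \<and>
                    (\<lambda>n. reg_index X Y f Jf (s n) * ennreal (\<omega> (fdist X x' (s n)))) \<longlonglongrightarrow> 0))"

text \<open>Distances to the empty set are \<open>\<infinity>\<close>.\<close>

definition set_fdist :: "('x::t2_space, 'e::banach) finsler \<Rightarrow> 'x \<Rightarrow> 'x set \<Rightarrow> ennreal"
  where "set_fdist X u A = (INF v\<in>A. ennreal (fdist X u v))"

definition pseudo_lipschitz_const ::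
    "('x::t2_space, 'e::banach) finsler \<Rightarrow> ('y::t2_space, 'f::banach) finsler \<Rightarrow> ('y \<Rightarrow> 'x set) \<Rightarrow>
     'y \<Rightarrow> 'x \<Rightarrow> real \<Rightarrow> bool"
  where "pseudo_lipschitz_const X Y g y x \<mu> \<longleftrightarrow> \<mu> > 0 \<and>
           (\<exists>V W. open V \<and> y \<in> V \<and> open W \<and> x \<in> W \<and>
              (\<forall>w\<in>V. \<forall>z\<in>V. \<forall>u\<in>W. u \<in> g w \<longrightarrow> set_fdist X u (g z) \<le> ennreal (\<mu> * fdist Y w z)))"

definition pseudo_lipschitz_around ::
    "('x::t2_space, 'e::banach) finsler \<Rightarrow> ('y::t2_space, 'f::banach) finsler \<Rightarrow> ('y \<Rightarrow> 'x set) \<Rightarrow>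
     'y \<Rightarrow> 'x \<Rightarrow> bool"
  where "pseudo_lipschitz_around X Y g y x \<longleftrightarrow> (\<exists>\<mu>. pseudo_lipschitz_const X Y g y x \<mu>)"

definition lip ::
    "('x::t2_space, 'e::banach) finsler \<Rightarrow> ('y::t2_space, 'f::banach) finsler \<Rightarrow> ('y \<Rightarrow> 'x set) \<Rightarrow>
     'y \<Rightarrow> 'x \<Rightarrow> ennreal"
  where "lip X Y g y x = (INF \<mu>\<in>{\<mu>. pseudo_lipschitz_const X Y g y x \<mu>}. ennreal \<mu>)"

end

(*
  Ekeland's variational principle together with the differentiability of the norm of Y replaces the Hahn-Banach
  theorem throughout. If all operators T in co Jf(B) are isomorphisms with C(T) > beta, then, in a chart and with
  the norms frozen at x, Ekeland's principle applied to u |-> |f(u) - y| shows that f is open with rate beta: at a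
  near-minimiser with f(u) <> y the derivative l of the norm has dual norm 1, and a minimax argument on the
  weak-operator compact convex set Jf(u) yields one direction v in which every l(T v) is less than -beta |v|.
  For linear f this gives |T v| >= beta |v|; combined with the mean value inequality and a separation argument
  (again Ekeland) it makes f expand distances by the factor beta near x. So f is a local homeomorphism with local
  inverses of Lipschitz constant 1/beta for each beta < C(Jf(x)), which is the bound on lip.

  For the covering property, let gamma be a partial lift of a segment in a chart ball of Y, and let eta(t) be the
  distance of gamma(t) from x*. The submersion condition bounds C(Jf) from below by c / omega(eta), so
  eta' <= B omega(eta) in the sense of right Dini derivatives; as the integral of 1/omega diverges, eta stays
  bounded, gamma is Lipschitz, and completeness lets it be continued. Continuing along all rays of the ball gives
  sections through every preimage, whose images are the sheets.
*)
theory Submission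
  imports Defs
begin

section \<open>Variational tools in Banach spaces\<close>

text \<open>Openness and injectivity draw on different sets of operators. Openness uses the values
  Jf(u) one at a time: a descent direction must serve every operator of Jf(u), and compactness is
  available only for a single value. Injectivity uses the hull over a ball: a chord f(v) - f(u) is
  compared with the vectors T(v - u) for T from a whole segment. The charts that witness strongness
  may differ from the charts that define the index. Compactness therefore enters only through the
  images of Jf(u) under one functional, a form that survives a change of charts. Near x, distances
  and norms frozen at x agree up to a factor 1 + \<epsilon> in X and in Y; the strict inequality
  \<beta> < C(Jf(x)) leaves room for both factors. The weight may jump, and the distance from x*
  need not be differentiable along a lift, so growth is measured by right increments and by a
  primitive of 1/\<omega> that is only Lipschitz. Local sections are taken over star-shaped sets
  because there they are determined by their value at the centre; this makes a largest one available
  as a plain union.\<close>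

text \<open>Mean value inequality for one-sided control, with \<delta> depending on the time: the
  times that satisfy the bound form a closed set, and the hypothesis pushes its supremum to the
  right until it reaches \<open>b\<close>.\<close>

lemma dini_le:
  fixes g :: "real \<Rightarrow> real"
  assumes "a \<le> b" "continuous_on {a..b} g"
    and d: "\<And>t. a \<le> t \<Longrightarrow> t < b \<Longrightarrow> \<exists>\<delta>>0. \<forall>s. t < s \<longrightarrow> s < t + \<delta> \<longrightarrow> s \<le> b \<longrightarrow> g s \<le> g t + A * (s - t)"
  shows "g b \<le> g a + A * (b - a)"
proof -
  define T where "T = {t\<in>{a..b}. g t \<le> g a + A * (t - a)}"
  have "closed T" unfolding T_def
    by (intro closed_Collect_le continuous_closed_preimage continuous_on_closed_Collect_le assms continuous_intros closed_atLeastAtMost)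
  moreover have ne: "a \<in> T" using assms(1) by (auto simp: T_def)
  moreover have bd: "bdd_above T" by (auto simp: T_def bdd_above_def)
  ultimately have c: "Sup T \<in> T" using closed_contains_Sup by blast
  have "Sup T = b"
  proof (rule ccontr)
    assume "Sup T \<noteq> b"
    then have lt: "Sup T < b" "a \<le> Sup T" using c by (auto simp: T_def)
    from d[OF lt(2,1)] obtain \<delta> where \<delta>: "\<delta> > 0" "\<And>s. Sup T < s \<Longrightarrow> s < Sup T + \<delta> \<Longrightarrow> s \<le> b \<Longrightarrow> g s \<le> g (Sup T) + A * (s - Sup T)"
      by blast
    define s where "s = min b (Sup T + \<delta>/2)"
    have s: "Sup T < s" "s < Sup T + \<delta>" "s \<le> b" using lt \<delta> by (auto simp: s_def min_def)
    have "g s \<le> g (Sup T) + A * (s - Sup T)" using \<delta>(2) s by blast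
    also have "\<dots> \<le> g a + A * (Sup T - a) + A * (s - Sup T)" using c by (auto simp: T_def)
    finally have "s \<in> T" using s lt by (auto simp: T_def algebra_simps)
    then show False using cSup_upper[OF _ bd] s(1) by force
  qed
  then show ?thesis using c by (auto simp: T_def)
qed

section \<open>Equivalent norms and Ekeland's principle\<close>

lemma equivalent_normD:
  assumes "equivalent_norm n"
  shows "0 \<le> n u" "n u = 0 \<longleftrightarrow> u = 0" "n (r *\<^sub>R u) = \<bar>r\<bar> * n u" "n (u + v) \<le> n u + n v"
    "n 0 = 0" "n (- u) = n u" "n (u - v) = n (v - u)" "n (u - w) \<le> n (u - v) + n (v - w)" "\<bar>n u - n v\<bar> \<le> n (u - v)"
proof -
  note h = assms[unfolded equivalent_norm_def norm_on_def]
  show 1: "0 \<le> n u" "n u = 0 \<longleftrightarrow> u = 0" for u using h by auto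
  show 2: "n (r *\<^sub>R u) = \<bar>r\<bar> * n u" for r u using h by auto
  show 3: "n (u + v) \<le> n u + n v" for u v using h by auto
  show "n 0 = 0" using 1 by auto
  show 4: "n (- u) = n u" for u using 2[of "-1" u] by simp
  show 5: "n (u - v) = n (v - u)" for u v using 4[of "v-u"] by simp
  show "n (u - w) \<le> n (u - v) + n (v - w)" using 3[of "u-v" "v-w"] by simp
  show "\<bar>n u - n v\<bar> \<le> n (u - v)" using 3[of "u-v" v] 3[of "v-u" u] 5[of u v] by simp
qed

lemma equivalent_norm_bounds:
  assumes "equivalent_norm n"
  obtains m M where "m > 0" "M > 0" "\<And>v. m * norm v \<le> n v" "\<And>v. n v \<le> M * norm v"
proof -
  obtain m M where m: "m > 0" "\<And>v. m * norm v \<le> n v" "\<And>v. n v \<le> M * norm v"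
    using assms unfolding equivalent_norm_def by blast
  show thesis
  proof (rule that[of m "max M 1"])
    fix v show "n v \<le> max M 1 * norm v"
      using m(3)[of v] mult_right_mono[of M "max M 1" "norm v"] by simp
  qed (use m in auto)
qed

lemma equivalent_norm_continuous:
  assumes "equivalent_norm n" shows "continuous_on S n"
proof -
  obtain m M where m: "M > 0" "\<And>v. n v \<le> M * norm v" using equivalent_norm_bounds[OF assms] by metis
  have "M-lipschitz_on UNIV n"
  proof (rule lipschitz_onI)
    fix x y show "dist (n x) (n y) \<le> M * dist x y"
      using equivalent_normD(9)[OF assms, of x y] m(2)[of "x-y"] by (simp add: dist_norm)
  qed (use m in auto)
  then show ?thesis using lipschitz_on_continuous_on continuous_on_subset by blast
qed

text \<open>Each \<open>x (Suc k)\<close> nearly minimises \<open>g\<close> over the set of points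
  below \<open>x k\<close> in Ekeland's order. The decrease of \<open>g\<close> controls the steps,
  so the sequence converges by completeness, and its limit is minimal in the order.\<close>

lemma ekeland:
  fixes n :: "'e::banach \<Rightarrow> real"
  assumes n: "equivalent_norm n" and S: "closed S" and g: "continuous_on S g"
    and pos: "\<And>x. x \<in> S \<Longrightarrow> 0 \<le> g x" and x0: "x0 \<in> S" and \<mu>: "\<mu> > 0"
  obtains u where "u \<in> S" "g u + \<mu> * n (u - x0) \<le> g x0"
    "\<And>v. v \<in> S \<Longrightarrow> g u \<le> g v + \<mu> * n (v - u)"
proof -
  \<comment> \<open>The lower set of \<open>x\<close> in Ekeland's order; \<open>Msub\<close> below
    is transitivity.\<close>
  define M where "M x = {v\<in>S. g v + \<mu> * n (v - x) \<le> g x}" for x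
  note nD = equivalent_normD[OF n]
  have Mself: "x \<in> S \<Longrightarrow> x \<in> M x" for x by (simp add: M_def nD)
  have Msub: "M v \<subseteq> M x" if "v \<in> M x" for v x
  proof
    fix w assume w: "w \<in> M v"
    have "\<mu> * n (w - x) \<le> \<mu> * n (w - v) + \<mu> * n (v - x)"
      using nD(8)[of w x v] \<mu> by (simp add: distrib_left[symmetric])
    then show "w \<in> M x" using w that by (auto simp: M_def)
  qed
  have ex: "\<exists>v. v \<in> M x \<and> (\<forall>w\<in>M x. g v \<le> g w + 1 / real (Suc k))" if xS: "x \<in> S" for x k
  proof -
    have bd: "bdd_below (g ` M x)" using pos by (auto simp: M_def bdd_below_def)
    have "Inf (g ` M x) < Inf (g ` M x) + 1 / real (Suc k)" by simp
    then obtain v where v: "v \<in> M x" "g v < Inf (g ` M x) + 1 / real (Suc k)"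
      using cInf_lessD[of "g ` M x"] Mself[OF xS] by blast
    have "g v \<le> g w + 1 / real (Suc k)" if "w \<in> M x" for w
      using cInf_lower[OF imageI[OF that] bd] v by linarith
    then show ?thesis using v by blast
  qed
  have "\<exists>x. \<forall>k. x k \<in> S \<and> (k = 0 \<longrightarrow> x k = x0) \<and> (x (Suc k) \<in> M (x k) \<and> (\<forall>w\<in>M (x k). g (x (Suc k)) \<le> g w + 1 / real (Suc k)))"
  proof -
    define P where "P k x \<longleftrightarrow> x \<in> S \<and> (k = 0 \<longrightarrow> x = x0)" for k :: nat and x
    define Q where "Q k x y \<longleftrightarrow> y \<in> M x \<and> (\<forall>w\<in>M x. g y \<le> g w + 1 / real (Suc k))" for k x y
    have "\<exists>f. \<forall>k. P k (f k) \<and> Q k (f k) (f (Suc k))"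
    proof (rule dependent_nat_choice)
      show "\<exists>x. P 0 x" using x0 by (auto simp: P_def)
      fix x k assume "P k x"
      then show "\<exists>y. P (Suc k) y \<and> Q k x y" using ex[of x k] unfolding P_def Q_def by (auto simp: M_def)
    qed
    then show ?thesis unfolding P_def Q_def by blast
  qed
  then obtain x where x: "\<And>k. x k \<in> S" "x 0 = x0" "\<And>k. x (Suc k) \<in> M (x k)"
    and near: "\<And>k w. w \<in> M (x k) \<Longrightarrow> g (x (Suc k)) \<le> g w + 1 / real (Suc k)" by metis
  have mono: "M (x l) \<subseteq> M (x k)" if "k \<le> l" for k l
    using that by (induction rule: dec_induct) (use Msub x in blast)+
  have inM: "x l \<in> M (x k)" if "k \<le> l" for k l using mono[OF that] Mself x by blast
  have dec: "decseq (\<lambda>k. g (x k))"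
  proof (rule decseq_SucI)
    fix k show "g (x (Suc k)) \<le> g (x k)" using x(3)[of k] nD(1)[of "x (Suc k) - x k"] \<mu>
      by (auto simp: M_def) (smt (verit) mult_nonneg_nonneg)
  qed
  obtain L where L: "(\<lambda>k. g (x k)) \<longlonglongrightarrow> L"
    using decseq_convergent[OF dec, of 0] pos x(1) by metis
  obtain m Mb where m: "m > 0" "\<And>v. m * norm v \<le> n v" using equivalent_norm_bounds[OF n] by metis
  \<comment> \<open>For \<open>k \<le> l\<close> the order gives
    \<open>\<mu> * n (x l - x k) \<le> g (x k) - g (x l)\<close>, and the values of \<open>g\<close>
    along the sequence converge.\<close>
  have "Cauchy x"
  proof (rule CauchyI)
    fix e :: real assume e: "e > 0"
    have "Cauchy (\<lambda>k. g (x k))" using L LIMSEQ_imp_Cauchy by blast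
    then obtain N where N: "\<And>i j. i \<ge> N \<Longrightarrow> j \<ge> N \<Longrightarrow> norm (g (x i) - g (x j)) < \<mu> * m * e"
      using CauchyD[of "\<lambda>k. g (x k)" "\<mu> * m * e"] \<mu> m e by (metis mult_pos_pos)
    have *: "norm (x l - x k) < e" if "N \<le> k" "k \<le> l" for k l
    proof -
      have "\<mu> * (m * norm (x l - x k)) \<le> \<mu> * n (x l - x k)" using m \<mu> by simp
      also have "\<dots> \<le> g (x k) - g (x l)" using inM[OF that(2)] by (auto simp: M_def)
      also have "\<dots> < \<mu> * m * e" using N[of k l] that by (auto simp: abs_less_iff)
      finally have "(\<mu> * m) * norm (x l - x k) < (\<mu> * m) * e" by (simp add: mult.assoc)
      then show ?thesis using \<mu> m by simp
    qed
    show "\<exists>N. \<forall>i\<ge>N. \<forall>j\<ge>N. norm (x i - x j) < e"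
      using * by (metis nle_le norm_minus_commute)
  qed
  then obtain u where u: "x \<longlonglongrightarrow> u" using Cauchy_convergent convergent_def by blast
  have uS: "u \<in> S" using S x(1) u closed_sequentially by blast
  have gu: "(\<lambda>k. g (x k)) \<longlonglongrightarrow> g u"
    using g u uS x(1) by (auto intro: continuous_on_tendsto_compose)
  have uM: "u \<in> M (x k)" for k
  proof -
    have "(\<lambda>l. g (x l) + \<mu> * n (x l - x k)) \<longlonglongrightarrow> g u + \<mu> * n (u - x k)"
      by (intro tendsto_intros gu u continuous_on_tendsto_compose[OF equivalent_norm_continuous[OF n, of UNIV]]) auto
    moreover have "\<forall>l\<ge>k. g (x l) + \<mu> * n (x l - x k) \<le> g (x k)" using inM by (auto simp: M_def)
    ultimately have "g u + \<mu> * n (u - x k) \<le> g (x k)" by (blast intro: LIMSEQ_le_const2)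
    then show ?thesis using uS by (simp add: M_def)
  qed
  show thesis
  proof (rule that[OF uS])
    show "g u + \<mu> * n (u - x0) \<le> g x0" using uM[of 0] x(2) by (simp add: M_def)
    fix v assume v: "v \<in> S"
    show "g u \<le> g v + \<mu> * n (v - u)"
    proof (rule ccontr)
      assume c: "\<not> ?thesis"
      \<comment> \<open>A point strictly below \<open>u\<close> is below every \<open>x k\<close>,
        so near-minimality forces \<open>g u \<le> g v\<close> in the limit, although
        \<open>g v\<close> is strictly smaller.\<close>
      then have "v \<in> M u" using v by (simp add: M_def)
      then have "g (x (Suc k)) \<le> g v + 1 / real (Suc k)" for k using near Msub[OF uM] by blast
      moreover have "(\<lambda>k. g v + 1 / real (Suc k)) \<longlonglongrightarrow> g v + 0"
        by (intro tendsto_intros LIMSEQ_Suc[OF lim_1_over_n])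
      ultimately have "g u \<le> g v + 0" using LIMSEQ_le[OF LIMSEQ_Suc[OF gu]] by blast
      then show False using c nD(1)[of "v - u"] \<mu> by (smt (verit) mult_nonneg_nonneg)
    qed
  qed
qed

section \<open>Differentiable norms: openness with a rate, and separation\<close>

lemma directional_derivative:
  fixes g :: "'a::real_normed_vector \<Rightarrow> real"
  assumes l: "(g has_derivative l) (at w)"
  shows "((\<lambda>t. (g (w + t *\<^sub>R v) - g w) / t) \<longlongrightarrow> l v) (at_right 0)"
proof -
  have "((\<lambda>t. g (w + t *\<^sub>R v)) has_derivative (\<lambda>t. l (t *\<^sub>R v))) (at 0)"
    by (rule has_derivative_compose[of "\<lambda>t. w + t *\<^sub>R v" "\<lambda>t. t *\<^sub>R v" 0 UNIV g l, simplified])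
       (use l in \<open>auto intro!: derivative_eq_intros\<close>)
  then have "((\<lambda>t. g (w + t *\<^sub>R v)) has_field_derivative l v) (at 0)"
    unfolding has_field_derivative_def by (simp add: linear_scale[OF has_derivative_linear[OF l]] mult_commute_abs)
  then show ?thesis unfolding DERIV_def by (auto intro: filterlim_at_split[THEN iffD1, THEN conjunct2])
qed

text \<open>The triangle inequality bounds the difference quotients in direction \<open>v\<close> by
  \<open>n v\<close>, and homogeneity makes them constantly \<open>n w\<close> in direction
  \<open>w\<close>. Hence the derivative is a norming functional at \<open>w\<close>.\<close>

lemma norm_derivative:
  assumes n: "equivalent_norm n" and l: "(n has_derivative l) (at w)"
  shows "\<bar>l v\<bar> \<le> n v" "l w = n w"
proof -
  note nD = equivalent_normD[OF n]
  have lin: "linear l" using l has_derivative_linear by blast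
  note lim = directional_derivative[OF l]
  have up: "l v \<le> n v" for v
  proof (rule tendsto_upperbound[OF lim])
    show "\<forall>\<^sub>F t in at_right 0. (n (w + t *\<^sub>R v) - n w) / t \<le> n v"
      using eventually_at_right_less[of 0]
    proof eventually_elim
      case (elim t)
      then show ?case using nD(4)[of w "t *\<^sub>R v"] nD(3)[of t v] by (simp add: field_simps)
    qed
  qed simp
  then show "\<bar>l v\<bar> \<le> n v"
    using up[of v] up[of "-v"] nD(6)[of v] linear_neg[OF lin, of v] by (auto simp: abs_le_iff)
  have "\<forall>\<^sub>F t in at_right 0. (n (w + t *\<^sub>R w) - n w) / t = n w"
    using eventually_at_right_less[of 0]
  proof eventually_elim
    case (elim t)
    have "w + t *\<^sub>R w = (1 + t) *\<^sub>R w" by (simp add: algebra_simps)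
    then show ?case using elim nD(3)[of "1+t" w] by (simp add: field_simps)
  qed
  then have "((\<lambda>t. (n (w + t *\<^sub>R w) - n w) / t) \<longlongrightarrow> n w) (at_right 0)"
    by (rule tendsto_eventually)
  then show "l w = n w" using tendsto_unique[OF _ lim] by auto
qed

text \<open>If the Ekeland point \<open>u\<close> missed \<open>y\<close>, the move along
  \<open>v\<close> would lower the linearised norm at a rate above \<open>\<beta> * nE v\<close>,
  while \<open>lip\<close> keeps the linearisation error of smaller order in \<open>t\<close>; this
  violates the slope condition at \<open>u\<close>. The bound on \<open>nE (u - x)\<close> is the
  other half of Ekeland's principle.\<close>

lemma open_core:
  fixes f :: "'e::banach \<Rightarrow> 'f::banach"
  assumes nE: "equivalent_norm nE" and nF: "equivalent_norm nF"
    and smooth: "\<And>w. w \<noteq> 0 \<Longrightarrow> nF differentiable (at w)"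
    and \<beta>: "\<beta> > 0" and f: "continuous_on {u. nE (u - x) \<le> r} f"
    and desc: "\<And>u l. nE (u - x) < r \<Longrightarrow> bounded_linear l \<Longrightarrow> (\<And>w. \<bar>l w\<bar> \<le> nF w) \<Longrightarrow> (\<exists>w. w \<noteq> 0 \<and> l w = nF w) \<Longrightarrow>
       \<exists>v \<kappa>. \<kappa> > \<beta> * nE v \<and> (\<forall>\<^sub>F t in at_right 0. l (f (u + t *\<^sub>R v)) - l (f u) \<le> - \<kappa> * t)"
    and lip: "\<And>u v. nE (u - x) < r \<Longrightarrow> \<exists>K. \<forall>\<^sub>F t in at_right 0. norm (f (u + t *\<^sub>R v) - f u) \<le> K * t"
    and y: "nF (y - f x) < \<beta> * r"
  shows "\<exists>u. nE (u - x) \<le> nF (y - f x) / \<beta> \<and> f u = y"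
proof -
  let ?S = "{u. nE (u - x) \<le> r}"
  note D = equivalent_normD[OF nE] and DF = equivalent_normD[OF nF]
  have cont: "continuous_on UNIV (\<lambda>u. nE (u - x))"
    by (rule continuous_on_compose2[OF equivalent_norm_continuous[OF nE, of UNIV]]) (auto intro!: continuous_intros)
  have S: "closed ?S" using cont by (intro closed_Collect_le) auto
  have o: "open {u. nE (u - x) < r}" using cont by (intro open_Collect_less) auto
  have r: "r > 0" using y DF(1)[of "y - f x"] \<beta> by (smt (verit) mult_pos_pos zero_less_mult_iff)
  have g: "continuous_on ?S (\<lambda>u. nF (f u - y))"
    by (rule continuous_on_compose2[OF equivalent_norm_continuous[OF nF, of UNIV]]) (auto intro!: continuous_intros f)
  obtain u where u: "u \<in> ?S" "nF (f u - y) + \<beta> * nE (u - x) \<le> nF (f x - y)"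
    "\<And>v. v \<in> ?S \<Longrightarrow> nF (f u - y) \<le> nF (f v - y) + \<beta> * nE (v - u)"
    using ekeland[OF nE S g, of x \<beta>] \<beta> r D(5) DF(1) by auto
  have b: "\<beta> * nE (u - x) \<le> nF (y - f x)" using u(2) DF(1)[of "f u - y"] DF(7)[of "f x" y] by linarith
  \<comment> \<open>Strictly inside the ball, so that small moves from \<open>u\<close> are
    admissible competitors.\<close>
  then have ux: "nE (u - x) < r" using y \<beta> by (smt (verit) mult_less_cancel_left_pos)
  have "f u = y"
  proof (rule ccontr)
    assume "f u \<noteq> y"
    then have w: "f u - y \<noteq> 0" by simp
    then obtain l where l: "(nF has_derivative l) (at (f u - y))" using smooth[OF w] by (auto simp: differentiable_def)
    note nl = norm_derivative[OF nF l]
    have bl: "bounded_linear l" using l by (rule has_derivative_bounded_linear)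
    obtain v \<kappa> where v: "\<kappa> > \<beta> * nE v" "\<forall>\<^sub>F t in at_right 0. l (f (u + t *\<^sub>R v)) - l (f u) \<le> - \<kappa> * t"
      using desc[OF ux bl nl(1)] w nl(2) by blast
    obtain K0 where "\<forall>\<^sub>F t in at_right 0. norm (f (u + t *\<^sub>R v) - f u) \<le> K0 * t" using lip[OF ux] by blast
    moreover define K where "K = max K0 1"
    ultimately have K: "\<forall>\<^sub>F t in at_right 0. norm (f (u + t *\<^sub>R v) - f u) \<le> K * t" "K > 0"
      by (auto elim!: eventually_elim2[OF _ eventually_at_right_less[of 0]] intro: order_trans mult_right_mono)
    \<comment> \<open>With this tolerance the linearisation error, at most \<open>e * K * t\<close>,
      consumes half of the gain \<open>(\<kappa> - \<beta> * nE v) * t\<close>.\<close>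
    define e where "e = (\<kappa> - \<beta> * nE v) / (2 * K)"
    have e: "e > 0" using v K by (simp add: e_def)
    obtain d where d: "d > 0" "\<And>w'. norm (w' - (f u - y)) < d \<Longrightarrow> norm (nF w' - nF (f u - y) - l (w' - (f u - y))) \<le> e * norm (w' - (f u - y))"
      using l e unfolding has_derivative_at_alt by meson
    have "\<forall>\<^sub>F t in at_right 0. K * t < d"
    proof -
      have "((\<lambda>t. K * t) \<longlongrightarrow> K * 0) (at_right 0)" by (intro tendsto_intros)
      then show ?thesis using order_tendstoD(2) d(1) by fastforce
    qed
    moreover have "\<forall>\<^sub>F t in at_right 0. u + t *\<^sub>R v \<in> {u. nE (u - x) < r}"
    proof -
      have "((\<lambda>t. u + t *\<^sub>R v) \<longlongrightarrow> u + 0 *\<^sub>R v) (at_right 0)" by (intro tendsto_intros)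
      then show ?thesis using topological_tendstoD[OF _ o] ux by auto
    qed
    ultimately have "\<forall>\<^sub>F t::real in at_right 0. False"
      using v(2) K(1) eventually_at_right_less[of 0]
    proof eventually_elim
      case (elim t)
      let ?D = "f (u + t *\<^sub>R v) - f u"
      have "norm ?D < d" using elim by linarith
      then have "nF (f u - y + ?D) \<le> nF (f u - y) + l ?D + e * norm ?D" using d(2)[of "f u - y + ?D"] by simp
      also have "l ?D \<le> - \<kappa> * t" using elim by (simp add: linear_diff[OF bounded_linear.linear[OF bl]])
      also have "e * norm ?D \<le> e * (K * t)" using elim e by (intro mult_left_mono) auto
      also have "e * (K * t) = (\<kappa> - \<beta> * nE v) / 2 * t" using K by (simp add: e_def)
      finally have 1: "nF (f (u + t *\<^sub>R v) - y) \<le> nF (f u - y) - \<kappa> * t + (\<kappa> - \<beta> * nE v) / 2 * t" by simp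
      have "nF (f u - y) \<le> nF (f (u + t *\<^sub>R v) - y) + \<beta> * nE (u + t *\<^sub>R v - u)"
        by (rule u(3)) (use elim in simp)
      then have "nF (f u - y) \<le> nF (f (u + t *\<^sub>R v) - y) + \<beta> * nE v * t" using D(3)[of t v] elim by (simp add: mult_ac)
      with 1 have "\<kappa> * t \<le> (\<kappa> - \<beta> * nE v) / 2 * t + \<beta> * nE v * t" by linarith
      then have "(\<kappa> - \<beta> * nE v) * t \<le> (\<kappa> - \<beta> * nE v) * t / 2" by (simp add: field_simps)
      moreover have "(\<kappa> - \<beta> * nE v) * t > 0" using v(1) elim by simp
      ultimately show False by linarith
    qed
    then show False by (simp add: trivial_limit_at_right_real)
  qed
  moreover have "nE (u - x) \<le> nF (y - f x) / \<beta>" using b \<beta> by (simp add: field_simps)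
  ultimately show ?thesis by blast
qed

text \<open>A nearest point of the closure to \<open>q\<close> may fail to exist; Ekeland supplies
  an almost nearest point \<open>u\<close>. The derivative \<open>l\<close> of the norm at
  \<open>u - q\<close> satisfies \<open>l (u - q) \<ge> d\<close>, and since segments from
  \<open>u\<close> stay in the closure, \<open>l (c - u)\<close> is at least
  \<open>- \<epsilon> * n (c - u)\<close>.\<close>

lemma separation:
  fixes n :: "'f::banach \<Rightarrow> real"
  assumes n: "equivalent_norm n" and smooth: "\<And>w. w \<noteq> 0 \<Longrightarrow> n differentiable (at w)"
    and C: "convex C" "C \<noteq> {}" "bounded C" and d: "d > 0" "\<And>c. c \<in> C \<Longrightarrow> d \<le> n (c - q)"
  shows "\<exists>l. bounded_linear l \<and> (\<forall>c\<in>C. l q + d / 2 \<le> l c)"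
proof -
  note D = equivalent_normD[OF n]
  let ?S = "closure C"
  have cont: "continuous_on A (\<lambda>u. n (u - q))" for A
    by (rule continuous_on_compose2[OF equivalent_norm_continuous[OF n, of UNIV]]) (auto intro!: continuous_intros)
  have dS: "d \<le> n (c - q)" if "c \<in> ?S" for c
    using continuous_ge_on_closure[OF cont[of "closure C"]] that d(2) by blast
  obtain M where M: "M > 0" "\<And>v. n v \<le> M * norm v" using equivalent_norm_bounds[OF n] by metis
  obtain B where B: "\<And>c. c \<in> ?S \<Longrightarrow> norm c \<le> B" using bounded_closure[OF C(3)] by (auto simp: bounded_iff)
  define E where "E = max 1 (M * (B + B))"
  have E: "n (c - c') \<le> E" if "c \<in> ?S" "c' \<in> ?S" for c c'
  proof -
    have "norm (c - c') \<le> B + B" using norm_triangle_ineq4[of c c'] B[OF that(1)] B[OF that(2)] by linarith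
    then have "M * norm (c - c') \<le> M * (B + B)" using M by (intro mult_left_mono) auto
    then show ?thesis using M(2)[of "c - c'"] by (simp add: E_def)
  qed
  \<comment> \<open>\<open>E\<close> bounds the diameter of the closure in the norm
    \<open>n\<close>, so the total loss \<open>\<epsilon> * E\<close> is exactly
    \<open>d / 2\<close>.\<close>
  define \<epsilon> where "\<epsilon> = d / (2 * E)"
  have \<epsilon>: "\<epsilon> > 0" using d by (simp add: \<epsilon>_def E_def)
  obtain x0 where x0: "x0 \<in> ?S" using C(2) closure_subset by blast
  obtain u where u: "u \<in> ?S" "\<And>v. v \<in> ?S \<Longrightarrow> n (u - q) \<le> n (v - q) + \<epsilon> * n (v - u)"
    by (rule ekeland[OF n closed_closure cont D(1) x0 \<epsilon>]) blast
  have "u - q \<noteq> 0" using dS[OF u(1)] d(1) D(2)[of "u - q"] by auto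
  from smooth[OF this] obtain l where l: "(n has_derivative l) (at (u - q))" by (auto simp: differentiable_def)
  note nl = norm_derivative[OF n l]
  have bl: "bounded_linear l" using l by (rule has_derivative_bounded_linear)
  note lin = bounded_linear.linear[OF bl]
  have "l q + d / 2 \<le> l c" if c: "c \<in> ?S" for c
  proof -
    note lim = directional_derivative[OF l, of "c - u"]
    have "\<forall>\<^sub>F t in at_right 0. - \<epsilon> * n (c - u) \<le> (n (u - q + t *\<^sub>R (c - u)) - n (u - q)) / t"
      using eventually_at_right_real[OF zero_less_one]
    proof eventually_elim
      case (elim t)
      have "(1 - t) *\<^sub>R u + t *\<^sub>R c \<in> ?S"
        using convexD_alt[OF convex_closure[OF C(1)] u(1) c, of t] elim by auto
      then have "u + t *\<^sub>R (c - u) \<in> ?S" by (simp add: algebra_simps)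
      from u(2)[OF this] have "n (u - q) \<le> n (u + t *\<^sub>R (c - u) - q) + \<epsilon> * (t * n (c - u))" using D(3)[of t] elim by simp
      moreover have "u + t *\<^sub>R (c - u) - q = u - q + t *\<^sub>R (c - u)" by simp
      ultimately show ?case using elim by (simp add: field_simps)
    qed
    then have "- \<epsilon> * n (c - u) \<le> l (c - u)" using tendsto_lowerbound[OF lim] by simp
    moreover have "\<epsilon> * n (c - u) \<le> d / 2" using mult_left_mono[OF E[OF c u(1)], of \<epsilon>] \<epsilon> by (simp add: \<epsilon>_def E_def)
    moreover have "l (u - q) \<ge> d" using nl(2) dS[OF u(1)] by simp
    ultimately show ?thesis by (simp add: linear_diff[OF lin])
  qed
  then show ?thesis using bl closure_subset by blast
qed


text \<open>The pairs \<open>(v, a)\<close> with \<open>\<beta> * n v \<le> a\<close> form a convex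
  cone. If the planar compact convex image of \<open>K\<close> missed the closed positive quadrant,
  a separating line would give a nonnegative combination of the two pairs for which
  \<open>ex\<close> fails. This is the induction step of the minimax argument; compactness of
  \<open>K\<close> refers to pointwise convergence.\<close>

lemma two_functionals:
  fixes K :: "('e::banach \<Rightarrow> real) set"
  assumes K: "compact K" "convex K" and lin: "\<And>k. k \<in> K \<Longrightarrow> linear k"
    and n: "equivalent_norm n" and \<beta>: "\<beta> \<ge> 0"
    and ex: "\<And>v a. \<beta> * n v \<le> a \<Longrightarrow> \<exists>k\<in>K. 0 \<le> k v + a"
    and v: "\<beta> * n v \<le> a" and v': "\<beta> * n v' \<le> a'"
  shows "\<exists>k\<in>K. 0 \<le> k v + a \<and> 0 \<le> k v' + a'"
proof (rule ccontr)
  assume no: "\<not> ?thesis"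
  note D = equivalent_normD[OF n]
  let ?h = "\<lambda>k. (k v + a, k v' + a')"
  let ?Q = "{0::real..} \<times> {0::real..}"
  have c: "compact (?h ` K)"
    by (intro compact_continuous_image K continuous_intros continuous_on_product_then_coordinatewise[OF continuous_on_id])
  have "convex ((\<lambda>k. (k v, k v')) ` K)"
    by (rule convex_linear_image[OF linearI K(2)]) (auto simp: scaleR_fun_def)
  then have "convex ((\<lambda>x. (a, a') + x) ` (\<lambda>k. (k v, k v')) ` K)" by (rule convex_translation)
  also have "(\<lambda>x. (a, a') + x) ` (\<lambda>k. (k v, k v')) ` K = ?h ` K" by (simp add: image_image add.commute)
  finally have cv: "convex (?h ` K)" .
  have ne: "K \<noteq> {}" using ex[OF v] by auto
  have disj: "?Q \<inter> ?h ` K = {}"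
  proof (rule ccontr)
    assume "\<not> ?thesis"
    then obtain k where "k \<in> K" "?h k \<in> ?Q" by blast
    then show False using no by (auto simp: mem_Times_iff)
  qed
  have Q: "convex ?Q" "closed ?Q" by (auto intro: convex_Times closed_Times)
  have "?h ` K \<noteq> {}" using ne by simp
  from separating_hyperplane_closed_compact[OF Q cv c this disj]
  obtain z b where zb: "\<forall>x\<in>?Q. z \<bullet> x < b" "\<forall>x\<in>?h ` K. b < z \<bullet> x"
    by (elim exE conjE)
  note z = zb[rule_format]
  obtain p q where pq: "z = (p, q)" by fastforce
  have b: "b > 0" using z(1)[of "(0,0)"] by (simp add: pq)
  \<comment> \<open>The quadrant is unbounded in both coordinate directions and lies in the half
    plane \<open>z \<bullet> x < b\<close>, so neither weight can be positive.\<close>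
  have "p \<le> 0"
  proof (rule ccontr)
    assume "\<not> p \<le> 0" then show False using z(1)[of "(b / p, 0)"] b by (simp add: pq)
  qed
  have "q \<le> 0"
  proof (rule ccontr)
    assume "\<not> q \<le> 0" then show False using z(1)[of "(0, b / q)"] b by (simp add: pq)
  qed
  \<comment> \<open>The combined pair again belongs to the cone, so \<open>ex\<close> applies to
    it.\<close>
  let ?w = "(-p) *\<^sub>R v + (-q) *\<^sub>R v'" and ?c = "(-p) * a + (-q) * a'"
  have "\<beta> * n ?w \<le> \<beta> * ((-p) * n v + (-q) * n v')"
    using D(4)[of "(-p) *\<^sub>R v" "(-q) *\<^sub>R v'"] D(3)[of "-p" v] D(3)[of "-q" v'] \<open>p \<le> 0\<close> \<open>q \<le> 0\<close> \<beta>
    by (intro mult_left_mono) auto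
  also have "\<dots> = (-p) * (\<beta> * n v) + (-q) * (\<beta> * n v')" by (simp add: algebra_simps)
  also have "\<dots> \<le> ?c" by (intro add_mono mult_left_mono v v') (use \<open>p \<le> 0\<close> \<open>q \<le> 0\<close> in auto)
  finally obtain k where k: "k \<in> K" "0 \<le> k ?w + ?c" using ex by blast
  have "k ?w = (-p) * k v + (-q) * k v'"
    by (simp only: linear_add[OF lin[OF k(1)]] linear_scale[OF lin[OF k(1)]] real_scaleR_def)
  then show False using k z(2)[of "?h k"] b by (auto simp: pq algebra_simps)
qed

text \<open>Each \<open>v\<close> has its own \<open>k\<close> in the hypothesis, and one
  \<open>k\<close> serves all \<open>v\<close> in the conclusion. By compactness it is enough to
  treat finitely many \<open>v\<close>; these are imposed one after another, each time cutting
  \<open>K\<close> down to a compact convex slice on which \<open>two_functionals\<close> restores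
  the hypothesis.\<close>

lemma minimax:
  fixes K :: "('e::banach \<Rightarrow> real) set"
  assumes K: "compact K" "convex K" and lin: "\<And>k. k \<in> K \<Longrightarrow> linear k"
    and n: "equivalent_norm n" and \<beta>: "\<beta> \<ge> 0"
    and ex: "\<And>v. \<exists>k\<in>K. - \<beta> * n v \<le> k v"
  shows "\<exists>k\<in>K. \<forall>v. - \<beta> * n v \<le> k v"
proof -
  have closed: "closed {k :: 'e \<Rightarrow> real. c \<le> k v + a}" for v a c
    by (intro closed_Collect_le continuous_intros continuous_on_product_then_coordinatewise[OF continuous_on_id])
  \<comment> \<open>Stated for arbitrary compact convex sets, since the induction passes to slices,
    and for arbitrary pairs of the cone, since its hypothesis on \<open>K\<close> is formulated for
    such pairs.\<close>
  have fin: "\<exists>k\<in>K. \<forall>(v, a)\<in>I. 0 \<le> k v + a"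
    if "finite I" "\<forall>(v, a)\<in>I. \<beta> * n v \<le> a" "compact K" "convex K" "\<And>k. k \<in> K \<Longrightarrow> linear k"
      "\<And>v a. \<beta> * n v \<le> a \<Longrightarrow> \<exists>k\<in>K. 0 \<le> k v + a" for I and K :: "('e \<Rightarrow> real) set"
    using that
  proof (induction I arbitrary: K rule: finite_induct)
    case empty
    have "\<exists>k\<in>K. 0 \<le> k 0 + 0" by (rule empty.prems) (simp add: equivalent_normD(5)[OF n])
    then show ?case by blast
  next
    case (insert i I)
    obtain v a where i: "i = (v, a)" by fastforce
    let ?K = "K \<inter> {k. 0 \<le> k v + a}"
    have va: "\<beta> * n v \<le> a" using insert.prems i by auto
    have "\<exists>k\<in>?K. \<forall>(v, a)\<in>I. 0 \<le> k v + a"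
    proof (rule insert.IH)
      show "\<forall>(v, a)\<in>I. \<beta> * n v \<le> a" using insert.prems by auto
      show "compact ?K" by (intro compact_Int_closed insert.prems closed)
      show "convex ?K"
      proof (intro convex_Int insert.prems convexI)
        fix x y :: "'e \<Rightarrow> real" and s t :: real
        assume h: "x \<in> {k. 0 \<le> k v + a}" "y \<in> {k. 0 \<le> k v + a}" "0 \<le> s" "0 \<le> t" "s + t = 1"
        have "0 \<le> s * (x v + a) + t * (y v + a)" using h by auto
        also have "\<dots> = s * x v + t * y v + (s + t) * a" by (simp add: algebra_simps)
        finally show "s *\<^sub>R x + t *\<^sub>R y \<in> {k. 0 \<le> k v + a}" using h by (simp add: scaleR_fun_def)
      qed
      show "linear k" if "k \<in> ?K" for k using insert.prems that by auto
      show "\<exists>k\<in>?K. 0 \<le> k v' + a'" if "\<beta> * n v' \<le> a'" for v' a'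
        using two_functionals[OF insert.prems(2-4) n \<beta> insert.prems(5) va that] by blast
    qed
    then show ?case by (auto simp: i)
  qed
  have ex': "\<exists>k\<in>K. 0 \<le> k v + a" if "\<beta> * n v \<le> a" for v a
  proof -
    obtain k where "k \<in> K" "- \<beta> * n v \<le> k v" using ex[of v] by blast
    then show ?thesis using that by (intro bexI[of _ k]) auto
  qed
  have "K \<inter> (\<Inter>v. {k. 0 \<le> k v + \<beta> * n v}) \<noteq> {}"
  proof (rule compact_imp_fip_image[OF K(1)])
    fix I :: "'e set" assume I: "finite I"
    have "\<exists>k\<in>K. \<forall>(v, a)\<in>(\<lambda>v. (v, \<beta> * n v)) ` I. 0 \<le> k v + a"
      by (rule fin) (use I K lin ex' in auto)
    then show "K \<inter> (\<Inter>v\<in>I. {k. 0 \<le> k v + \<beta> * n v}) \<noteq> {}" by auto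
  qed (rule closed)
  then obtain k where "k \<in> K" "\<And>v. 0 \<le> k v + \<beta> * n v" by blast
  moreover have "- \<beta> * n v \<le> k v" for v using \<open>\<And>v. 0 \<le> k v + \<beta> * n v\<close>[of v] by simp
  ultimately show ?thesis by blast
qed

text \<open>Along the segment, the pseudo-Jacobian inequality in the direction \<open>v - u\<close>
  bounds the upper right Dini derivative of \<open>l \<circ> f\<close> by \<open>M\<close>. Since a
  limsup bound yields increments only for slopes above \<open>M\<close>, the argument runs with
  \<open>M + \<eta>\<close>.\<close>

lemma pj_mean_value:
  fixes f :: "'e::banach \<Rightarrow> 'f::banach" and l :: "'f \<Rightarrow>\<^sub>L real"
  assumes pj: "\<And>z. z \<in> closed_segment u v \<Longrightarrow> pseudo_jacobian_at f z (J z)"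
    and f: "continuous_on (closed_segment u v) f"
    and M: "\<And>z T. z \<in> closed_segment u v \<Longrightarrow> T \<in> J z \<Longrightarrow> l (blinfun_apply T (v - u)) \<le> M"
  shows "l (f v) - l (f u) \<le> M"
proof (rule field_le_epsilon)
  fix \<eta> :: real assume \<eta>: "\<eta> > 0"
  define w where "w = v - u"
  define g where "g t = l (f (u + t *\<^sub>R w))" for t
  have seg: "u + t *\<^sub>R w \<in> closed_segment u v" if "0 \<le> t" "t \<le> 1" for t
    using that by (auto simp: in_segment w_def algebra_simps intro!: exI[of _ t])
  have g: "continuous_on {0..1} g" unfolding g_def
    by (intro continuous_intros continuous_on_compose2[OF f]) (use seg in auto)
  have "g 1 \<le> g 0 + (M + \<eta>) * (1 - 0)"
  proof (rule dini_le[OF _ g])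
    fix t :: real assume t: "0 \<le> t" "t < 1"
    let ?z = "u + t *\<^sub>R w"
    have z: "?z \<in> closed_segment u v" using seg t by simp
    have "Limsup (at_right 0) (\<lambda>t. ereal ((l (f (?z + t *\<^sub>R w)) - l (f ?z)) / t)) \<le> (SUP T\<in>J ?z. ereal (l (blinfun_apply T w)))"
      by (rule pj[OF z, unfolded pseudo_jacobian_at_def, THEN conjunct2, rule_format])
    also have "\<dots> \<le> ereal M" using M[OF z] by (auto intro!: SUP_least simp: w_def)
    also have "\<dots> < ereal (M + \<eta>)" using \<eta> by simp
    finally have "\<forall>\<^sub>F t in at_right 0. ereal ((l (f (?z + t *\<^sub>R w)) - l (f ?z)) / t) < ereal (M + \<eta>)"
      by (rule Limsup_lessD)
    then obtain \<delta> where \<delta>: "\<delta> > 0" "\<And>s. 0 < s \<Longrightarrow> s < \<delta> \<Longrightarrow> (l (f (?z + s *\<^sub>R w)) - l (f ?z)) / s < M + \<eta>"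
      unfolding eventually_at_right[OF zero_less_one] by auto
    show "\<exists>\<delta>>0. \<forall>s>t. s < t + \<delta> \<longrightarrow> s \<le> 1 \<longrightarrow> g s \<le> g t + (M + \<eta>) * (s - t)"
    proof (intro exI[of _ \<delta>] conjI allI impI)
      fix s assume s: "t < s" "s < t + \<delta>"
      have "?z + (s - t) *\<^sub>R w = u + s *\<^sub>R w" by (simp add: algebra_simps)
      then show "g s \<le> g t + (M + \<eta>) * (s - t)" using \<delta>(2)[of "s - t"] s by (simp add: g_def field_simps)
    qed (use \<delta> in auto)
  qed simp
  then show "l (f v) - l (f u) \<le> M + \<eta>" by (simp add: g_def w_def)
qed

text \<open>If every direction failed for some operator of \<open>J\<close>, the minimax lemma would
  produce one operator that fails for every direction, against \<open>low\<close>. Compactness is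
  used once more to make the supremum of \<open>l (T v)\<close> over \<open>J\<close> a maximum,
  which leaves a gap for \<kappa>.\<close>

lemma pj_descent:
  fixes f :: "'e::banach \<Rightarrow> 'f::banach" and l :: "'f \<Rightarrow>\<^sub>L real"
  assumes pj: "pseudo_jacobian_at f u J" and n: "equivalent_norm n" and \<beta>: "\<beta> \<ge> 0"
    and K: "compact ((\<lambda>T v. l (blinfun_apply T v)) ` J)" "convex ((\<lambda>T v. l (blinfun_apply T v)) ` J)"
    and low: "\<And>T. T \<in> J \<Longrightarrow> \<exists>w. n w \<le> 1 \<and> l (T w) < - \<beta>"
  shows "\<exists>v \<kappa>. \<kappa> > \<beta> * n v \<and> (\<forall>\<^sub>F t in at_right 0. l (f (u + t *\<^sub>R v)) - l (f u) \<le> - \<kappa> * t)"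
proof -
  let ?K = "(\<lambda>T v. l (blinfun_apply T v)) ` J"
  have "\<exists>v. \<forall>k\<in>?K. k v < - \<beta> * n v"
  proof (rule ccontr)
    assume "\<not> ?thesis"
    then have "\<exists>k\<in>?K. \<forall>v. - \<beta> * n v \<le> k v"
      by (intro minimax[OF K _ n \<beta>]) (auto simp: not_less blinfun.add_right blinfun.scaleR_right intro!: linearI)
    then obtain T where T: "T \<in> J" "\<And>v. - \<beta> * n v \<le> l (T v)" by auto
    obtain w where w: "n w \<le> 1" "l (T w) < - \<beta>" using low[OF T(1)] by blast
    have "- \<beta> \<le> - \<beta> * n w" using mult_left_mono[OF w(1) \<beta>] by simp
    then show False using T(2)[of w] w by linarith
  qed
  then obtain v where v: "\<And>T. T \<in> J \<Longrightarrow> l (T v) < - \<beta> * n v" by auto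
  have "J \<noteq> {}" using pj by (simp add: pseudo_jacobian_at_def)
  then have "\<exists>k\<in>?K. \<forall>k'\<in>?K. k' v \<le> k v"
    by (intro continuous_attains_sup K continuous_on_product_then_coordinatewise[OF continuous_on_id]) auto
  then obtain T where T: "T \<in> J" "\<And>T'. T' \<in> J \<Longrightarrow> l (T' v) \<le> l (T v)" by auto
  \<comment> \<open>The midpoint of \<open>\<beta> * n v\<close> and \<open>- l (T v)\<close>, where
    \<open>T\<close> maximises \<open>l (T v)\<close>.\<close>
  define \<kappa> where "\<kappa> = (\<beta> * n v - l (T v)) / 2"
  have k: "\<kappa> > \<beta> * n v" "l (T v) < - \<kappa>" using v[OF T(1)] by (auto simp: \<kappa>_def field_simps)
  have "Limsup (at_right 0) (\<lambda>t. ereal ((l (f (u + t *\<^sub>R v)) - l (f u)) / t)) \<le> (SUP T\<in>J. ereal (l (blinfun_apply T v)))"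
    by (rule pj[unfolded pseudo_jacobian_at_def, THEN conjunct2, rule_format])
  also have "\<dots> \<le> ereal (l (blinfun_apply T v))" using T by (auto intro!: SUP_least)
  also have "\<dots> < ereal (- \<kappa>)" using k by simp
  finally have "\<forall>\<^sub>F t in at_right 0. ereal ((l (f (u + t *\<^sub>R v)) - l (f u)) / t) < ereal (- \<kappa>)"
    by (rule Limsup_lessD)
  then have "\<forall>\<^sub>F t in at_right 0. l (f (u + t *\<^sub>R v)) - l (f u) \<le> - \<kappa> * t"
    using eventually_at_right_less[of 0] by eventually_elim (simp add: field_simps)
  then show ?thesis using k by blast
qed

text \<open>\<open>open_core\<close> at the origin with target \<open>T v\<close> yields a preimage
  whose norm is at most \<open>nF (T v) / \<beta>\<close>, and injectivity identifies this preimage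
  with \<open>v\<close>.\<close>

lemma isomorphism_lower_bound:
  fixes T :: "'e::banach \<Rightarrow>\<^sub>L 'f::banach"
  assumes nE: "equivalent_norm nE" and nF: "equivalent_norm nF"
    and smooth: "\<And>w. w \<noteq> 0 \<Longrightarrow> nF differentiable (at w)" and \<beta>: "\<beta> > 0"
    and inj: "inj (blinfun_apply T)"
    and low: "\<And>l. bounded_linear l \<Longrightarrow> (\<And>w. \<bar>l w\<bar> \<le> nF w) \<Longrightarrow> (\<exists>w. w \<noteq> 0 \<and> l w = nF w) \<Longrightarrow> \<exists>w. nE w \<le> 1 \<and> l (T w) < - \<beta>"
  shows "\<beta> * nE v \<le> nF (T v)"
proof -
  \<comment> \<open>The summand 1 makes the target strictly closer than
    \<open>\<beta> * r\<close>.\<close>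
  define r where "r = nF (T v) / \<beta> + 1"
  have "\<exists>u. nE (u - 0) \<le> nF (T v - T 0) / \<beta> \<and> T u = T v"
  proof (rule open_core[OF nE nF smooth \<beta>, where r = r])
    show "continuous_on {u. nE (u - 0) \<le> r} (blinfun_apply T)" by (intro continuous_intros)
    fix u :: 'e and l :: "'f \<Rightarrow> real"
    assume l: "bounded_linear l" "\<And>w. \<bar>l w\<bar> \<le> nF w" "\<exists>w. w \<noteq> 0 \<and> l w = nF w"
    obtain w where w: "nE w \<le> 1" "l (T w) < - \<beta>" using low[OF l] by blast
    have "\<beta> * nE w \<le> \<beta>" using mult_left_mono[OF w(1), of \<beta>] \<beta> by simp
    then have "- l (T w) > \<beta> * nE w" using w by linarith
    moreover have "l (T (u + t *\<^sub>R w)) - l (T u) = - (- l (T w)) * t" for t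
      using linear_add[OF bounded_linear.linear[OF l(1)]] linear_scale[OF bounded_linear.linear[OF l(1)]]
      by (simp add: blinfun.add_right blinfun.scaleR_right)
    ultimately show "\<exists>w \<kappa>. \<kappa> > \<beta> * nE w \<and> (\<forall>\<^sub>F t in at_right 0. l (T (u + t *\<^sub>R w)) - l (T u) \<le> - \<kappa> * t)"
      by (intro exI[of _ w] exI[of _ "- l (T w)"]) simp
  next
    fix u w :: 'e
    have "norm (T (u + t *\<^sub>R w) - T u) = norm (T w) * t" if "t > 0" for t :: real
      using that by (simp add: blinfun.add_right blinfun.scaleR_right)
    then show "\<exists>K. \<forall>\<^sub>F t in at_right 0. norm (T (u + t *\<^sub>R w) - T u) \<le> K * t"
      by (intro exI[of _ "norm (T w)"] eventually_mono[OF eventually_at_right_less[of 0]]) simp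
  next
    show "nF (T v - T 0) < \<beta> * r" using \<beta> by (simp add: r_def blinfun.zero_right field_simps)
  qed
  then have "nE v \<le> nF (T v) / \<beta>" using inj by (auto simp: blinfun.zero_right dest: injD)
  then show ?thesis using \<beta> by (simp add: field_simps)
qed

text \<open>If the increment of \<open>f\<close> were too short, it would keep a positive distance
  from the convex set of all \<open>T (v - u)\<close>. A functional separating the two contradicts
  the mean value inequality.\<close>

lemma pj_expansive:
  fixes f :: "'e::banach \<Rightarrow> 'f::banach"
  assumes nE: "equivalent_norm nE" and nF: "equivalent_norm nF"
    and smooth: "\<And>w. w \<noteq> 0 \<Longrightarrow> nF differentiable (at w)"
    and pj: "\<And>z. z \<in> closed_segment u v \<Longrightarrow> pseudo_jacobian_at f z (J z)"
    and f: "continuous_on (closed_segment u v) f"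
    and bd: "bounded (\<Union>z\<in>closed_segment u v. J z)"
    and low: "\<And>T w. T \<in> convex hull (\<Union>z\<in>closed_segment u v. J z) \<Longrightarrow> \<beta> * nE w \<le> nF (blinfun_apply T w)"
  shows "\<beta> * nE (v - u) \<le> nF (f v - f u)"
proof (rule ccontr)
  assume neg: "\<not> ?thesis"
  note DF = equivalent_normD[OF nF]
  let ?H = "convex hull (\<Union>z\<in>closed_segment u v. J z)"
  let ?C = "(\<lambda>T. blinfun_apply T (v - u)) ` ?H"
  \<comment> \<open>The deficit \<open>d\<close> bounds the distance from \<open>q\<close> to the
    convex set from below, by the reverse triangle inequality.\<close>
  define q d where "q = f v - f u" and "d = \<beta> * nE (v - u) - nF (f v - f u)"
  have bl: "bounded_linear (\<lambda>T. blinfun_apply T (v - u))" by (rule blinfun.bounded_linear_left)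
  have "convex ?C" by (intro convex_linear_image bounded_linear.linear[OF bl] convex_convex_hull)
  moreover have "bounded ?C" by (intro bounded_linear_image[OF _ bl] bounded_convex_hull bd)
  moreover have "J u \<noteq> {}" using pj[of u] by (simp add: pseudo_jacobian_at_def)
  then have "?C \<noteq> {}" by (auto simp: Bex_def)
  moreover have "d > 0" using neg by (simp add: d_def)
  moreover have "d \<le> nF (c - q)" if "c \<in> ?C" for c
  proof -
    have "\<beta> * nE (v - u) \<le> nF c" using that low by auto
    then show ?thesis using DF(4)[of "c - q" q] by (simp add: d_def q_def)
  qed
  ultimately obtain l where l: "bounded_linear l" "\<And>c. c \<in> ?C \<Longrightarrow> l q + d / 2 \<le> l c"
    using separation[OF nF smooth, of ?C d q] by blast
  \<comment> \<open>The sign is reversed because the mean value inequality bounds increments from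
    above, whereas the separation bounds \<open>l\<close> on the convex set from below.\<close>
  define L where "L = Blinfun (\<lambda>w. - l w)"
  have L: "blinfun_apply L = (\<lambda>w. - l w)" unfolding L_def
    by (rule bounded_linear_Blinfun_apply) (intro bounded_linear_minus l)
  have "L (f v) - L (f u) \<le> - (l q + d / 2)"
  proof (rule pj_mean_value[OF pj f])
    fix z T assume "z \<in> closed_segment u v" "T \<in> J z"
    then have "T (v - u) \<in> ?C" by (intro imageI hull_inc) auto
    then show "L (T (v - u)) \<le> - (l q + d / 2)" using l(2)[of "T (v - u)"] by (simp add: L)
  qed
  then show False using \<open>d > 0\<close> by (simp add: L q_def linear_diff[OF bounded_linear.linear[OF l(1)]])
qed


section \<open>The Finsler distance\<close>

definition chart_norm ::
    "('x::t2_space, 'e::banach) finsler \<Rightarrow> ('x, 'e) chart \<Rightarrow> 'x \<Rightarrow> 'e \<Rightarrow> real"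
  where "chart_norm X c x v = fnorm X x (d_chart_inv X c x v)"

section \<open>Charts and their transition maps\<close>

lemma is_chartD:
  assumes "is_chart c"
  shows "open (chart_dom c)" "open (chart_ran c)"
    "x \<in> chart_dom c \<Longrightarrow> chart_inv c (chart_map c x) = x"
    "x \<in> chart_dom c \<Longrightarrow> chart_map c x \<in> chart_ran c"
    "z \<in> chart_ran c \<Longrightarrow> chart_map c (chart_inv c z) = z"
    "z \<in> chart_ran c \<Longrightarrow> chart_inv c z \<in> chart_dom c"
    "continuous_on (chart_dom c) (chart_map c)"
    "continuous_on (chart_ran c) (chart_inv c)"
  using assms by (auto simp: is_chart_def homeomorphism_def)

lemma charts_at_iff: "c \<in> charts_at X x \<longleftrightarrow> c \<in> charts X \<and> x \<in> chart_dom c"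
  by (auto simp: charts_at_def)

lemma charts_is_chart: "c \<in> charts X \<Longrightarrow> is_chart c"
  by (auto simp: charts_def)

lemma d_transition_has_derivative:
  assumes "C1_manifold X" "c \<in> charts_at X x" "c' \<in> charts_at X x"
  shows "(transition c c' has_derivative d_transition c c' x) (at (chart_map c x))"
  using transition_differentiable[OF assms] by (simp add: d_transition_def frechet_derivative_works)

lemma C1_onE:
  assumes "C1_on S g"
  obtains D where "continuous_on S D" "\<And>z. z \<in> S \<Longrightarrow> (g has_derivative blinfun_apply (D z)) (at z)"
  using assms by (auto simp: C1_on_def)

text \<open>Membership in \<open>charts\<close> demands compatibility with the atlas only. Around
  each point the transition factors through an atlas chart, and the derivative is there a continuous
  composition of two continuous derivatives.\<close>

lemma charts_C1_transition:
  assumes X: "C1_manifold X" and c: "c \<in> charts X" and c': "c' \<in> charts X"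
  shows "C1_on (chart_map c ` (chart_dom c \<inter> chart_dom c')) (transition c c')"
proof -
  define D where "D z = Blinfun (d_transition c c' (chart_inv c z))" for z
  note ic = charts_is_chart[OF c] and ic' = charts_is_chart[OF c']
  note hc = is_chartD[OF ic] and hc' = is_chartD[OF ic']
  have der: "(transition c c' has_derivative blinfun_apply (D (chart_map c x))) (at (chart_map c x))"
    and Dapp: "blinfun_apply (D (chart_map c x)) = d_transition c c' x"
    if "x \<in> chart_dom c" "x \<in> chart_dom c'" for x
  proof -
    have h: "(transition c c' has_derivative d_transition c c' x) (at (chart_map c x))"
      using d_transition_has_derivative[OF X] c c' that by (simp add: charts_at_iff)
    then show "blinfun_apply (D (chart_map c x)) = d_transition c c' x"
      by (simp add: D_def hc that bounded_linear_Blinfun_apply has_derivative_bounded_linear)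
    with h show "(transition c c' has_derivative blinfun_apply (D (chart_map c x))) (at (chart_map c x))" by simp
  qed
  have "isCont D (chart_map c x)" if x: "x \<in> chart_dom c" "x \<in> chart_dom c'" for x
  proof -
    have "x \<in> (\<Union>c\<in>atlas X. chart_dom c)" using X unfolding C1_manifold_def by blast
    then obtain a where a: "a \<in> atlas X" "x \<in> chart_dom a" by blast
    have ia: "is_chart a" using X a by (auto simp: C1_manifold_def)
    have aX: "a \<in> charts X" using X a(1) unfolding C1_manifold_def charts_def by blast
    obtain D1 where D1: "continuous_on (chart_map c ` (chart_dom c \<inter> chart_dom a)) D1"
      "\<And>z. z \<in> chart_map c ` (chart_dom c \<inter> chart_dom a) \<Longrightarrow> (transition c a has_derivative blinfun_apply (D1 z)) (at z)"
      using c a(1) C1_onE unfolding charts_def C1_compatible_def by blast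
    obtain D2 where D2: "continuous_on (chart_map a ` (chart_dom c' \<inter> chart_dom a)) D2"
      "\<And>z. z \<in> chart_map a ` (chart_dom c' \<inter> chart_dom a) \<Longrightarrow> (transition a c' has_derivative blinfun_apply (D2 z)) (at z)"
      using c' a(1) C1_onE unfolding charts_def C1_compatible_def by blast
    let ?S = "chart_map c ` (chart_dom c \<inter> (chart_dom a \<inter> chart_dom c'))"
    have oS: "open ?S" using is_chartD(1)[OF ia] hc'(1) by (intro overlap_open ic open_Int) auto
    have eq: "D z = D2 (transition c a z) o\<^sub>L D1 z" if z: "z \<in> ?S" for z
    proof -
      obtain y where y: "z = chart_map c y" "y \<in> chart_dom c" "y \<in> chart_dom a" "y \<in> chart_dom c'" using z by auto
      have at: "c \<in> charts_at X y" "a \<in> charts_at X y" "c' \<in> charts_at X y"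
        using c aX c' y by (auto simp: charts_at_iff)
      have e: "transition c a z = chart_map a y" using y hc by (simp add: transition_def)
      have "blinfun_apply (D1 z) = d_transition c a y"
        using has_derivative_unique[OF D1(2) d_transition_has_derivative[OF X at(1,2)]] y by blast
      moreover have "blinfun_apply (D2 (transition c a z)) = d_transition a c' y"
        using has_derivative_unique[OF D2(2) d_transition_has_derivative[OF X at(2,3)]] y e by auto
      ultimately show ?thesis
        by (intro blinfun_eqI) (simp add: y(1) Dapp y d_transition_comp[OF X at(1,2,3)])
    qed
    have "continuous_on ?S (transition c a)"
    proof (intro continuous_at_imp_continuous_on ballI)
      fix z assume "z \<in> ?S"
      then have "z \<in> chart_map c ` (chart_dom c \<inter> chart_dom a)" by auto
      from D1(2)[OF this] show "isCont (transition c a) z" by (rule has_derivative_continuous)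
    qed
    then have "continuous_on ?S (\<lambda>z. D2 (transition c a z) o\<^sub>L D1 z)"
      by (intro bounded_bilinear.continuous_on[OF bounded_bilinear_blinfun_compose]
            continuous_on_compose2[OF D2(1)] continuous_on_subset[OF D1(1)])
         (auto simp: transition_def hc)
    then have "continuous_on ?S D" using eq by (simp cong: continuous_on_cong)
    then show ?thesis using oS x a(2) by (auto simp: continuous_on_eq_continuous_at)
  qed
  then have "continuous_on (chart_map c ` (chart_dom c \<inter> chart_dom c')) D"
    by (intro continuous_at_imp_continuous_on) auto
  then show ?thesis unfolding C1_on_def using der by (intro exI[of _ D]) auto
qed

locale finsler_space =
  fixes X :: "('x::t2_space, 'e::banach) finsler"
  assumes finsler: "finsler_manifold X"
begin

lemma manifold: "C1_manifold X"
  using finsler by (simp add: finsler_manifold_def)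

lemma chart_exists: "\<exists>c. c \<in> charts_at X x"
  using charts_at_nonempty[OF manifold] by blast

lemma equivalent_chart_norm:
  assumes "c \<in> charts_at X x" shows "equivalent_norm (chart_norm X c x)"
  using finsler assms by (auto simp: finsler_manifold_def finsler_structure_def chart_norm_def[abs_def])

lemma continuous_chart_norm:
  assumes "c \<in> charts X"
  shows "continuous_on (chart_ran c \<times> UNIV) (\<lambda>(z, v). chart_norm X c (chart_inv c z) v)"
  using finsler assms by (simp add: finsler_manifold_def finsler_structure_def chart_norm_def)

lemma chart_norm_comparison:
  assumes "c \<in> charts_at X x" "\<epsilon> > 0"
  obtains U where "open U" "x \<in> U" "U \<subseteq> chart_dom c"
    "\<And>u v. u \<in> U \<Longrightarrow> chart_norm X c x v \<le> (1 + \<epsilon>) * chart_norm X c u v"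
    "\<And>u v. u \<in> U \<Longrightarrow> chart_norm X c u v \<le> (1 + \<epsilon>) * chart_norm X c x v"
proof -
  obtain U where U: "open U" "x \<in> U" "U \<subseteq> chart_dom c"
    "\<forall>u\<in>U. \<forall>v. 1 / (1 + \<epsilon>) * chart_norm X c x v \<le> chart_norm X c u v \<and> chart_norm X c u v \<le> (1 + \<epsilon>) * chart_norm X c x v"
    using finsler assms unfolding finsler_manifold_def finsler_structure_def chart_norm_def by meson
  show thesis
  proof (rule that[OF U(1-3)])
    fix u v assume "u \<in> U"
    then show "chart_norm X c x v \<le> (1 + \<epsilon>) * chart_norm X c u v" using U(4) assms(2) by (auto simp: field_simps)
  qed (use U(4) in auto)
qed

section \<open>Speed, length and operations on paths\<close>

definition speed :: "real \<Rightarrow> real \<Rightarrow> (real \<Rightarrow> 'x) \<Rightarrow> real \<Rightarrow> real"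
  where "speed a b \<sigma> t = fnorm X (\<sigma> t) (velocity X a b \<sigma> t)"

lemma path_len_speed: "path_len X a b \<sigma> = integral {a..b} (speed a b \<sigma>)"
  by (simp add: path_len_def speed_def[abs_def])

lemma C1_pathD:
  assumes "C1_path X a b \<sigma>"
  shows "a < b" "continuous_on {a..b} \<sigma>"
    "c \<in> charts X \<Longrightarrow> t \<in> {a..b} \<Longrightarrow> \<sigma> t \<in> chart_dom c \<Longrightarrow>
      (chart_map c \<circ> \<sigma> has_vector_derivative vector_derivative (chart_map c \<circ> \<sigma>) (at t within {a..b})) (at t within {a..b})"
    "c \<in> charts X \<Longrightarrow> continuous_on {t\<in>{a..b}. \<sigma> t \<in> chart_dom c}
        (\<lambda>t. vector_derivative (chart_map c \<circ> \<sigma>) (at t within {a..b}))"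
  using assms by (auto simp: C1_path_def vector_derivative_works[symmetric])

lemma C1_pathI:
  assumes "a < b" "continuous_on {a..b} \<sigma>"
    and der: "\<And>c t. c \<in> charts X \<Longrightarrow> t \<in> {a..b} \<Longrightarrow> \<sigma> t \<in> chart_dom c \<Longrightarrow>
      (chart_map c \<circ> \<sigma> has_vector_derivative D c t) (at t within {a..b})"
    and cont: "\<And>c. c \<in> charts X \<Longrightarrow> continuous_on {t\<in>{a..b}. \<sigma> t \<in> chart_dom c} (D c)"
  shows "C1_path X a b \<sigma>"
  unfolding C1_path_def
proof (intro conjI ballI)
  fix c assume c: "c \<in> charts X"
  show "(chart_map c \<circ> \<sigma>) differentiable at t within {a..b}" if "t \<in> {t \<in> {a..b}. \<sigma> t \<in> chart_dom c}" for t
    using der[OF c] that by (auto simp: differentiable_def has_vector_derivative_def)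
  have "vector_derivative (chart_map c \<circ> \<sigma>) (at t within {a..b}) = D c t" if "t \<in> {t \<in> {a..b}. \<sigma> t \<in> chart_dom c}" for t
    using vector_derivative_within_cbox[OF assms(1), of t "chart_map c \<circ> \<sigma>" "D c t"] der[OF c] that by auto
  then show "continuous_on {t\<in>{a..b}. \<sigma> t \<in> chart_dom c} (\<lambda>t. vector_derivative (chart_map c \<circ> \<sigma>) (at t within {a..b}))"
    by (intro continuous_on_eq[OF cont[OF c]]) (rule sym)
qed (use assms in auto)

lemma speed_chart:
  assumes p: "C1_path X a b \<sigma>" and t: "t \<in> {a..b}" and c: "c \<in> charts_at X (\<sigma> t)"
  shows "speed a b \<sigma> t = chart_norm X c (\<sigma> t) (vector_derivative (chart_map c \<circ> \<sigma>) (at t within {a..b}))"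
proof -
  have "d_chart_inv X c (\<sigma> t) (velocity X a b \<sigma> t c) = velocity X a b \<sigma> t"
    by (rule d_chart_inv_of_coord[OF c velocity_tangent[OF manifold p t]])
  moreover have "velocity X a b \<sigma> t c = vector_derivative (chart_map c \<circ> \<sigma>) (at t within {a..b})"
    using c by (simp add: velocity_def)
  ultimately show ?thesis by (simp add: speed_def chart_norm_def)
qed

lemma speed_chart_derivative:
  assumes p: "C1_path X a b \<sigma>" and t: "t \<in> {a..b}" and c: "c \<in> charts_at X (\<sigma> t)"
    and D: "(chart_map c \<circ> \<sigma> has_vector_derivative D) (at t within {a..b})"
  shows "speed a b \<sigma> t = chart_norm X c (\<sigma> t) D"
  using speed_chart[OF assms(1-3)] vector_derivative_within_cbox[of a b t "chart_map c \<circ> \<sigma>" D] D t C1_pathD(1)[OF p] by simp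

lemma speed_nonneg:
  assumes p: "C1_path X a b \<sigma>" and t: "t \<in> {a..b}"
  shows "0 \<le> speed a b \<sigma> t"
proof -
  obtain c where c: "c \<in> charts_at X (\<sigma> t)" using chart_exists by blast
  show ?thesis using equivalent_normD(1)[OF equivalent_chart_norm[OF c]] speed_chart[OF p t c] by simp
qed

text \<open>In a chart the speed is the jointly continuous local norm applied to position and
  coordinate velocity. The times spent in the chart domain form a relatively open set, so continuity
  there is continuity within the whole interval.\<close>

lemma continuous_speed:
  assumes p: "C1_path X a b \<sigma>"
  shows "continuous_on {a..b} (speed a b \<sigma>)"
proof -
  note P = C1_pathD[OF p]
  have "continuous (at t within {a..b}) (speed a b \<sigma>)" if t: "t \<in> {a..b}" for t
  proof -
    obtain c where c: "c \<in> charts_at X (\<sigma> t)" using chart_exists by blast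
    have cX: "c \<in> charts X" "\<sigma> t \<in> chart_dom c" using c by (auto simp: charts_at_iff)
    note hc = is_chartD[OF charts_is_chart[OF cX(1)]]
    let ?S = "{t\<in>{a..b}. \<sigma> t \<in> chart_dom c}"
    have "continuous_on ?S (\<lambda>t. (chart_map c (\<sigma> t), vector_derivative (chart_map c \<circ> \<sigma>) (at t within {a..b})))"
      by (intro continuous_intros P(4)[OF cX(1)] continuous_on_compose2[OF hc(7)] continuous_on_subset[OF P(2)]) auto
    then have "continuous_on ?S (\<lambda>t. case (chart_map c (\<sigma> t), vector_derivative (chart_map c \<circ> \<sigma>) (at t within {a..b})) of
        (z, v) \<Rightarrow> chart_norm X c (chart_inv c z) v)"
      by (rule continuous_on_compose2[OF continuous_chart_norm[OF cX(1)]]) (use hc in auto)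
    then have "continuous_on ?S (speed a b \<sigma>)"
      by (rule continuous_on_cong[THEN iffD1, OF refl, rotated])
         (auto simp: hc speed_chart[OF p _ , of _ c] charts_at_iff cX(1))
    then have ct: "continuous (at t within ?S) (speed a b \<sigma>)"
      using t cX(2) by (auto simp: continuous_on_eq_continuous_within)
    obtain V where V: "open V" "V \<inter> {a..b} = ?S"
      using P(2) hc(1) unfolding continuous_on_open_invariant by (auto simp: vimage_def Int_def conj_commute)
    have "at t within ?S = at t within {a..b}"
      by (rule at_within_nhd[of _ V]) (use V t cX in auto)
    then show ?thesis using ct by simp
  qed
  then show ?thesis by (simp add: continuous_on_eq_continuous_within)
qed

lemma path_len_nonneg:
  assumes p: "C1_path X a b \<sigma>" shows "0 \<le> path_len X a b \<sigma>"
  unfolding path_len_speed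
  by (rule integral_nonneg[OF integrable_continuous_real[OF continuous_speed[OF p]] speed_nonneg[OF p]])

text \<open>The chain rule in the form that \<open>C1_pathI\<close> consumes: an explicit candidate
  for the coordinate derivative, and its continuity.\<close>

lemma reparam:
  assumes p: "C1_path X a b \<sigma>" and q: "q ` {a'..b'} \<subseteq> {a..b}"
    and d: "\<And>s. s \<in> {a'..b'} \<Longrightarrow> (q has_vector_derivative q' s) (at s within {a'..b'})"
    and c: "c \<in> charts X"
  shows "s \<in> {a'..b'} \<Longrightarrow> \<sigma> (q s) \<in> chart_dom c \<Longrightarrow>
      (chart_map c \<circ> (\<sigma> \<circ> q) has_vector_derivative q' s *\<^sub>R vector_derivative (chart_map c \<circ> \<sigma>) (at (q s) within {a..b})) (at s within {a'..b'})"
    and "continuous_on {a'..b'} q' \<Longrightarrow> continuous_on {s\<in>{a'..b'}. \<sigma> (q s) \<in> chart_dom c}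
      (\<lambda>s. q' s *\<^sub>R vector_derivative (chart_map c \<circ> \<sigma>) (at (q s) within {a..b}))"
proof -
  note P = C1_pathD[OF p]
  have qs: "q s \<in> {a..b}" if "s \<in> {a'..b'}" for s using q that by blast
  show "(chart_map c \<circ> (\<sigma> \<circ> q) has_vector_derivative q' s *\<^sub>R vector_derivative (chart_map c \<circ> \<sigma>) (at (q s) within {a..b})) (at s within {a'..b'})"
    if s: "s \<in> {a'..b'}" "\<sigma> (q s) \<in> chart_dom c"
    unfolding comp_assoc[symmetric]
    by (rule vector_diff_chain_within[OF d[OF s(1)]], rule has_vector_derivative_within_subset[OF P(3)[OF c]])
       (use s q qs in auto)
  have "continuous_on {a'..b'} q"
    using has_derivative_continuous[OF d[unfolded has_vector_derivative_def]] by (simp add: continuous_on_eq_continuous_within)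
  then show "continuous_on {s\<in>{a'..b'}. \<sigma> (q s) \<in> chart_dom c}
      (\<lambda>s. q' s *\<^sub>R vector_derivative (chart_map c \<circ> \<sigma>) (at (q s) within {a..b}))" if "continuous_on {a'..b'} q'"
    using that qs
    by (intro continuous_intros continuous_on_compose2[OF P(4)[OF c], of _ q])
       (auto elim: continuous_on_subset)
qed

lemma length_derivative:
  assumes p: "C1_path X a b \<sigma>" and t: "t \<in> {a..b}"
  shows "((\<lambda>u. integral {a..u} (speed a b \<sigma>)) has_vector_derivative speed a b \<sigma> t) (at t within {a..b})"
  by (rule integral_has_vector_derivative[OF continuous_speed[OF p] t])

text \<open>The composition of the arc length function with \<open>q\<close> has the integrand as
  its derivative, so the fundamental theorem of calculus gives the change of variables even where
  \<open>q\<close> reverses direction.\<close>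

lemma has_integral_reparam:
  assumes p: "C1_path X a b \<sigma>" and q: "q ` {a'..b'} \<subseteq> {a..b}" and ab: "a' \<le> b'"
    and d: "\<And>s. s \<in> {a'..b'} \<Longrightarrow> (q has_vector_derivative q' s) (at s within {a'..b'})"
  shows "((\<lambda>s. q' s * speed a b \<sigma> (q s)) has_integral
      integral {a..q b'} (speed a b \<sigma>) - integral {a..q a'} (speed a b \<sigma>)) {a'..b'}"
proof -
  let ?L = "\<lambda>u. integral {a..u} (speed a b \<sigma>)"
  have qs: "q s \<in> {a..b}" if "s \<in> {a'..b'}" for s using q that by blast
  have "(?L \<circ> q has_vector_derivative q' s *\<^sub>R speed a b \<sigma> (q s)) (at s within {a'..b'})" if "s \<in> {a'..b'}" for s
    by (rule vector_diff_chain_within[OF d[OF that]], rule has_vector_derivative_within_subset[OF length_derivative[OF p]])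
       (use that q qs in auto)
  then have "((\<lambda>s. q' s *\<^sub>R speed a b \<sigma> (q s)) has_integral (?L \<circ> q) b' - (?L \<circ> q) a') {a'..b'}"
    by (rule fundamental_theorem_of_calculus[OF ab])
  then show ?thesis by simp
qed

lemma reverse_path:
  assumes p: "C1_path X a b \<sigma>"
  defines "\<tau> \<equiv> \<sigma> \<circ> (\<lambda>s. a + b - s)"
  shows "C1_path X a b \<tau>" "path_len X a b \<tau> = path_len X a b \<sigma>"
proof -
  note P = C1_pathD[OF p]
  let ?q = "\<lambda>s. a + b - s"
  have d: "(?q has_vector_derivative (\<lambda>_. -1) s) (at s within {a..b})" for s
    by (auto intro!: derivative_eq_intros)
  have q: "?q ` {a..b} \<subseteq> {a..b}" by auto
  show C: "C1_path X a b \<tau>"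
    unfolding \<tau>_def
  proof (rule C1_pathI[OF P(1)])
    show "continuous_on {a..b} (\<sigma> \<circ> ?q)" using q by (intro continuous_on_compose continuous_intros continuous_on_subset[OF P(2)])
    fix c assume c: "c \<in> charts X"
    show "(chart_map c \<circ> (\<sigma> \<circ> ?q) has_vector_derivative (-1) *\<^sub>R vector_derivative (chart_map c \<circ> \<sigma>) (at (?q t) within {a..b})) (at t within {a..b})"
      if "t \<in> {a..b}" "(\<sigma> \<circ> ?q) t \<in> chart_dom c" for t
      using reparam(1)[OF p q d c that(1)] that(2) by simp
    show "continuous_on {t\<in>{a..b}. (\<sigma> \<circ> ?q) t \<in> chart_dom c} (\<lambda>t. (-1) *\<^sub>R vector_derivative (chart_map c \<circ> \<sigma>) (at (?q t) within {a..b}))"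
      using reparam(2)[OF p q d c] by simp
  qed
  have sp: "speed a b \<tau> s = speed a b \<sigma> (?q s)" if s: "s \<in> {a..b}" for s
  proof -
    obtain c where c: "c \<in> charts_at X (\<tau> s)" using chart_exists by blast
    have cX: "c \<in> charts X" "\<sigma> (?q s) \<in> chart_dom c" using c by (auto simp: charts_at_iff \<tau>_def)
    have "speed a b \<tau> s = chart_norm X c (\<tau> s) ((-1) *\<^sub>R vector_derivative (chart_map c \<circ> \<sigma>) (at (?q s) within {a..b}))"
      by (rule speed_chart_derivative[OF C s c]) (use reparam(1)[OF p q d cX(1) s cX(2)] in \<open>simp add: \<tau>_def comp_def\<close>)
    also have "\<dots> = chart_norm X c (\<tau> s) (vector_derivative (chart_map c \<circ> \<sigma>) (at (?q s) within {a..b}))"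
      using equivalent_normD(6)[OF equivalent_chart_norm[OF c]] by simp
    also have "\<dots> = speed a b \<sigma> (?q s)"
      using speed_chart[OF p, of "?q s" c] s c by (auto simp: \<tau>_def)
    finally show ?thesis .
  qed
  have "((\<lambda>s. (-1) * speed a b \<sigma> (?q s)) has_integral integral {a..?q b} (speed a b \<sigma>) - integral {a..?q a} (speed a b \<sigma>)) {a..b}"
    by (rule has_integral_reparam[OF p q _ d]) (use P(1) in auto)
  from has_integral_neg[OF this] have "((\<lambda>s. speed a b \<sigma> (?q s)) has_integral path_len X a b \<sigma>) {a..b}"
    by (simp add: path_len_speed)
  then have "(speed a b \<tau> has_integral path_len X a b \<sigma>) {a..b}"
    by (rule has_integral_eq[rotated]) (simp add: sp)
  then show "path_len X a b \<tau> = path_len X a b \<sigma>" by (simp add: path_len_speed integral_unique)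
qed

text \<open>The quadratic time changes make the velocity vanish at the junction, so that the joined path is \<open>C\<^sup>1\<close>.\<close>

lemma join_paths:
  assumes p1: "C1_path X a b \<sigma>" and p2: "C1_path X a' b' \<sigma>'" and eq: "\<sigma> b = \<sigma>' a'"
  obtains \<tau> where "C1_path X (-1) 1 \<tau>" "\<tau> (-1) = \<sigma> a" "\<tau> 1 = \<sigma>' b'"
    "path_len X (-1) 1 \<tau> = path_len X a b \<sigma> + path_len X a' b' \<sigma>'"
proof -
  note P1 = C1_pathD[OF p1] and P2 = C1_pathD[OF p2]
  define q1 q1' where "q1 s = b - (b - a) * s\<^sup>2" and "q1' s = - 2 * (b - a) * s" for s :: real
  define q2 q2' where "q2 s = a' + (b' - a') * s\<^sup>2" and "q2' s = 2 * (b' - a') * s" for s :: real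
  have d1: "(q1 has_vector_derivative q1' s) (at s within S)" for s S
    unfolding q1_def[abs_def] q1'_def has_real_derivative_iff_has_vector_derivative[symmetric]
    by (auto intro!: derivative_eq_intros simp: algebra_simps)
  have d2: "(q2 has_vector_derivative q2' s) (at s within S)" for s S
    unfolding q2_def[abs_def] q2'_def has_real_derivative_iff_has_vector_derivative[symmetric]
    by (auto intro!: derivative_eq_intros)
  have sq: "0 \<le> s\<^sup>2 \<and> s\<^sup>2 \<le> 1" if "\<bar>s\<bar> \<le> 1" for s :: real
    using that by (simp add: abs_square_le_1)
  have q1: "q1 ` {-1..0} \<subseteq> {a..b}"
  proof (safe)
    fix s :: real assume "s \<in> {-1..0}"
    then have "0 \<le> (b - a) * s\<^sup>2" "(b - a) * s\<^sup>2 \<le> (b - a) * 1" using sq[of s] P1(1) by (auto intro!: mult_left_mono simp del: mult_1_right)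
    then show "q1 s \<in> {a..b}" by (auto simp: q1_def)
  qed
  have q2: "q2 ` {0..1} \<subseteq> {a'..b'}"
  proof (safe)
    fix s :: real assume "s \<in> {0..1}"
    then have "0 \<le> (b' - a') * s\<^sup>2" "(b' - a') * s\<^sup>2 \<le> (b' - a') * 1" using sq[of s] P2(1) by (auto intro!: mult_left_mono simp del: mult_1_right)
    then show "q2 s \<in> {a'..b'}" by (auto simp: q2_def)
  qed
  have z: "q1 0 = b" "q2 0 = a'" "q1 (-1) = a" "q2 1 = b'" "q1' 0 = 0" "q2' 0 = 0"
    by (auto simp: q1_def q2_def q1'_def q2'_def)
  have un: "{-1..1} = {-1..0} \<union> {0..1::real}" by auto
  define \<tau> where "\<tau> s = (if s \<in> {-1..0} then (\<sigma> \<circ> q1) s else (\<sigma>' \<circ> q2) s)" for s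
  define D :: "('x, 'e) chart \<Rightarrow> real \<Rightarrow> 'e" where "D c s = (if s \<in> {-1..0} then q1' s *\<^sub>R vector_derivative (chart_map c \<circ> \<sigma>) (at (q1 s) within {a..b})
      else q2' s *\<^sub>R vector_derivative (chart_map c \<circ> \<sigma>') (at (q2 s) within {a'..b'}))" for c s
  have \<tau>1: "\<tau> s = \<sigma> (q1 s)" if "s \<in> {-1..0}" for s using that by (simp add: \<tau>_def)
  have \<tau>2: "\<tau> s = \<sigma>' (q2 s)" if "s \<in> {0..1}" for s using that eq z by (auto simp: \<tau>_def)
  \<comment> \<open>At \<open>s = 0\<close> both branches of \<open>D\<close> vanish, so the second
    formula holds on the closed interval.\<close>
  have D2: "D c s = q2' s *\<^sub>R vector_derivative (chart_map c \<circ> \<sigma>') (at (q2 s) within {a'..b'})" if "s \<in> {0..1}" for c s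
    using that z by (auto simp: D_def)
  have contq: "continuous_on S q1" "continuous_on S q2" "continuous_on S q1'" "continuous_on S q2'" for S
    unfolding q1_def[abs_def] q2_def[abs_def] q1'_def[abs_def] q2'_def[abs_def] by (intro continuous_intros)+
  have der: "(chart_map c \<circ> \<tau> has_vector_derivative D c s) (at s within {-1..1})"
    if c: "c \<in> charts X" and s: "s \<in> {-1..1}" "\<tau> s \<in> chart_dom c" for c s
  proof -
    have e: "chart_map c \<circ> \<tau> = (\<lambda>s. if s \<in> {-1..0} then (chart_map c \<circ> (\<sigma> \<circ> q1)) s else (chart_map c \<circ> (\<sigma>' \<circ> q2)) s)"
      by (auto simp: \<tau>_def fun_eq_iff)
    have i: "{-1..0} \<inter> {0..1::real} = {0}" by auto
    show ?thesis unfolding e D_def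
    proof (rule has_vector_derivative_If_within_closures[OF _ un])
      show "s \<in> {-1..0} \<union> {0..1}" using s by auto
      show "(chart_map c \<circ> (\<sigma> \<circ> q1) has_vector_derivative q1' s *\<^sub>R vector_derivative (chart_map c \<circ> \<sigma>) (at (q1 s) within {a..b}))
        (at s within {-1..0} \<union> closure {-1..0} \<inter> closure {0..1})" if "s \<in> {-1..0} \<union> closure {-1..0} \<inter> closure {0..1}"
        using reparam(1)[OF p1 q1 d1 c, of s] that s \<tau>1[of s] by (simp add: i insert_absorb)
      show "(chart_map c \<circ> (\<sigma>' \<circ> q2) has_vector_derivative q2' s *\<^sub>R vector_derivative (chart_map c \<circ> \<sigma>') (at (q2 s) within {a'..b'}))
        (at s within {0..1} \<union> closure {-1..0} \<inter> closure {0..1})" if "s \<in> {0..1} \<union> closure {-1..0} \<inter> closure {0..1}"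
        using reparam(1)[OF p2 q2 d2 c, of s] that s \<tau>2[of s] by (simp add: i insert_absorb)
    qed (use eq z in auto)
  qed
  have C: "C1_path X (-1) 1 \<tau>"
  proof (rule C1_pathI[where D = D])
    have "continuous_on {-1..0} (\<sigma> \<circ> q1)" "continuous_on {0..1} (\<sigma>' \<circ> q2)"
      by (intro continuous_on_compose contq continuous_on_subset[OF P1(2) q1] continuous_on_subset[OF P2(2) q2])+
    then show "continuous_on {-1..1} \<tau>" unfolding un \<tau>_def
      by (intro continuous_on_cases) (use eq z in auto)
    fix c assume c: "c \<in> charts X"
    show "(chart_map c \<circ> \<tau> has_vector_derivative D c s) (at s within {-1..1})" if "s \<in> {-1..1}" "\<tau> s \<in> chart_dom c" for s
      using der[OF c] that by blast
    let ?A = "{s\<in>{-1..0}. \<sigma> (q1 s) \<in> chart_dom c}" and ?B = "{s\<in>{0..1}. \<sigma>' (q2 s) \<in> chart_dom c}"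
    have AB: "{s\<in>{-1..1}. \<tau> s \<in> chart_dom c} = ?A \<union> ?B"
    proof (intro set_eqI)
      fix s :: real
      show "s \<in> {s\<in>{-1..1}. \<tau> s \<in> chart_dom c} \<longleftrightarrow> s \<in> ?A \<union> ?B"
        using \<tau>1[of s] \<tau>2[of s] by (cases "s \<le> 0") (auto)
    qed
    have AI: "(?A \<union> ?B) \<inter> {-1..0} = ?A" and BI: "(?A \<union> ?B) \<inter> {0..1} = ?B" using eq z by auto
    have cl: "closedin (top_of_set (?A \<union> ?B)) ?A" "closedin (top_of_set (?A \<union> ?B)) ?B"
      using closedin_closed_Int[OF closed_atLeastAtMost, of "?A \<union> ?B" "-1" 0]
        closedin_closed_Int[OF closed_atLeastAtMost, of "?A \<union> ?B" 0 1] unfolding AI BI by blast+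
    have "continuous_on (?A \<union> ?B) (\<lambda>s. if s \<in> {-1..0} then q1' s *\<^sub>R vector_derivative (chart_map c \<circ> \<sigma>) (at (q1 s) within {a..b})
      else q2' s *\<^sub>R vector_derivative (chart_map c \<circ> \<sigma>') (at (q2 s) within {a'..b'}))"
      by (rule continuous_on_cases_local[OF cl reparam(2)[OF p1 q1 d1 c contq(3)] reparam(2)[OF p2 q2 d2 c contq(4)]])
         (use z in auto)
    then show "continuous_on {s\<in>{-1..1}. \<tau> s \<in> chart_dom c} (D c)" unfolding AB D_def .
  qed simp
  have s1: "speed (-1) 1 \<tau> s = q1' s * speed a b \<sigma> (q1 s)" if s: "s \<in> {-1..0}" for s
  proof -
    obtain c where c: "c \<in> charts_at X (\<tau> s)" using chart_exists by blast
    have "q1 s \<in> {a..b}" using q1 s by blast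
    then have s': "s \<in> {-1..1}" "q1 s \<in> {a..b}" using s by auto
    have "speed (-1) 1 \<tau> s = chart_norm X c (\<tau> s) (q1' s *\<^sub>R vector_derivative (chart_map c \<circ> \<sigma>) (at (q1 s) within {a..b}))"
      using speed_chart_derivative[OF C s'(1) c der] c s s' by (simp add: charts_at_iff D_def)
    \<comment> \<open>The time change is nondecreasing on this half, so homogeneity of the norm
      produces the factor \<open>q1' s\<close> without an absolute value.\<close>
    moreover have "0 \<le> q1' s" using mult_nonpos_nonpos[of "-2 * (b - a)" s] s P1(1) by (simp add: q1'_def)
    then have "chart_norm X c (\<tau> s) (q1' s *\<^sub>R vector_derivative (chart_map c \<circ> \<sigma>) (at (q1 s) within {a..b})) = q1' s * speed a b \<sigma> (q1 s)"
      using equivalent_normD(3)[OF equivalent_chart_norm[OF c]] speed_chart[OF p1 s'(2), of c] c \<tau>1[OF s] by simp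
    ultimately show ?thesis by simp
  qed
  have s2: "speed (-1) 1 \<tau> s = q2' s * speed a' b' \<sigma>' (q2 s)" if s: "s \<in> {0..1}" for s
  proof -
    obtain c where c: "c \<in> charts_at X (\<tau> s)" using chart_exists by blast
    have "q2 s \<in> {a'..b'}" using q2 s by blast
    then have s': "s \<in> {-1..1}" "q2 s \<in> {a'..b'}" using s by auto
    have "speed (-1) 1 \<tau> s = chart_norm X c (\<tau> s) (q2' s *\<^sub>R vector_derivative (chart_map c \<circ> \<sigma>') (at (q2 s) within {a'..b'}))"
      using speed_chart_derivative[OF C s'(1) c der] c s' D2[OF s] by (simp add: charts_at_iff)
    also have "\<dots> = q2' s * speed a' b' \<sigma>' (q2 s)"
      using equivalent_normD(3)[OF equivalent_chart_norm[OF c]] speed_chart[OF p2 s'(2), of c] c \<tau>2[OF s] s P2(1)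
      by (simp add: q2'_def)
    finally show ?thesis .
  qed
  have "(speed (-1) 1 \<tau> has_integral path_len X a b \<sigma>) {-1..0}"
    using has_integral_eq[OF _ has_integral_reparam[OF p1 q1 _ d1], of "speed (-1) 1 \<tau>"] s1 z
    by (simp add: path_len_speed)
  moreover have "(speed (-1) 1 \<tau> has_integral path_len X a' b' \<sigma>') {0..1}"
    using has_integral_eq[OF _ has_integral_reparam[OF p2 q2 _ d2], of "speed (-1) 1 \<tau>"] s2 z
    by (simp add: path_len_speed)
  ultimately have "(speed (-1) 1 \<tau> has_integral path_len X a b \<sigma> + path_len X a' b' \<sigma>') {-1..1}"
    by (rule has_integral_combine[rotated 2]) auto
  then have "path_len X (-1) 1 \<tau> = path_len X a b \<sigma> + path_len X a' b' \<sigma>'"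
    by (simp add: path_len_speed integral_unique)
  then show thesis using that[OF C] \<tau>1[of "-1"] \<tau>2[of 1] z by simp
qed

lemma line_path:
  assumes c: "c \<in> charts X" and uv: "u \<in> chart_dom c" "v \<in> chart_dom c"
    and seg: "closed_segment (chart_map c u) (chart_map c v) \<subseteq> chart_ran c"
  defines "\<sigma> \<equiv> (\<lambda>t. chart_inv c (chart_map c u + t *\<^sub>R (chart_map c v - chart_map c u)))"
  shows "C1_path X 0 1 \<sigma>" "\<sigma> 0 = u" "\<sigma> 1 = v"
    "\<And>t. t \<in> {0..1} \<Longrightarrow> speed 0 1 \<sigma> t = chart_norm X c (\<sigma> t) (chart_map c v - chart_map c u)"
proof -
  note ic = charts_is_chart[OF c]
  note hc = is_chartD[OF ic]
  define w where "w = chart_map c v - chart_map c u"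
  define l where "l t = chart_map c u + t *\<^sub>R w" for t
  have ll: "l t \<in> chart_ran c" if "t \<in> {0..1}" for t
    using that seg by (force simp: l_def w_def in_segment algebra_simps)
  have \<sigma>: "\<sigma> t = chart_inv c (l t)" for t by (simp add: \<sigma>_def l_def w_def)
  show "\<sigma> 0 = u" "\<sigma> 1 = v" using uv hc by (simp_all add: \<sigma>_def)
  have cl: "continuous_on S l" for S unfolding l_def[abs_def] by (intro continuous_intros)
  have dl: "(l has_vector_derivative w) (at t within S)" for t S
    unfolding l_def[abs_def] by (auto intro!: derivative_eq_intros)
  have map\<sigma>: "chart_map c (\<sigma> t) = l t" "\<sigma> t \<in> chart_dom c" if "t \<in> {0..1}" for t
    using ll[OF that] hc by (auto simp: \<sigma>)
  have cont: "continuous_on {0..1} \<sigma>" unfolding \<sigma>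
    by (rule continuous_on_compose2[OF hc(8) cl]) (use ll in auto)
  \<comment> \<open>\<open>C1_pathI\<close> asks for the coordinate derivative as a function of the
    chart, so a continuous derivative of each transition map is fixed by choice.\<close>
  define DD where "DD c' = (SOME D. continuous_on (chart_map c ` (chart_dom c \<inter> chart_dom c')) D \<and>
      (\<forall>z\<in>chart_map c ` (chart_dom c \<inter> chart_dom c'). (transition c c' has_derivative blinfun_apply (D z)) (at z)))" for c'
  have DD: "continuous_on (chart_map c ` (chart_dom c \<inter> chart_dom c')) (DD c') \<and>
      (\<forall>z\<in>chart_map c ` (chart_dom c \<inter> chart_dom c'). (transition c c' has_derivative blinfun_apply (DD c' z)) (at z))"
    if "c' \<in> charts X" for c'
    unfolding DD_def by (rule someI_ex[OF charts_C1_transition[OF manifold c that, unfolded C1_on_def]])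
  have mem: "l t \<in> chart_map c ` (chart_dom c \<inter> chart_dom c')" if "t \<in> {0..1}" "\<sigma> t \<in> chart_dom c'" for t c'
    using map\<sigma>[OF that(1)] that(2) by (intro image_eqI[of _ _ "\<sigma> t"]) auto
  show C: "C1_path X 0 1 \<sigma>"
  proof (rule C1_pathI[where D = "\<lambda>c' t. DD c' (l t) w"])
    fix c' assume c': "c' \<in> charts X"
    show "(chart_map c' \<circ> \<sigma> has_vector_derivative DD c' (l t) w) (at t within {0..1})"
      if t: "t \<in> {0..1}" "\<sigma> t \<in> chart_dom c'" for t
    proof -
      have "chart_map c' \<circ> \<sigma> = transition c c' \<circ> l" by (auto simp: transition_def \<sigma>)
      moreover have "(transition c c' \<circ> l has_vector_derivative DD c' (l t) w) (at t within {0..1})"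
        using vector_derivative_diff_chain_within[OF dl has_derivative_at_withinI] DD[OF c'] mem[OF t] by blast
      ultimately show ?thesis by simp
    qed
    show "continuous_on {t \<in> {0..1}. \<sigma> t \<in> chart_dom c'} (\<lambda>t. DD c' (l t) w)"
      by (intro continuous_intros continuous_on_compose2[OF conjunct1[OF DD[OF c']] cl]) (use mem in auto)
  qed (use cont in auto)
  show "speed 0 1 \<sigma> t = chart_norm X c (\<sigma> t) (chart_map c v - chart_map c u)" if t: "t \<in> {0..1}" for t
  proof (rule speed_chart_derivative[OF C t])
    show "c \<in> charts_at X (\<sigma> t)" using c map\<sigma> t by (simp add: charts_at_iff)
    show "(chart_map c \<circ> \<sigma> has_vector_derivative chart_map c v - chart_map c u) (at t within {0..1})"
      using dl[of t "{0..1}"] unfolding w_def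
      by (rule has_vector_derivative_transform[OF t, rotated]) (use map\<sigma> in auto)
  qed
qed

end

section \<open>The distance as an infimum of lengths\<close>

context finsler_space
begin

lemma fdist_le_path_len:
  assumes "C1_path X a b \<sigma>" "\<sigma> a = u" "\<sigma> b = v"
  shows "fdist X u v \<le> path_len X a b \<sigma>"
  unfolding fdist_def
proof (rule cInf_lower)
  show "path_len X a b \<sigma> \<in> {path_len X a b \<sigma> |a b \<sigma>. C1_path X a b \<sigma> \<and> \<sigma> a = u \<and> \<sigma> b = v}"
    using assms by blast
  show "bdd_below {path_len X a b \<sigma> |a b \<sigma>. C1_path X a b \<sigma> \<and> \<sigma> a = u \<and> \<sigma> b = v}"
    by (rule bdd_belowI[of _ 0]) (use path_len_nonneg in blast)
qed

lemma open_chart_ball: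
  assumes c: "c \<in> charts_at X x"
  shows "open {u\<in>chart_dom c. chart_norm X c x (chart_map c u - p) < \<rho>}"
proof -
  note hc = is_chartD[OF charts_at_D(1)[OF c]]
  have "continuous_on (chart_dom c) (\<lambda>u. chart_norm X c x (chart_map c u - p))"
    by (rule continuous_on_compose2[OF equivalent_norm_continuous[OF equivalent_chart_norm[OF c], of UNIV]])
       (auto intro!: continuous_intros hc)
  then have "openin (top_of_set (chart_dom c)) (chart_dom c \<inter> (\<lambda>u. chart_norm X c x (chart_map c u - p)) -` {..<\<rho>})"
    by (rule continuous_openin_preimage_gen) auto
  then have "open (chart_dom c \<inter> (\<lambda>u. chart_norm X c x (chart_map c u - p)) -` {..<\<rho>})"
    using hc(1) openin_open_trans by blast
  moreover have "chart_dom c \<inter> (\<lambda>u. chart_norm X c x (chart_map c u - p)) -` {..<\<rho>} =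
    {u\<in>chart_dom c. chart_norm X c x (chart_map c u - p) < \<rho>}" by auto
  ultimately show ?thesis by simp
qed

lemma chart_ball_exists:
  assumes c: "c \<in> charts_at X x" and Q: "open Q" "x \<in> Q"
  obtains \<rho> where "\<rho> > 0" "\<And>z. chart_norm X c x (z - chart_map c x) < \<rho> \<Longrightarrow> z \<in> chart_ran c \<and> chart_inv c z \<in> Q"
proof -
  note hc = is_chartD[OF charts_at_D(1)[OF c]]
  have x: "x \<in> chart_dom c" using c by (simp add: charts_at_iff)
  have "open (chart_map c ` (chart_dom c \<inter> Q))" by (rule overlap_open[OF charts_at_D(1)[OF c] Q(1)])
  then obtain e where e: "e > 0" "ball (chart_map c x) e \<subseteq> chart_map c ` (chart_dom c \<inter> Q)"
    unfolding open_contains_ball using x Q by blast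
  obtain m M where m: "m > 0" "\<And>v. m * norm v \<le> chart_norm X c x v"
    using equivalent_norm_bounds[OF equivalent_chart_norm[OF c]] by metis
  show thesis
  proof (rule that[of "m * e"])
    fix z assume "chart_norm X c x (z - chart_map c x) < m * e"
    then have "m * norm (z - chart_map c x) < m * e" using m(2) by (rule order.strict_trans1[rotated])
    then have "z \<in> ball (chart_map c x) e" using m(1) by (simp add: dist_norm norm_minus_commute)
    then obtain u where "u \<in> chart_dom c" "u \<in> Q" "z = chart_map c u" using e(2) by blast
    then show "z \<in> chart_ran c \<and> chart_inv c z \<in> Q" using hc by auto
  qed (use m e in simp)
qed

lemma chart_norm_ball_convex:
  assumes c: "c \<in> charts_at X x"
  shows "convex {z. chart_norm X c x (z - p) < \<rho>}"
proof (rule convexI)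
  note D = equivalent_normD[OF equivalent_chart_norm[OF c]]
  fix y z :: 'e and s t :: real
  assume h: "y \<in> {z. chart_norm X c x (z - p) < \<rho>}" "z \<in> {z. chart_norm X c x (z - p) < \<rho>}" "0 \<le> s" "0 \<le> t" "s + t = 1"
  have "s *\<^sub>R y + t *\<^sub>R z - p = s *\<^sub>R (y - p) + t *\<^sub>R (z - p)"
    using h(5) by (simp add: algebra_simps flip: scaleR_add_left)
  then have "chart_norm X c x (s *\<^sub>R y + t *\<^sub>R z - p) \<le> s * chart_norm X c x (y - p) + t * chart_norm X c x (z - p)"
    using D(4)[of "s *\<^sub>R (y - p)" "t *\<^sub>R (z - p)"] D(3) h by simp
  also have "\<dots> < \<rho>" using h convex_bound_lt[of _ \<rho> _ s t] by simp
  finally show "s *\<^sub>R y + t *\<^sub>R z \<in> {z. chart_norm X c x (z - p) < \<rho>}" by simp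
qed

lemma line_path_length:
  assumes c: "c \<in> charts_at X x"
    and \<rho>: "\<And>z. chart_norm X c x (z - chart_map c x) < \<rho> \<Longrightarrow> z \<in> chart_ran c \<and>
        (\<forall>v. chart_norm X c (chart_inv c z) v \<le> K * chart_norm X c x v)"
    and u: "u \<in> chart_dom c" "chart_norm X c x (chart_map c u - chart_map c x) < \<rho>"
    and v: "v \<in> chart_dom c" "chart_norm X c x (chart_map c v - chart_map c x) < \<rho>"
  obtains a b \<sigma> where "C1_path X a b \<sigma>" "\<sigma> a = u" "\<sigma> b = v"
    "path_len X a b \<sigma> \<le> K * chart_norm X c x (chart_map c v - chart_map c u)"
proof -
  have cX: "c \<in> charts X" using c by (simp add: charts_at_iff)
  have seg0: "closed_segment (chart_map c u) (chart_map c v) \<subseteq> {z. chart_norm X c x (z - chart_map c x) < \<rho>}"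
    by (intro closed_segment_subset chart_norm_ball_convex[OF c]) (use u v in auto)
  then have seg: "closed_segment (chart_map c u) (chart_map c v) \<subseteq> chart_ran c" using \<rho> by auto
  note L = line_path[OF cX u(1) v(1) seg]
  let ?\<sigma> = "\<lambda>t. chart_inv c (chart_map c u + t *\<^sub>R (chart_map c v - chart_map c u))"
  have "speed 0 1 ?\<sigma> t \<le> K * chart_norm X c x (chart_map c v - chart_map c u)" if t: "t \<in> {0..1}" for t
  proof -
    have "chart_map c u + t *\<^sub>R (chart_map c v - chart_map c u) \<in> closed_segment (chart_map c u) (chart_map c v)"
      using t by (auto simp: in_segment algebra_simps intro!: exI[of _ t])
    then show ?thesis using L(4)[OF t] \<rho> seg0 by auto
  qed
  then have "integral {0..1} (speed 0 1 ?\<sigma>) \<le> integral {0..1::real} (\<lambda>_. K * chart_norm X c x (chart_map c v - chart_map c u))"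
    by (intro integral_le integrable_continuous_real continuous_speed[OF L(1)] continuous_intros) auto
  then have "path_len X 0 1 ?\<sigma> \<le> K * chart_norm X c x (chart_map c v - chart_map c u)"
    by (simp add: path_len_speed)
  then show thesis using that[OF L(1-3)] by blast
qed

text \<open>Being joined by a path is an equivalence relation with open classes, and the manifold is
  connected. Consequently the infimum defining \<open>fdist\<close> is taken over a nonempty
  set.\<close>

lemma path_exists: "\<exists>a b \<sigma>. C1_path X a b \<sigma> \<and> \<sigma> a = u \<and> \<sigma> b = v"
proof -
  let ?R = "\<lambda>u v. \<exists>a b \<sigma>. C1_path X a b \<sigma> \<and> \<sigma> a = u \<and> \<sigma> b = v"
  show "?R u v"
  proof (rule connected_equivalence_relation[where S = UNIV and a = u and b = v and R = ?R])
    show "connected (UNIV :: 'x set)" using finsler by (simp add: finsler_manifold_def)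
    show "?R y x" if xy: "?R x y" for x y
    proof -
      obtain a b \<sigma> where p: "C1_path X a b \<sigma>" "\<sigma> a = x" "\<sigma> b = y" using xy by blast
      show ?thesis
        by (intro exI conjI, rule reverse_path(1)[OF p(1)]) (use p in auto)
    qed
    show "?R x z" if xy: "?R x y" and yz: "?R y z" for x y z
    proof -
      obtain a b \<sigma> where p: "C1_path X a b \<sigma>" "\<sigma> a = x" "\<sigma> b = y" using xy by blast
      obtain a' b' \<sigma>' where p': "C1_path X a' b' \<sigma>'" "\<sigma>' a' = y" "\<sigma>' b' = z" using yz by blast
      have "\<sigma> b = \<sigma>' a'" using p p' by simp
      from join_paths[OF p(1) p'(1) this] show ?thesis using p p' by metis
    qed
    show "\<exists>T. openin (top_of_set UNIV) T \<and> x \<in> T \<and> (\<forall>y\<in>T. ?R x y)" for x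
    proof -
      obtain c where c: "c \<in> charts_at X x" using chart_exists by blast
      note D = equivalent_normD[OF equivalent_chart_norm[OF c]]
      have x: "x \<in> chart_dom c" using c by (simp add: charts_at_iff)
      obtain U where U: "open U" "x \<in> U" "\<And>u v. u \<in> U \<Longrightarrow> chart_norm X c u v \<le> (1 + 1) * chart_norm X c x v"
        by (rule chart_norm_comparison[OF c zero_less_one]) blast
      obtain \<rho> where \<rho>: "\<rho> > 0" "\<And>z. chart_norm X c x (z - chart_map c x) < \<rho> \<Longrightarrow> z \<in> chart_ran c \<and> chart_inv c z \<in> U"
        using chart_ball_exists[OF c U(1,2)] by blast
      let ?T = "{u\<in>chart_dom c. chart_norm X c x (chart_map c u - chart_map c x) < \<rho>}"
      have "?R x y" if "y \<in> ?T" for y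
      proof -
        have y: "y \<in> chart_dom c" "chart_norm X c x (chart_map c y - chart_map c x) < \<rho>" using that by auto
        have x': "chart_norm X c x (chart_map c x - chart_map c x) < \<rho>" using D(5) \<rho>(1) by simp
        have "z \<in> chart_ran c \<and> (\<forall>v. chart_norm X c (chart_inv c z) v \<le> (1 + 1) * chart_norm X c x v)"
          if "chart_norm X c x (z - chart_map c x) < \<rho>" for z using \<rho>(2)[OF that] U(3) by blast
        from line_path_length[OF c this x x' y] show ?thesis by metis
      qed
      moreover have "x \<in> ?T" using x D(5) \<rho>(1) by simp
      ultimately show ?thesis using open_chart_ball[OF c] by (intro exI[of _ ?T]) auto
    qed
  qed auto
qed

lemma fdist_less_path:
  assumes "fdist X u v < r"
  obtains a b \<sigma> where "C1_path X a b \<sigma>" "\<sigma> a = u" "\<sigma> b = v" "path_len X a b \<sigma> < r"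
proof -
  let ?S = "{path_len X a b \<sigma> |a b \<sigma>. C1_path X a b \<sigma> \<and> \<sigma> a = u \<and> \<sigma> b = v}"
  obtain a b \<sigma> where "C1_path X a b \<sigma>" "\<sigma> a = u" "\<sigma> b = v" using path_exists[of u v] by blast
  then have "path_len X a b \<sigma> \<in> ?S" by blast
  then have "?S \<noteq> {}" by blast
  from cInf_lessD[OF this assms[unfolded fdist_def]] obtain l where l: "l \<in> ?S" "l < r" by blast
  from l(1) obtain a b \<sigma> where "l = path_len X a b \<sigma>" "C1_path X a b \<sigma>" "\<sigma> a = u" "\<sigma> b = v" by blast
  with l(2) show thesis using that by blast
qed

lemma fdist_nonneg: "0 \<le> fdist X u v"
  unfolding fdist_def
  by (rule cInf_greatest) (use path_exists[of u v] path_len_nonneg in auto)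

lemma fdist_commute: "fdist X u v = fdist X v u"
proof -
  have "fdist X v u \<le> fdist X u v" for u v
  proof (rule field_le_epsilon)
    fix e :: real assume "e > 0"
    then obtain a b \<sigma> where p: "C1_path X a b \<sigma>" "\<sigma> a = u" "\<sigma> b = v" "path_len X a b \<sigma> < fdist X u v + e"
      using fdist_less_path[of u v "fdist X u v + e"] by auto
    show "fdist X v u \<le> fdist X u v + e"
      using fdist_le_path_len[OF reverse_path(1)[OF p(1)], of v u] reverse_path(2)[OF p(1)] p by simp
  qed
  then show ?thesis by (simp add: antisym)
qed

lemma fdist_triangle: "fdist X u w \<le> fdist X u v + fdist X v w"
proof (rule field_le_epsilon)
  fix e :: real assume e: "e > 0"
  obtain a b \<sigma> where p: "C1_path X a b \<sigma>" "\<sigma> a = u" "\<sigma> b = v" "path_len X a b \<sigma> < fdist X u v + e / 2"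
    using fdist_less_path[of u v "fdist X u v + e / 2"] e by auto
  obtain a' b' \<sigma>' where p': "C1_path X a' b' \<sigma>'" "\<sigma>' a' = v" "\<sigma>' b' = w" "path_len X a' b' \<sigma>' < fdist X v w + e / 2"
    using fdist_less_path[of v w "fdist X v w + e / 2"] e by auto
  have "\<sigma> b = \<sigma>' a'" using p p' by simp
  then obtain \<tau> where \<tau>: "C1_path X (-1) 1 \<tau>" "\<tau> (-1) = \<sigma> a" "\<tau> 1 = \<sigma>' b'"
    "path_len X (-1) 1 \<tau> = path_len X a b \<sigma> + path_len X a' b' \<sigma>'" using join_paths[OF p(1) p'(1)] by metis
  show "fdist X u w \<le> fdist X u v + fdist X v w + e"
    using fdist_le_path_len[OF \<tau>(1), of u w] \<tau> p p' by simp
qed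

lemma path_chart_lipschitz:
  assumes p: "C1_path X a b \<sigma>" and st: "a \<le> s" "s \<le> t" "t \<le> b" and c: "c \<in> charts_at X x" and K: "K \<ge> 0"
    and W: "\<And>\<tau>. s \<le> \<tau> \<Longrightarrow> \<tau> \<le> t \<Longrightarrow> \<sigma> \<tau> \<in> chart_dom c \<and> (\<forall>v. chart_norm X c x v \<le> K * chart_norm X c (\<sigma> \<tau>) v)"
  shows "chart_norm X c x (chart_map c (\<sigma> t) - chart_map c (\<sigma> s)) \<le> K * (integral {a..t} (speed a b \<sigma>) - integral {a..s} (speed a b \<sigma>))"
proof -
  note P = C1_pathD[OF p]
  let ?n = "chart_norm X c x"
  have n: "equivalent_norm ?n" by (rule equivalent_chart_norm[OF c])
  note D = equivalent_normD[OF n]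
  have cX: "c \<in> charts X" using c by (simp add: charts_at_iff)
  note hc = is_chartD[OF charts_is_chart[OF cX]]
  obtain M where M: "M > 0" "\<And>v. ?n v \<le> M * norm v" using equivalent_norm_bounds[OF n] by metis
  define H where "H \<tau> = chart_map c (\<sigma> \<tau>)" for \<tau>
  define L where "L \<tau> = integral {a..\<tau>} (speed a b \<sigma>)" for \<tau>
  define G where "G \<tau> = ?n (H \<tau> - H s) - K * L \<tau>" for \<tau>
  have sub: "{s..t} \<subseteq> {a..b}" using st by auto
  have dL: "(L has_vector_derivative speed a b \<sigma> \<tau>) (at \<tau> within {s..t})" if "\<tau> \<in> {s..t}" for \<tau>
    unfolding L_def[abs_def]
    by (rule has_vector_derivative_within_subset[OF length_derivative[OF p] sub]) (use that sub in auto)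
  define V where "V \<tau> = vector_derivative (chart_map c \<circ> \<sigma>) (at \<tau> within {a..b})" for \<tau>
  have dH: "(H has_vector_derivative V \<tau>) (at \<tau> within {s..t})" if \<tau>: "\<tau> \<in> {s..t}" for \<tau>
  proof -
    have "\<tau> \<in> {a..b}" "\<sigma> \<tau> \<in> chart_dom c" using W[of \<tau>] \<tau> st by auto
    from has_vector_derivative_within_subset[OF P(3)[OF cX this] sub] show ?thesis
      by (simp add: H_def[abs_def] V_def comp_def)
  qed
  have VN: "?n (V \<tau>) \<le> K * speed a b \<sigma> \<tau>" if \<tau>: "\<tau> \<in> {s..t}" for \<tau>
  proof -
    have "\<tau> \<in> {a..b}" "c \<in> charts_at X (\<sigma> \<tau>)" using W[of \<tau>] \<tau> st cX by (auto simp: charts_at_iff)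
    then show ?thesis using speed_chart[OF p] W[of \<tau>] \<tau> by (simp add: V_def)
  qed
  have cont: "continuous_on {s..t} G"
  proof -
    have "continuous_on {s..t} H" "continuous_on {s..t} L"
      using has_derivative_continuous[OF dH[unfolded has_vector_derivative_def]]
        has_derivative_continuous[OF dL[unfolded has_vector_derivative_def]] by (simp_all add: continuous_on_eq_continuous_within)
    then show ?thesis unfolding G_def
      by (intro continuous_intros continuous_on_compose2[OF equivalent_norm_continuous[OF n, of UNIV]]) auto
  qed
  have "G t - G s \<le> \<eta> * (t - s)" if \<eta>: "\<eta> > 0" for \<eta>
  proof -
    have "G t \<le> G s + \<eta> * (t - s)"
    proof (rule dini_le[OF st(2) cont])
      fix \<tau> assume \<tau>: "s \<le> \<tau>" "\<tau> < t"
      \<comment> \<open>The first-order error of the coordinates is weighted by \<open>M\<close> and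
        that of the length by \<open>K\<close>; together they amount to \<eta> per unit of
        time.\<close>
      define e where "e = \<eta> / (M + K)"
      have MK: "M + K > 0" using M K by simp
      have e: "e > 0" using \<eta> MK by (simp add: e_def)
      obtain d1 where d1: "d1 > 0" "\<And>y. y \<in> {s..t} \<Longrightarrow> norm (y - \<tau>) < d1 \<Longrightarrow> norm (H y - H \<tau> - (y - \<tau>) *\<^sub>R V \<tau>) \<le> e * norm (y - \<tau>)"
        using dH[of \<tau>] \<tau> e unfolding has_vector_derivative_def has_derivative_within_alt by auto
      obtain d2 where d2: "d2 > 0" "\<And>y. y \<in> {s..t} \<Longrightarrow> norm (y - \<tau>) < d2 \<Longrightarrow> norm (L y - L \<tau> - (y - \<tau>) *\<^sub>R speed a b \<sigma> \<tau>) \<le> e * norm (y - \<tau>)"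
        using dL[of \<tau>] \<tau> e unfolding has_vector_derivative_def has_derivative_within_alt by auto
      show "\<exists>\<delta>>0. \<forall>y>\<tau>. y < \<tau> + \<delta> \<longrightarrow> y \<le> t \<longrightarrow> G y \<le> G \<tau> + \<eta> * (y - \<tau>)"
      proof (intro exI[of _ "min d1 d2"] conjI allI impI)
        fix y assume y: "\<tau> < y" "y < \<tau> + min d1 d2" "y \<le> t"
        have h1: "norm (H y - H \<tau> - (y - \<tau>) *\<^sub>R V \<tau>) \<le> e * (y - \<tau>)" using d1(2)[of y] y \<tau> by auto
        have h2: "\<bar>L y - L \<tau> - (y - \<tau>) * speed a b \<sigma> \<tau>\<bar> \<le> e * (y - \<tau>)" using d2(2)[of y] y \<tau> by auto
        have e': "H y - H s = (H \<tau> - H s) + ((y - \<tau>) *\<^sub>R V \<tau> + (H y - H \<tau> - (y - \<tau>) *\<^sub>R V \<tau>))" by simp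
        have "?n (H y - H s) \<le> ?n (H \<tau> - H s) + (?n ((y - \<tau>) *\<^sub>R V \<tau>) + ?n (H y - H \<tau> - (y - \<tau>) *\<^sub>R V \<tau>))"
          unfolding e' using D(4)[of "H \<tau> - H s" "(y - \<tau>) *\<^sub>R V \<tau> + (H y - H \<tau> - (y - \<tau>) *\<^sub>R V \<tau>)"]
            D(4)[of "(y - \<tau>) *\<^sub>R V \<tau>" "H y - H \<tau> - (y - \<tau>) *\<^sub>R V \<tau>"] by linarith
        also have "?n ((y - \<tau>) *\<^sub>R V \<tau>) \<le> (y - \<tau>) * (K * speed a b \<sigma> \<tau>)"
          using D(3)[of "y - \<tau>" "V \<tau>"] VN[of \<tau>] y \<tau> by (simp add: mult_left_mono)
        also have "?n (H y - H \<tau> - (y - \<tau>) *\<^sub>R V \<tau>) \<le> M * (e * (y - \<tau>))"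
          using M(2) mult_left_mono[OF h1, of M] M(1) by (meson less_eq_real_def order_trans)
        also have "(y - \<tau>) * (K * speed a b \<sigma> \<tau>) = K * ((y - \<tau>) * speed a b \<sigma> \<tau>)" by simp
        also have "\<dots> \<le> K * (L y - L \<tau> + e * (y - \<tau>))" using h2 K by (intro mult_left_mono) auto
        finally have "G y \<le> G \<tau> + (M + K) * e * (y - \<tau>)" by (simp add: G_def algebra_simps)
        then show "G y \<le> G \<tau> + \<eta> * (y - \<tau>)" using MK by (simp add: e_def)
      qed (use d1 d2 in auto)
    qed
    then show ?thesis by simp
  qed
  note Gle = this
  have "G t - G s \<le> \<eta>" if "\<eta> > 0" for \<eta>
  proof -
    have "\<eta> / (t - s + 1) * (t - s) \<le> \<eta>" using that st by (simp add: field_simps)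
    moreover have "\<eta> / (t - s + 1) > 0" using that st by simp
    ultimately show ?thesis using Gle[of "\<eta> / (t - s + 1)"] by linarith
  qed
  then have "G t - G s \<le> 0 + \<eta>" if "\<eta> > 0" for \<eta> using that by simp
  then have "G t - G s \<le> 0" by (rule field_le_epsilon)
  moreover have "G s = - (K * L s)" by (simp add: G_def D(5))
  moreover have "G t = ?n (H t - H s) - K * L t" by (simp add: G_def)
  ultimately have "?n (H t - H s) \<le> K * (L t - L s)" by (simp add: right_diff_distrib)
  then show ?thesis by (simp only: H_def L_def)
qed

text \<open>The danger is that the path leaves the chart domain, where coordinates say nothing about
  it. At a first exit time the preceding coordinates are Cauchy by the length estimate, their limit
  is still strictly inside the norm ball, and the Hausdorff property identifies the point on the
  path with the point of these coordinates.\<close>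

lemma path_stays_in_chart:
  assumes p: "C1_path X a b \<sigma>" and c: "c \<in> charts_at X x" and K: "K \<ge> 0"
    and \<rho>: "\<And>z. chart_norm X c x (z - chart_map c x) < \<rho> \<Longrightarrow> z \<in> chart_ran c \<and>
        (\<forall>v. chart_norm X c x v \<le> K * chart_norm X c (chart_inv c z) v)"
    and start: "\<sigma> a \<in> chart_dom c"
    and short: "K * path_len X a b \<sigma> + chart_norm X c x (chart_map c (\<sigma> a) - chart_map c x) < \<rho>"
  shows "\<sigma> b \<in> chart_dom c" "chart_norm X c x (chart_map c (\<sigma> b) - chart_map c (\<sigma> a)) \<le> K * path_len X a b \<sigma>"
proof -
  note P = C1_pathD[OF p]
  let ?n = "chart_norm X c x"
  have n: "equivalent_norm ?n" by (rule equivalent_chart_norm[OF c])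
  note D = equivalent_normD[OF n]
  have cX: "c \<in> charts X" using c by (simp add: charts_at_iff)
  note hc = is_chartD[OF charts_is_chart[OF cX]]
  define L where "L \<tau> = integral {a..\<tau>} (speed a b \<sigma>)" for \<tau>
  let ?W = "{u\<in>chart_dom c. ?n (chart_map c u - chart_map c x) < \<rho>}"
  have L: "continuous_on {a..b} L" "L a = 0" "L b = path_len X a b \<sigma>"
    using has_derivative_continuous[OF length_derivative[OF p, unfolded has_vector_derivative_def]]
    by (simp_all add: L_def[abs_def] path_len_speed continuous_on_eq_continuous_within)
  have Lmono: "L s \<le> L t" if "a \<le> s" "s \<le> t" "t \<le> b" for s t
  proof -
    have "L s + integral {s..t} (speed a b \<sigma>) = L t" unfolding L_def
      using that by (intro Henstock_Kurzweil_Integration.integral_combine integrable_continuous_real continuous_on_subset[OF continuous_speed[OF p]]) auto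
    moreover have "0 \<le> integral {s..t} (speed a b \<sigma>)"
      using that by (intro integral_nonneg integrable_continuous_real continuous_on_subset[OF continuous_speed[OF p]] speed_nonneg[OF p]) auto
    ultimately show ?thesis by simp
  qed
  have \<rho>0: "\<rho> > 0"
    using short D(1)[of "chart_map c (\<sigma> a) - chart_map c x"] K path_len_nonneg[OF p] by (smt (verit) mult_nonneg_nonneg)
  have Wa: "\<sigma> a \<in> ?W" using start short K path_len_nonneg[OF p] by (smt (verit) mem_Collect_eq mult_nonneg_nonneg)
  have lip: "?n (chart_map c (\<sigma> t) - chart_map c (\<sigma> s)) \<le> K * (L t - L s)"
    if "a \<le> s" "s \<le> t" "t \<le> b" "\<And>\<tau>. s \<le> \<tau> \<Longrightarrow> \<tau> \<le> t \<Longrightarrow> \<sigma> \<tau> \<in> ?W" for s t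
    unfolding L_def
  proof (rule path_chart_lipschitz[OF p that(1-3) c K])
    fix \<tau> assume "s \<le> \<tau>" "\<tau> \<le> t"
    from that(4)[OF this] show "\<sigma> \<tau> \<in> chart_dom c \<and> (\<forall>v. ?n v \<le> K * chart_norm X c (\<sigma> \<tau>) v)"
      using \<rho>[of "chart_map c (\<sigma> \<tau>)"] hc by auto
  qed
  have stay: "\<sigma> t \<in> ?W" if t: "a < t" "t \<le> b" and before: "\<And>s. a \<le> s \<Longrightarrow> s < t \<Longrightarrow> \<sigma> s \<in> ?W" for t
  proof -
    define s where "s k = t - (t - a) / real (k + 2)" for k
    have s: "a \<le> s k" "s k < t" for k
      using t mult_left_mono[of 1 "real (k + 2)" "t - a"] by (auto simp: s_def field_simps)
    have slim: "s \<longlonglongrightarrow> t"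
    proof -
      have "(\<lambda>k. (t - a) / real (k + 2)) \<longlonglongrightarrow> 0"
        by (rule LIMSEQ_ignore_initial_segment[OF lim_const_over_n])
      then show ?thesis unfolding s_def[abs_def] using tendsto_diff[OF tendsto_const] by fastforce
    qed
    have sab: "s k \<in> {a..b}" for k using s[of k] t by auto
    have Llim: "(\<lambda>k. L (s k)) \<longlonglongrightarrow> L t"
      by (rule continuous_on_tendsto_compose[OF L(1) slim]) (use t sab in auto)
    define y where "y k = chart_map c (\<sigma> (s k))" for k
    have ydiff: "?n (y k - y l) \<le> K * \<bar>L (s k) - L (s l)\<bar>" for k l
    proof (cases "s l \<le> s k")
      case True
      have "?n (y k - y l) \<le> K * (L (s k) - L (s l))" unfolding y_def
      proof (rule lip)
        show "\<sigma> \<tau> \<in> ?W" if "s l \<le> \<tau>" "\<tau> \<le> s k" for \<tau>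
          by (rule before) (use that s[of l] s[of k] in linarith)+
      qed (use True s[of l] s[of k] t in linarith)+
      then show ?thesis using K by (smt (verit) mult_left_mono)
    next
      case False
      have "?n (y l - y k) \<le> K * (L (s l) - L (s k))" unfolding y_def
      proof (rule lip)
        show "\<sigma> \<tau> \<in> ?W" if "s k \<le> \<tau>" "\<tau> \<le> s l" for \<tau>
          by (rule before) (use that s[of l] s[of k] in linarith)+
      qed (use False s[of l] s[of k] t in linarith)+
      then show ?thesis using K D(7)[of "y k" "y l"] by (smt (verit) mult_left_mono)
    qed
    obtain m M where m: "m > 0" "\<And>v. m * norm v \<le> ?n v" using equivalent_norm_bounds[OF n] by metis
    have "Cauchy y"
    proof (rule CauchyI)
      fix e :: real assume e: "e > 0"
      define e' where "e' = m * e / (K + 1)"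
      have "e' > 0" using e m K by (simp add: e'_def)
      then obtain N where N: "\<And>i j. i \<ge> N \<Longrightarrow> j \<ge> N \<Longrightarrow> norm (L (s i) - L (s j)) < e'"
        using CauchyD[OF LIMSEQ_imp_Cauchy[OF Llim]] by metis
      have "norm (y i - y j) < e" if "i \<ge> N" "j \<ge> N" for i j
      proof -
        have "m * norm (y i - y j) \<le> K * \<bar>L (s i) - L (s j)\<bar>" using m(2) ydiff order_trans by blast
        also have "\<dots> \<le> K * e'" using N[OF that] K by (intro mult_left_mono) auto
        also have "\<dots> < (K + 1) * e'" using \<open>e' > 0\<close> by simp
        also have "\<dots> = m * e" using K by (simp add: e'_def)
        finally show ?thesis using m(1) by simp
      qed
      then show "\<exists>N. \<forall>i\<ge>N. \<forall>j\<ge>N. norm (y i - y j) < e" by blast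
    qed
    then obtain z where z: "y \<longlonglongrightarrow> z" using Cauchy_convergent convergent_def by blast
    have "?n (y k - chart_map c x) \<le> K * path_len X a b \<sigma> + ?n (chart_map c (\<sigma> a) - chart_map c x)" for k
    proof -
      have "?n (y k - chart_map c (\<sigma> a)) \<le> K * (L (s k) - L a)" unfolding y_def
      proof (rule lip)
        show "\<sigma> \<tau> \<in> ?W" if "a \<le> \<tau>" "\<tau> \<le> s k" for \<tau>
          by (rule before) (use that s[of k] in linarith)+
      qed (use s[of k] t in linarith)+
      also have "\<dots> \<le> K * path_len X a b \<sigma>" using Lmono[of "s k" b] L s[of k] t K by (intro mult_left_mono) auto
      finally show ?thesis using D(8)[of "y k" "chart_map c x" "chart_map c (\<sigma> a)"] by simp
    qed
    moreover have "(\<lambda>k. ?n (y k - chart_map c x)) \<longlonglongrightarrow> ?n (z - chart_map c x)"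
      by (intro continuous_on_tendsto_compose[OF equivalent_norm_continuous[OF n, of UNIV]] tendsto_intros z) auto
    ultimately have "?n (z - chart_map c x) \<le> K * path_len X a b \<sigma> + ?n (chart_map c (\<sigma> a) - chart_map c x)"
      by (intro LIMSEQ_le_const2) auto
    \<comment> \<open>The strict inequality in \<open>short\<close> survives the passage to the
      limit, so \<open>z\<close> is interior and \<open>chart_inv c\<close> is continuous
      there.\<close>
    then have zn: "?n (z - chart_map c x) < \<rho>" using short by simp
    then have zr: "z \<in> chart_ran c" using \<rho> by blast
    have yr: "y k \<in> chart_ran c" "chart_inv c (y k) = \<sigma> (s k)" for k
      using before[OF s] hc by (auto simp: y_def)
    have "(\<lambda>k. chart_inv c (y k)) \<longlonglongrightarrow> chart_inv c z"
      by (rule continuous_on_tendsto_compose[OF hc(8) z zr]) (simp add: yr)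
    moreover have "(\<lambda>k. \<sigma> (s k)) \<longlonglongrightarrow> \<sigma> t"
      by (rule continuous_on_tendsto_compose[OF P(2) slim]) (use t sab in auto)
    ultimately have "\<sigma> t = chart_inv c z" using LIMSEQ_unique by (simp add: yr) blast
    then show ?thesis using zn zr hc by auto
  qed
  have all: "\<sigma> t \<in> ?W" if "t \<in> {a..b}" for t
  proof (rule ccontr)
    assume bad: "\<sigma> t \<notin> ?W"
    \<comment> \<open>A closed set of times, whose infimum is the first exit time.\<close>
    let ?B = "{a..b} \<inter> \<sigma> -` (- ?W)"
    have cl: "closed ?B"
      by (rule continuous_closed_preimage[OF P(2) closed_atLeastAtMost]) (use open_chart_ball[OF c] in auto)
    have ne: "?B \<noteq> {}" and bb: "bdd_below ?B" using bad that by auto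
    have T: "Inf ?B \<in> ?B" by (rule closed_contains_Inf[OF ne bb cl])
    have "Inf ?B \<noteq> a" using T Wa by auto
    then have "a < Inf ?B" "Inf ?B \<le> b" using T by auto
    moreover have "\<sigma> s \<in> ?W" if "a \<le> s" "s < Inf ?B" for s
      using cInf_lower[OF _ bb, of s] that \<open>Inf ?B \<le> b\<close> by force
    ultimately have "\<sigma> (Inf ?B) \<in> ?W" by (rule stay)
    then show False using T by auto
  qed
  show "\<sigma> b \<in> chart_dom c" using all[of b] P(1) by auto
  have "?n (chart_map c (\<sigma> b) - chart_map c (\<sigma> a)) \<le> K * (L b - L a)"
    by (rule lip) (use all P(1) in auto)
  then show "?n (chart_map c (\<sigma> b) - chart_map c (\<sigma> a)) \<le> K * path_len X a b \<sigma>" using L by simp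
qed

text \<open>Coordinate segments bound the distance from above. For the lower bound, nearly shortest
  paths are too short to leave the chart ball, and inside it the length dominates the coordinate
  displacement.\<close>

lemma fdist_chart_comparison:
  assumes c: "c \<in> charts_at X x" and Q: "open Q" "x \<in> Q" and \<epsilon>: "\<epsilon> > 0"
  obtains r where "r > 0" "fball X x r \<subseteq> Q \<inter> chart_dom c"
    "\<And>u v. u \<in> fball X x r \<Longrightarrow> v \<in> fball X x r \<Longrightarrow>
       chart_norm X c x (chart_map c u - chart_map c v) \<le> (1 + \<epsilon>) * fdist X u v"
    "\<And>u v. u \<in> fball X x r \<Longrightarrow> v \<in> fball X x r \<Longrightarrow>
       fdist X u v \<le> (1 + \<epsilon>) * chart_norm X c x (chart_map c u - chart_map c v)"
    "\<exists>T. open T \<and> x \<in> T \<and> T \<subseteq> fball X x r"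
proof -
  let ?n = "chart_norm X c x"
  have n: "equivalent_norm ?n" by (rule equivalent_chart_norm[OF c])
  note D = equivalent_normD[OF n]
  have x: "x \<in> chart_dom c" using c by (simp add: charts_at_iff)
  note hc = is_chartD[OF charts_at_D(1)[OF c]]
  obtain U where U: "open U" "x \<in> U" "U \<subseteq> chart_dom c"
    "\<And>u v. u \<in> U \<Longrightarrow> ?n v \<le> (1 + \<epsilon>) * chart_norm X c u v"
    "\<And>u v. u \<in> U \<Longrightarrow> chart_norm X c u v \<le> (1 + \<epsilon>) * ?n v"
    by (rule chart_norm_comparison[OF c \<epsilon>]) blast
  have "open (U \<inter> Q)" "x \<in> U \<inter> Q" using U Q by auto
  then obtain \<rho> where \<rho>: "\<rho> > 0" "\<And>z. ?n (z - chart_map c x) < \<rho> \<Longrightarrow> z \<in> chart_ran c \<and> chart_inv c z \<in> U \<inter> Q"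
    by (rule chart_ball_exists[OF c]) blast
  have k: "1 + \<epsilon> \<ge> 0" using \<epsilon> by simp
  have \<rho>1: "z \<in> chart_ran c \<and> (\<forall>v. ?n v \<le> (1 + \<epsilon>) * chart_norm X c (chart_inv c z) v)" if "?n (z - chart_map c x) < \<rho>" for z
    using \<rho>(2)[OF that] U(4) by blast
  have \<rho>2: "z \<in> chart_ran c \<and> (\<forall>v. chart_norm X c (chart_inv c z) v \<le> (1 + \<epsilon>) * ?n v)" if "?n (z - chart_map c x) < \<rho>" for z
    using \<rho>(2)[OF that] U(5) by blast
  \<comment> \<open>Two points of the \<open>r\<close>-ball are less than \<open>2 * r\<close> apart
    and have coordinates within \<open>(1 + \<epsilon>) * r\<close> of the centre. A nearly shortest
    path between them thus stays within \<open>(1 + \<epsilon>) * (3 * r)\<close>, which is three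
    quarters of \<rho>.\<close>
  define r where "r = \<rho> / (4 * (1 + \<epsilon>))"
  have "(1 + \<epsilon>) * (3 * r) = 3 / 4 * \<rho>" using \<epsilon> by (simp add: r_def field_simps)
  then have r: "r > 0" "(1 + \<epsilon>) * (3 * r) < \<rho>" "(1 + \<epsilon>) * (4 * r) = \<rho>"
    using \<rho>(1) \<epsilon> by (simp_all add: r_def)
  have lower: "v \<in> chart_dom c \<and> ?n (chart_map c v - chart_map c u) \<le> (1 + \<epsilon>) * fdist X u v"
    if u: "u \<in> chart_dom c" and d: "(1 + \<epsilon>) * fdist X u v + ?n (chart_map c u - chart_map c x) < \<rho>" for u v
  proof -
    \<comment> \<open>The infimum of lengths need not be attained, hence the slack \<open>e\<close>;
      it is bounded by the remaining room in the chart ball and then sent to 0.\<close>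
    have *: "v \<in> chart_dom c \<and> ?n (chart_map c v - chart_map c u) \<le> (1 + \<epsilon>) * fdist X u v + e"
      if e: "e > 0" "e + ((1 + \<epsilon>) * fdist X u v + ?n (chart_map c u - chart_map c x)) < \<rho>" for e
    proof -
      have "fdist X u v < fdist X u v + e / (1 + \<epsilon>)" using e \<epsilon> by simp
      then obtain a b \<sigma> where p: "C1_path X a b \<sigma>" "\<sigma> a = u" "\<sigma> b = v" "path_len X a b \<sigma> < fdist X u v + e / (1 + \<epsilon>)"
        by (rule fdist_less_path)
      have len: "(1 + \<epsilon>) * path_len X a b \<sigma> \<le> (1 + \<epsilon>) * fdist X u v + e"
        using mult_left_mono[OF less_imp_le[OF p(4)] k] \<epsilon> by (simp add: distrib_left)
      have "\<sigma> a \<in> chart_dom c" "(1 + \<epsilon>) * path_len X a b \<sigma> + ?n (chart_map c (\<sigma> a) - chart_map c x) < \<rho>"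
        using p u len e by auto
      from path_stays_in_chart[OF p(1) c k \<rho>1 this] show ?thesis using p len by auto
    qed
    define e0 where "e0 = (\<rho> - ((1 + \<epsilon>) * fdist X u v + ?n (chart_map c u - chart_map c x))) / 2"
    have e0: "e0 > 0" "e0 + ((1 + \<epsilon>) * fdist X u v + ?n (chart_map c u - chart_map c x)) < \<rho>" using d by (auto simp: e0_def field_simps)
    have "?n (chart_map c v - chart_map c u) \<le> (1 + \<epsilon>) * fdist X u v + e" if "e > 0" for e
    proof -
      have "min e e0 > 0" "min e e0 \<le> e" "min e e0 \<le> e0" using that e0 by auto
      then show ?thesis using *[of "min e e0"] e0(2) by linarith
    qed
    then show ?thesis using *[OF e0] by (auto intro: field_le_epsilon)
  qed
  have inball: "v \<in> chart_dom c \<and> ?n (chart_map c v - chart_map c x) < (1 + \<epsilon>) * r" if "v \<in> fball X x r" for v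
  proof -
    have lt: "fdist X x v < r" using that by (simp add: fball_def)
    then have lt': "(1 + \<epsilon>) * fdist X x v < (1 + \<epsilon>) * r" using \<epsilon> by simp
    moreover have "(1 + \<epsilon>) * r < \<rho>" using r \<epsilon> by (simp add: field_simps)
    ultimately show ?thesis using lower[OF x, of v] D(5) by auto
  qed
  have small: "(1 + \<epsilon>) * r < \<rho>" using r \<epsilon> by (simp add: field_simps)
  show thesis
  proof (rule that[OF r(1)])
    show "fball X x r \<subseteq> Q \<inter> chart_dom c"
    proof
      fix v assume "v \<in> fball X x r"
      from inball[OF this] show "v \<in> Q \<inter> chart_dom c"
        using \<rho>(2)[of "chart_map c v"] small hc by auto
    qed
    fix u v assume uv: "u \<in> fball X x r" "v \<in> fball X x r"
    have "fdist X v u \<le> fdist X v x + fdist X x u" by (rule fdist_triangle)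
    then have "fdist X v u < 2 * r" using uv fdist_commute[of v x] by (simp add: fball_def)
    then have "(1 + \<epsilon>) * fdist X v u \<le> (1 + \<epsilon>) * (2 * r)" using k by (intro mult_left_mono) auto
    moreover have "(1 + \<epsilon>) * (2 * r) + (1 + \<epsilon>) * r = (1 + \<epsilon>) * (3 * r)" by (simp add: algebra_simps)
    ultimately have "(1 + \<epsilon>) * fdist X v u + ?n (chart_map c v - chart_map c x) < \<rho>"
      using r(2) inball[OF uv(2)] by linarith
    then show "?n (chart_map c u - chart_map c v) \<le> (1 + \<epsilon>) * fdist X u v"
      using lower[of v u] inball[OF uv(2)] fdist_commute[of u v] by auto
    obtain a b \<sigma> where p: "C1_path X a b \<sigma>" "\<sigma> a = v" "\<sigma> b = u"
      "path_len X a b \<sigma> \<le> (1 + \<epsilon>) * ?n (chart_map c u - chart_map c v)"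
    proof (rule line_path_length[OF c \<rho>2])
      show "v \<in> chart_dom c" "u \<in> chart_dom c" using inball uv by auto
      show "?n (chart_map c v - chart_map c x) < \<rho>" "?n (chart_map c u - chart_map c x) < \<rho>"
        using inball[OF uv(1)] inball[OF uv(2)] small by linarith+
    qed
    show "fdist X u v \<le> (1 + \<epsilon>) * ?n (chart_map c u - chart_map c v)"
      using fdist_le_path_len[OF p(1-3)] p(4) fdist_commute[of u v] by linarith
  next
    let ?T = "{u\<in>chart_dom c. ?n (chart_map c u - chart_map c x) < r / (1 + \<epsilon>)}"
    have "r / (1 + \<epsilon>) > 0" using r \<epsilon> by simp
    then have "open ?T" "x \<in> ?T" using open_chart_ball[OF c] x D(5) by auto
    moreover have "u \<in> fball X x r" if u: "u \<in> ?T" for u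
    proof -
      have "r / (1 + \<epsilon>) \<le> r" using r \<epsilon> by (simp add: field_simps)
      also have "r < \<rho>" using r \<epsilon> by (smt (verit) mult_less_cancel_right2)
      finally have "r / (1 + \<epsilon>) < \<rho>" .
      obtain a b \<sigma> where p: "C1_path X a b \<sigma>" "\<sigma> a = x" "\<sigma> b = u"
        "path_len X a b \<sigma> \<le> (1 + \<epsilon>) * ?n (chart_map c u - chart_map c x)"
      proof (rule line_path_length[OF c \<rho>2])
        show "?n (chart_map c x - chart_map c x) < \<rho>" using D(5) \<rho>(1) by simp
        show "?n (chart_map c u - chart_map c x) < \<rho>" using u \<open>r / (1 + \<epsilon>) < \<rho>\<close> by auto
      qed (use x u in auto)
      have "(1 + \<epsilon>) * ?n (chart_map c u - chart_map c x) < r" using u \<epsilon> by (simp add: field_simps)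
      then show ?thesis using fdist_le_path_len[OF p(1-3)] p(4) by (simp add: fball_def)
    qed
    ultimately show "\<exists>T. open T \<and> x \<in> T \<and> T \<subseteq> fball X x r" by blast
  qed
qed

text \<open>The topology of the underlying type is the metric topology of \<open>fdist\<close>, so
  limits and continuity may be read either way.\<close>

lemma open_iff_fball: "open S \<longleftrightarrow> (\<forall>x\<in>S. \<exists>r>0. fball X x r \<subseteq> S)"
proof
  assume S: "open S"
  show "\<forall>x\<in>S. \<exists>r>0. fball X x r \<subseteq> S"
  proof
    fix x assume x: "x \<in> S"
    obtain c where c: "c \<in> charts_at X x" using chart_exists by blast
    show "\<exists>r>0. fball X x r \<subseteq> S" by (rule fdist_chart_comparison[OF c S x zero_less_one]) blast
  qed
next
  assume S: "\<forall>x\<in>S. \<exists>r>0. fball X x r \<subseteq> S"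
  show "open S"
    unfolding open_subopen[of S]
  proof
    fix x assume "x \<in> S"
    then obtain r where r: "r > 0" "fball X x r \<subseteq> S" using S by blast
    obtain c where c: "c \<in> charts_at X x" using chart_exists by blast
    obtain r' where r': "r' > 0" "\<exists>T. open T \<and> x \<in> T \<and> T \<subseteq> fball X x r'"
      "fball X x r' \<subseteq> UNIV \<inter> chart_dom c"
      "\<And>u v. u \<in> fball X x r' \<Longrightarrow> v \<in> fball X x r' \<Longrightarrow> fdist X u v \<le> (1 + 1) * chart_norm X c x (chart_map c u - chart_map c v)"
      by (rule fdist_chart_comparison[OF c open_UNIV UNIV_I zero_less_one]) blast
    note D = equivalent_normD[OF equivalent_chart_norm[OF c]]
    obtain T where T: "open T" "x \<in> T" "T \<subseteq> fball X x r'" using r'(2) by blast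
    let ?T = "T \<inter> {u\<in>chart_dom c. chart_norm X c x (chart_map c u - chart_map c x) < r / 2}"
    have "open ?T" using T open_chart_ball[OF c, of "chart_map c x" "r/2"] r by auto
    moreover have "x \<in> ?T" using T c r D(5) by (auto simp: charts_at_iff)
    moreover have "?T \<subseteq> fball X x r"
    proof
      fix u assume u: "u \<in> ?T"
      then have "fdist X u x \<le> (1 + 1) * chart_norm X c x (chart_map c u - chart_map c x)" using T r'(4) by blast
      then show "u \<in> fball X x r" using u fdist_commute[of u x] by (simp add: fball_def)
    qed
    ultimately show "\<exists>T. open T \<and> x \<in> T \<and> T \<subseteq> S" using r(2) by blast
  qed
qed

lemma fdist_self [simp]: "fdist X x x = 0"
proof -
  obtain c where c: "c \<in> charts_at X x" using chart_exists by blast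
  note D = equivalent_normD[OF equivalent_chart_norm[OF c]]
  obtain r where r: "\<exists>T. open T \<and> x \<in> T \<and> T \<subseteq> fball X x r"
    "\<And>u v. u \<in> fball X x r \<Longrightarrow> v \<in> fball X x r \<Longrightarrow> fdist X u v \<le> (1 + 1) * chart_norm X c x (chart_map c u - chart_map c v)"
    by (rule fdist_chart_comparison[OF c open_UNIV UNIV_I zero_less_one]) blast
  have "x \<in> fball X x r" using r(1) by blast
  from r(2)[OF this this] show ?thesis using fdist_nonneg[of x x] by (simp add: D(5))
qed

lemma fdist_eq_0: "fdist X x y = 0 \<longleftrightarrow> x = y"
proof
  assume d: "fdist X x y = 0"
  show "x = y"
  proof (rule ccontr)
    assume "x \<noteq> y"
    then obtain S where S: "open S" "x \<in> S" "y \<notin> S" using t1_space by blast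
    then obtain r where "r > 0" "fball X x r \<subseteq> S" using open_iff_fball by blast
    then have "y \<in> S" using d by (auto simp: fball_def)
    then show False using S by simp
  qed
qed simp

lemma fball_open: "open (fball X x r)"
  unfolding open_iff_fball
proof
  fix u assume u: "u \<in> fball X x r"
  have "fball X u (r - fdist X x u) \<subseteq> fball X x r"
  proof
    fix v assume "v \<in> fball X u (r - fdist X x u)"
    then show "v \<in> fball X x r" using fdist_triangle[of x v u] by (simp add: fball_def)
  qed
  then show "\<exists>s>0. fball X u s \<subseteq> fball X x r" using u by (intro exI[of _ "r - fdist X x u"]) (simp add: fball_def)
qed

lemma tendsto_fdist: "(g \<longlongrightarrow> x) F \<longleftrightarrow> ((\<lambda>t. fdist X x (g t)) \<longlongrightarrow> 0) F"
proof
  assume g: "(g \<longlongrightarrow> x) F"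
  show "((\<lambda>t. fdist X x (g t)) \<longlongrightarrow> 0) F"
  proof (rule tendstoI)
    fix e :: real assume "e > 0"
    then have "x \<in> fball X x e" by (simp add: fball_def)
    then have "\<forall>\<^sub>F t in F. g t \<in> fball X x e" using g fball_open topological_tendstoD by blast
    then show "\<forall>\<^sub>F t in F. dist (fdist X x (g t)) 0 < e"
      by eventually_elim (simp add: fball_def fdist_nonneg)
  qed
next
  assume g: "((\<lambda>t. fdist X x (g t)) \<longlongrightarrow> 0) F"
  show "(g \<longlongrightarrow> x) F"
  proof (rule topological_tendstoI)
    fix S assume "open S" "x \<in> S"
    then obtain r where r: "r > 0" "fball X x r \<subseteq> S" using open_iff_fball by blast
    have "\<forall>\<^sub>F t in F. fdist X x (g t) < r" by (rule order_tendstoD(2)[OF g r(1)])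
    then show "\<forall>\<^sub>F t in F. g t \<in> S" by eventually_elim (use r in \<open>auto simp: fball_def\<close>)
  qed
qed

section \<open>Completeness and continuity of the distance\<close>

lemma Metric_space_fdist: "Metric_space UNIV (fdist X)"
  by standard (auto simp: fdist_nonneg fdist_commute fdist_eq_0 fdist_triangle)

lemma complete_convergent:
  assumes "finsler_complete X"
    and C: "\<And>e. e > 0 \<Longrightarrow> \<exists>N. \<forall>i\<ge>N. \<forall>j\<ge>N. fdist X (s i) (s j) < e"
  obtains x where "s \<longlonglongrightarrow> x"
proof -
  interpret M: Metric_space UNIV "fdist X" by (rule Metric_space_fdist)
  have "M.MCauchy s" unfolding M.MCauchy_def using C by auto
  then obtain x where x: "limitin M.mtopology s x sequentially"
    using assms(1) unfolding finsler_complete_def M.mcomplete_def by blast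
  have "(\<lambda>n. fdist X x (s n)) \<longlonglongrightarrow> 0"
  proof (rule tendstoI)
    fix e :: real assume "e > 0"
    then have "\<forall>\<^sub>F n in sequentially. fdist X (s n) x < e"
      using x unfolding M.limitin_metric by auto
    then show "\<forall>\<^sub>F n in sequentially. dist (fdist X x (s n)) 0 < e"
      by eventually_elim (simp add: fdist_nonneg fdist_commute)
  qed
  then show thesis using that tendsto_fdist by blast
qed

lemma abs_fdist_diff: "\<bar>fdist X x u - fdist X x v\<bar> \<le> fdist X u v"
  using fdist_triangle[of x u v] fdist_triangle[of x v u] fdist_commute[of u v] by linarith

lemma continuous_fdist: "continuous_on S (fdist X x)"
  unfolding continuous_on_def
proof
  fix u assume "u \<in> S"
  have "((\<lambda>v. v) \<longlongrightarrow> u) (at u within S)" by (rule tendsto_ident_at)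
  then have "((\<lambda>v. fdist X u v) \<longlongrightarrow> 0) (at u within S)" by (simp add: tendsto_fdist)
  then show "(fdist X x \<longlongrightarrow> fdist X x u) (at u within S)"
  proof (rule metric_tendsto_imp_tendsto)
    show "\<forall>\<^sub>F v in at u within S. dist (fdist X x v) (fdist X x u) \<le> dist (fdist X u v) 0"
      using abs_fdist_diff[of x] fdist_commute fdist_nonneg by (intro always_eventually) (simp add: dist_real_def)
  qed
qed

end


section \<open>Covering maps from lifts of segments\<close>

locale local_homeo =
  fixes f :: "'x::t2_space \<Rightarrow> 'y::t2_space"
  assumes cont: "continuous_on UNIV f"
    and local_inj: "\<exists>N. open N \<and> x \<in> N \<and> inj_on f N \<and> (\<forall>S. open S \<longrightarrow> S \<subseteq> N \<longrightarrow> open (f ` S))"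
begin

text \<open>The set of agreement is relatively open because \<open>f\<close> is locally injective,
  and relatively closed because the source is Hausdorff.\<close>

lemma lift_unique:
  fixes s1 s2 :: "'a::topological_space \<Rightarrow> 'x"
  assumes C: "connected C" and s: "continuous_on C s1" "continuous_on C s2"
    and eq: "\<And>z. z \<in> C \<Longrightarrow> f (s1 z) = f (s2 z)" and p: "p \<in> C" "s1 p = s2 p" and z: "z \<in> C"
  shows "s1 z = s2 z"
proof -
  let ?T = "{z\<in>C. s1 z = s2 z}"
  have "openin (top_of_set C) ?T"
  proof (subst openin_subopen, intro ballI)
    fix a assume a: "a \<in> ?T"
    obtain N where N: "open N" "s1 a \<in> N" "inj_on f N" using local_inj[of "s1 a"] by blast
    let ?U = "(C \<inter> s1 -` N) \<inter> (C \<inter> s2 -` N)"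
    have "openin (top_of_set C) ?U"
      by (intro openin_Int continuous_openin_preimage_gen s N)
    moreover have "a \<in> ?U" using a N by auto
    moreover have "?U \<subseteq> ?T" using N(3) eq by (auto dest: inj_onD)
    ultimately show "\<exists>T. openin (top_of_set C) T \<and> a \<in> T \<and> T \<subseteq> ?T" by blast
  qed
  moreover have "closedin (top_of_set C) ?T"
  proof -
    have "openin (top_of_set C) {z\<in>C. s1 z \<noteq> s2 z}"
    proof (subst openin_subopen, intro ballI)
      fix a assume a: "a \<in> {z\<in>C. s1 z \<noteq> s2 z}"
      then obtain A B where AB: "open A" "open B" "s1 a \<in> A" "s2 a \<in> B" "A \<inter> B = {}"
        using hausdorff[of "s1 a" "s2 a"] by blast
      let ?U = "(C \<inter> s1 -` A) \<inter> (C \<inter> s2 -` B)"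
      have "openin (top_of_set C) ?U"
        by (intro openin_Int continuous_openin_preimage_gen s AB)
      moreover have "a \<in> ?U" using a AB by auto
      moreover have "?U \<subseteq> {z\<in>C. s1 z \<noteq> s2 z}" using AB(5) by auto
      ultimately show "\<exists>T. openin (top_of_set C) T \<and> a \<in> T \<and> T \<subseteq> {z\<in>C. s1 z \<noteq> s2 z}" by blast
    qed
    moreover have "C - ?T = {z\<in>C. s1 z \<noteq> s2 z}" by auto
    ultimately show ?thesis by (auto simp: closedin_def)
  qed
  ultimately have "?T = {} \<or> ?T = C" using C unfolding connected_clopen by blast
  then show ?thesis using p z by blast
qed

lemma open_map: "open S \<Longrightarrow> open (f ` S)"
proof (subst open_subopen, intro ballI)
  fix y assume S: "open S" and "y \<in> f ` S"
  then obtain x where x: "x \<in> S" "y = f x" by blast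
  obtain N where N: "open N" "x \<in> N" "\<And>S. open S \<Longrightarrow> S \<subseteq> N \<Longrightarrow> open (f ` S)" using local_inj[of x] by blast
  have "open (f ` (S \<inter> N))" using N S by blast
  then show "\<exists>T. open T \<and> y \<in> T \<and> T \<subseteq> f ` S" using x N by blast
qed

end

text \<open>The set \<open>V\<close> stands for a chart ball with convex coordinate image
  \<open>P\<close> and inverse chart \<open>h\<close>. The analysis enters through
  \<open>lift_limit\<close> alone: a lift of a half-open segment has a limit at the open
  end.\<close>

locale star_lift = local_homeo f for f :: "'x::t2_space \<Rightarrow> 'y::t2_space" +
  fixes V :: "'y set" and P :: "'b::real_normed_vector set" and \<psi> h
  assumes homeo: "homeomorphism V P \<psi> h" and V: "open V" and P: "open P" "convex P"
    and lift_limit: "\<And>p w b \<gamma>. 0 < b \<Longrightarrow> (\<And>t. t \<in> {0..b} \<Longrightarrow> p + t *\<^sub>R w \<in> P) \<Longrightarrow> continuous_on {0..<b} \<gamma> \<Longrightarrow>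
      (\<And>t. t \<in> {0..<b} \<Longrightarrow> f (\<gamma> t) = h (p + t *\<^sub>R w)) \<Longrightarrow> \<exists>x. (\<gamma> \<longlongrightarrow> x) (at_left b)"
begin

lemma homeoD:
  shows "y \<in> V \<Longrightarrow> h (\<psi> y) = y" "y \<in> V \<Longrightarrow> \<psi> y \<in> P" "z \<in> P \<Longrightarrow> \<psi> (h z) = z" "z \<in> P \<Longrightarrow> h z \<in> V"
    "continuous_on V \<psi>" "continuous_on P h"
  using homeo by (auto simp: homeomorphism_def)

text \<open>A local inverse written over a coordinate ball. The final clause, that every point of
  \<open>N\<close> over the ball is a value of \<open>g\<close>, allows another lift that enters
  \<open>N\<close> to be recognised as \<open>g\<close>.\<close>

lemma local_inverse:
  assumes u: "f u \<in> V"
  obtains N \<delta> g where "open N" "u \<in> N" "\<delta> > 0" "ball (\<psi> (f u)) \<delta> \<subseteq> P" "continuous_on (ball (\<psi> (f u)) \<delta>) g"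
    "\<And>z. z \<in> ball (\<psi> (f u)) \<delta> \<Longrightarrow> f (g z) = h z" "g (\<psi> (f u)) = u"
    "\<And>y z. y \<in> N \<Longrightarrow> z \<in> ball (\<psi> (f u)) \<delta> \<Longrightarrow> f y = h z \<Longrightarrow> y = g z"
proof -
  obtain N where N: "open N" "u \<in> N" "inj_on f N" "\<And>S. open S \<Longrightarrow> S \<subseteq> N \<Longrightarrow> open (f ` S)" using local_inj[of u] by blast
  let ?p = "\<psi> (f u)"
  have oN: "open (f ` N)" using N by blast
  have p: "?p \<in> P" "h ?p = f u" using u homeoD by auto
  have "openin (top_of_set P) (P \<inter> h -` (f ` N))" by (rule continuous_openin_preimage_gen[OF homeoD(6) oN])
  then have "open (P \<inter> h -` (f ` N))" using P(1) openin_open_trans by blast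
  moreover have "?p \<in> P \<inter> h -` (f ` N)" using p N(2) by auto
  ultimately obtain \<delta> where \<delta>: "\<delta> > 0" "ball ?p \<delta> \<subseteq> P \<inter> h -` (f ` N)" unfolding open_contains_ball by blast
  define g where "g = inv_into N f \<circ> h"
  have "continuous_on (f ` N) (inv_into N f)"
  proof (rule continuous_on_inverse_open_map[OF continuous_on_subset[OF cont subset_UNIV] refl])
    show "openin (top_of_set (f ` N)) (f ` U)" if "openin (top_of_set N) U" for U
      using that N(1,4) oN by (metis openin_imp_subset openin_open_trans open_subset image_mono)
  qed (use N(3) in auto)
  then have "continuous_on (ball ?p \<delta>) g" unfolding g_def
    by (intro continuous_on_compose continuous_on_subset[OF homeoD(6)]) (use \<delta> in \<open>auto elim: continuous_on_subset\<close>)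
  moreover have "f (g z) = h z" if "z \<in> ball ?p \<delta>" for z
    using \<delta>(2) that f_inv_into_f[of "h z" f N] by (auto simp: g_def)
  moreover have "g ?p = u" using N p by (simp add: g_def)
  moreover have "y = g z" if "y \<in> N" "z \<in> ball ?p \<delta>" "f y = h z" for y z
    using that N(3) by (simp add: g_def flip: that(3))
  ultimately show thesis using that[OF N(1,2) \<delta>(1)] \<delta>(2) by blast
qed

text \<open>A continuous local section through \<open>x\<close> over an open set that is star-shaped
  about the coordinates of \<open>f x\<close>. Along each segment from the centre it is a lift with
  prescribed start, hence unique.\<close>

definition star_section :: "'x \<Rightarrow> 'b set \<Rightarrow> ('b \<Rightarrow> 'x) \<Rightarrow> bool"
  where "star_section x S s \<longleftrightarrow> open S \<and> S \<subseteq> P \<and> \<psi> (f x) \<in> S \<and> (\<forall>z\<in>S. closed_segment (\<psi> (f x)) z \<subseteq> S) \<and>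
    continuous_on S s \<and> (\<forall>z\<in>S. f (s z) = h z) \<and> s (\<psi> (f x)) = x"

lemma star_section_unique:
  assumes "star_section x S s" "star_section x S' s'" "z \<in> S" "z \<in> S'"
  shows "s z = s' z"
proof (rule lift_unique[of "closed_segment (\<psi> (f x)) z" s s' "\<psi> (f x)"])
  have "closed_segment (\<psi> (f x)) z \<subseteq> S" "closed_segment (\<psi> (f x)) z \<subseteq> S'" using assms by (auto simp: star_section_def)
  then show "continuous_on (closed_segment (\<psi> (f x)) z) s" "continuous_on (closed_segment (\<psi> (f x)) z) s'"
    using assms by (auto simp: star_section_def intro: continuous_on_subset)
  show "f (s y) = f (s' y)" if "y \<in> closed_segment (\<psi> (f x)) z" for y
  proof -
    have "y \<in> S" "y \<in> S'" using assms that unfolding star_section_def by blast+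
    then show ?thesis using assms by (simp add: star_section_def)
  qed
qed (use assms in \<open>auto simp: star_section_def\<close>)

text \<open>Any two star sections agree on their common domain, so the union of all of them is one;
  the local inverse at \<open>x\<close> shows that the family is not empty.\<close>

lemma maximal_star_section:
  assumes x: "f x \<in> V"
  obtains S s where "star_section x S s" "\<And>S' s'. star_section x S' s' \<Longrightarrow> S' \<subseteq> S"
proof -
  define I where "I = {(S, s). star_section x S s}"
  define S where "S = (\<Union>(S, s)\<in>I. S)"
  define s where "s z = (SOME y. \<exists>S' s'. star_section x S' s' \<and> z \<in> S' \<and> y = s' z)" for z
  have s_eq: "s z = s' z" if "star_section x S' s'" "z \<in> S'" for z S' s'
  proof -
    have "\<exists>S' s'. star_section x S' s' \<and> z \<in> S' \<and> s z = s' z"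
      unfolding s_def by (rule someI_ex) (use that in blast)
    then show ?thesis using star_section_unique that by metis
  qed
  have "star_section x S s"
    unfolding star_section_def
  proof (intro conjI ballI)
    show "open S" unfolding S_def I_def by (auto simp: star_section_def)
    show "S \<subseteq> P" unfolding S_def I_def by (auto simp: star_section_def)
    obtain N \<delta> g where g: "\<delta> > 0" "ball (\<psi> (f x)) \<delta> \<subseteq> P" "continuous_on (ball (\<psi> (f x)) \<delta>) g"
      "\<And>z. z \<in> ball (\<psi> (f x)) \<delta> \<Longrightarrow> f (g z) = h z" "g (\<psi> (f x)) = x"
      using local_inverse[OF x] by metis
    have "star_section x (ball (\<psi> (f x)) \<delta>) g"
      unfolding star_section_def using g by (auto simp: closed_segment_subset[OF _ _ convex_ball])
    then show "\<psi> (f x) \<in> S" "s (\<psi> (f x)) = x"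
      using s_eq[of "ball (\<psi> (f x)) \<delta>" g] g by (auto simp: S_def I_def)
    show "closed_segment (\<psi> (f x)) z \<subseteq> S" if zS: "z \<in> S" for z
    proof -
      obtain S' s' where i: "z \<in> S'" "star_section x S' s'" using zS by (auto simp: S_def I_def)
      then have "closed_segment (\<psi> (f x)) z \<subseteq> S'" by (auto simp: star_section_def)
      then show ?thesis using i(2) unfolding S_def I_def by blast
    qed
    show "f (s z) = h z" if "z \<in> S" for z
      using that s_eq unfolding S_def I_def by (auto simp: star_section_def)
    show "continuous_on S s" unfolding S_def
    proof (rule continuous_on_open_UN)
      fix i assume "i \<in> I"
      then obtain S' s' where i: "i = (S', s')" "star_section x S' s'" by (auto simp: I_def)
      then show "open (case i of (S, s) \<Rightarrow> S)" by (simp add: star_section_def)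
      have "continuous_on S' s" by (rule continuous_on_eq[of S' s']) (use i s_eq in \<open>auto simp: star_section_def\<close>)
      then show "continuous_on (case i of (S, s) \<Rightarrow> S) s" by (simp add: i)
    qed
  qed
  then show thesis using that[of S s] by (auto simp: S_def I_def)
qed

text \<open>On a segment from the centre to a missing point, let \<open>q\<close> be the first point
  outside \<open>S\<close>. The lift has a limit over \<open>q\<close>, and the local inverse
  \<open>g\<close> at that limit continues the section. A ball about \<open>q\<close> would spoil
  star-shapedness, so the extension is made over a truncated cone \<open>M\<close> with apex
  direction \<open>p\<close>.\<close>

lemma maximal_star_section_total:
  assumes x: "f x \<in> V" and ss: "star_section x S s" and max: "\<And>S' s'. star_section x S' s' \<Longrightarrow> S' \<subseteq> S"
  shows "S = P"
proof (rule ccontr)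
  assume "S \<noteq> P"
  define p where "p = \<psi> (f x)"
  have S: "open S" "S \<subseteq> P" "p \<in> S" "\<And>z. z \<in> S \<Longrightarrow> closed_segment p z \<subseteq> S" "continuous_on S s"
    "\<And>z. z \<in> S \<Longrightarrow> f (s z) = h z" "s p = x" using ss by (auto simp: star_section_def p_def)
  obtain z where z: "z \<in> P" "z \<notin> S" using \<open>S \<noteq> P\<close> S(2) by blast
  have pP: "p \<in> P" using S by blast
  define w where "w = z - p"
  have inP: "p + t *\<^sub>R w \<in> P" if "0 \<le> t" "t \<le> 1" for t
    using convexD_alt[OF P(2) pP z(1) that] by (simp add: w_def algebra_simps)
  define A where "A = {t\<in>{0..1}. p + t *\<^sub>R w \<notin> S}"
  have cw: "continuous_on B (\<lambda>t. p + t *\<^sub>R w)" for B by (intro continuous_intros)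
  have A_eq: "A = {0..1} \<inter> (\<lambda>t. p + t *\<^sub>R w) -` (- S)" by (auto simp: A_def)
  have clA: "closed A" unfolding A_eq by (rule continuous_closed_preimage[OF cw]) (use S in auto)
  have neA: "A \<noteq> {}" "bdd_below A" using z(2) by (auto simp: A_def w_def intro!: bdd_belowI[of _ 0])
  define t0 where "t0 = Inf A"
  have t0: "t0 \<in> A" unfolding t0_def by (rule closed_contains_Inf[OF neA clA])
  have "t0 \<noteq> 0" using t0 S(3) by (auto simp: A_def)
  then have t0': "0 < t0" "t0 \<le> 1" using t0 by (auto simp: A_def)
  define q where "q = p + t0 *\<^sub>R w"
  have q: "q \<notin> S" "q \<in> P" using t0 inP t0' by (auto simp: A_def q_def)
  have before: "p + t *\<^sub>R w \<in> S" if "0 \<le> t" "t < t0" for t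
    using cInf_lower[OF _ neA(2), of t] that t0' by (force simp: A_def t0_def)
  define \<gamma> where "\<gamma> t = s (p + t *\<^sub>R w)" for t
  have "\<exists>u. (\<gamma> \<longlongrightarrow> u) (at_left t0)"
  proof (rule lift_limit[of t0 p w])
    show "continuous_on {0..<t0} \<gamma>" unfolding \<gamma>_def
      by (rule continuous_on_compose2[OF S(5) cw]) (use before in auto)
  qed (use t0' inP before S(6) in \<open>auto simp: \<gamma>_def\<close>)
  then obtain u where u: "(\<gamma> \<longlongrightarrow> u) (at_left t0)" by blast
  have ev: "\<forall>\<^sub>F t in at_left t0. t \<in> {0<..<t0}"
    using eventually_at_left_real[OF t0'(1)] by simp
  have "((\<lambda>t. f (\<gamma> t)) \<longlongrightarrow> f u) (at_left t0)"
    by (rule continuous_on_tendsto_compose[OF cont u]) auto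
  moreover have lw: "((\<lambda>t. p + t *\<^sub>R w) \<longlongrightarrow> q) (at_left t0)" unfolding q_def by (intro tendsto_intros)
  have "((\<lambda>t. h (p + t *\<^sub>R w)) \<longlongrightarrow> h q) (at_left t0)"
    by (rule continuous_on_tendsto_compose[OF homeoD(6) lw q(2)])
       (use ev in eventually_elim, use inP t0' in auto)
  then have "((\<lambda>t. f (\<gamma> t)) \<longlongrightarrow> h q) (at_left t0)"
    by (rule Lim_transform_eventually) (use ev in eventually_elim, use before S(6) in \<open>auto simp: \<gamma>_def\<close>)
  ultimately have fu: "f u = h q" using tendsto_unique[OF trivial_limit_at_left_real] by blast
  then have uV: "f u \<in> V" "\<psi> (f u) = q" using q homeoD by auto
  obtain N \<delta> g where g: "open N" "u \<in> N" "\<delta> > 0" "ball q \<delta> \<subseteq> P" "continuous_on (ball q \<delta>) g"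
    "\<And>z. z \<in> ball q \<delta> \<Longrightarrow> f (g z) = h z" "g q = u"
    "\<And>y z. y \<in> N \<Longrightarrow> z \<in> ball q \<delta> \<Longrightarrow> f y = h z \<Longrightarrow> y = g z"
    by (rule local_inverse[OF uV(1), unfolded uV(2)]) blast
  have "\<forall>\<^sub>F t in at_left t0. \<gamma> t \<in> N" using topological_tendstoD[OF u g(1,2)] .
  moreover have "\<forall>\<^sub>F t in at_left t0. p + t *\<^sub>R w \<in> ball q \<delta>" using topological_tendstoD[OF lw open_ball] g(3) by simp
  ultimately have "\<forall>\<^sub>F t in at_left t0. \<gamma> t \<in> N \<and> p + t *\<^sub>R w \<in> ball q \<delta> \<and> t \<in> {0<..<t0}"
    using ev by eventually_elim auto
  \<comment> \<open>A time shortly before \<open>t0\<close> at which the lift has already entered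
    \<open>N\<close>; from there on \<open>s\<close> can be compared with \<open>g\<close>.\<close>
  from eventually_happens'[OF trivial_limit_at_left_real this]
  obtain t1 where t1: "\<gamma> t1 \<in> N" "p + t1 *\<^sub>R w \<in> ball q \<delta>" "0 < t1" "t1 < t0" by auto
  define q1 where "q1 = p + t1 *\<^sub>R w"
  have q1: "q1 \<in> S" "q1 \<in> ball q \<delta>" using before[of t1] t1 by (auto simp: q1_def)
  have sg1: "s q1 = g q1" using g(8)[OF t1(1,2)] S(6)[OF q1(1)] by (simp add: \<gamma>_def q1_def)
  have "open (S \<inter> ball q \<delta>)" using S by auto
  then obtain \<eta> where \<eta>: "\<eta> > 0" "ball q1 \<eta> \<subseteq> S \<inter> ball q \<delta>" using q1 unfolding open_contains_ball by blast
  have sg: "s y = g y" if y: "y \<in> ball q1 \<eta>" for y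
  proof (rule lift_unique[of "ball q1 \<eta>" s g q1])
    show "continuous_on (ball q1 \<eta>) s" "continuous_on (ball q1 \<eta>) g"
      using \<eta>(2) by (auto intro: continuous_on_subset[OF S(5)] continuous_on_subset[OF g(5)])
    show "f (s a) = f (g a)" if "a \<in> ball q1 \<eta>" for a using that \<eta>(2) S(6) g(6) by (metis IntE subsetD)
  qed (use \<eta> sg1 y in auto)
  \<comment> \<open>The homothety with centre \<open>p\<close> and ratio \<tau> sends
    \<open>q\<close> to \<open>q1\<close>.\<close>
  define \<tau> where "\<tau> = t1 / t0"
  have \<tau>: "0 < \<tau>" "\<tau> < 1" "\<tau> * t0 = t1" using t1 t0' by (auto simp: \<tau>_def)
  define \<delta>' where "\<delta>' = min \<delta> \<eta>"
  have \<delta>': "\<delta>' > 0" "\<delta>' \<le> \<delta>" "\<delta>' \<le> \<eta>" using g \<eta> by (auto simp: \<delta>'_def)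
  \<comment> \<open>The union of the homothetic images of \<open>ball q \<delta>'\<close> with
    ratios between \<tau> and 1. As a union of balls it is open, and it contains
    \<open>q\<close>.\<close>
  define M where "M = (\<Union>t\<in>{\<tau><..1}. ball (p + t *\<^sub>R (q - p)) (t * \<delta>'))"
  have MD: "\<exists>w' t. w' \<in> ball q \<delta>' \<and> \<tau> < t \<and> t \<le> 1 \<and> y = p + t *\<^sub>R (w' - p)" if yM: "y \<in> M" for y
  proof -
    obtain t where t: "\<tau> < t" "t \<le> 1" "y \<in> ball (p + t *\<^sub>R (q - p)) (t * \<delta>')" using yM unfolding M_def by auto
    define w' where "w' = p + (1 / t) *\<^sub>R (y - p)"
    have y: "y = p + t *\<^sub>R (w' - p)" using t \<tau> by (simp add: w'_def)
    have "p + t *\<^sub>R (q - p) - y = t *\<^sub>R (q - w')" unfolding y by (simp add: algebra_simps)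
    then have "t * norm (q - w') < t * \<delta>'" using t \<tau> by (simp add: dist_norm)
    then have "w' \<in> ball q \<delta>'" using t \<tau> by (simp add: dist_norm)
    then show ?thesis using t y by blast
  qed
  have MI: "p + t *\<^sub>R (w' - p) \<in> M" if "w' \<in> ball q \<delta>'" "\<tau> < t" "t \<le> 1" for w' t
  proof -
    have "p + t *\<^sub>R (q - p) - (p + t *\<^sub>R (w' - p)) = t *\<^sub>R (q - w')" by (simp add: algebra_simps)
    then have "p + t *\<^sub>R (w' - p) \<in> ball (p + t *\<^sub>R (q - p)) (t * \<delta>')" using that \<tau> by (simp add: dist_norm)
    then show ?thesis using that by (auto simp: M_def)
  qed
  \<comment> \<open>Every ray of the cone passes, at ratio \<tau>, through the ball where
    \<open>s\<close> and \<open>g\<close> are known to agree.\<close>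
  have base: "p + \<tau> *\<^sub>R (w' - p) \<in> ball q1 \<eta>" if "w' \<in> ball q \<delta>'" for w'
  proof -
    have "q1 - (p + \<tau> *\<^sub>R (w' - p)) = \<tau> *\<^sub>R (q - w')" using \<tau>(3) by (simp add: q1_def q_def algebra_simps)
    then have "dist q1 (p + \<tau> *\<^sub>R (w' - p)) = \<tau> * norm (q - w')" using \<tau> by (simp add: dist_norm)
    also have "\<dots> \<le> norm (q - w')" using \<tau> by (simp add: mult_left_le_one_le)
    also have "\<dots> < \<eta>" using that \<delta>' by (simp add: dist_norm)
    finally show ?thesis by simp
  qed
  have segM: "closed_segment (p + \<tau> *\<^sub>R (w' - p)) (p + t *\<^sub>R (w' - p)) \<subseteq> ball q \<delta>"
    if w': "w' \<in> ball q \<delta>'" and t: "\<tau> \<le> t" "t \<le> 1" for w' t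
  proof -
    have a: "p + \<tau> *\<^sub>R (w' - p) \<in> ball q \<delta>" using base[OF w'] \<eta>(2) by blast
    have b: "w' \<in> ball q \<delta>" using w' \<delta>' by auto
    have "p + t *\<^sub>R (w' - p) = (1 - (t - \<tau>) / (1 - \<tau>)) *\<^sub>R (p + \<tau> *\<^sub>R (w' - p)) + ((t - \<tau>) / (1 - \<tau>)) *\<^sub>R w'"
    proof -
      define k where "k = (t - \<tau>) / (1 - \<tau>)"
      have k: "\<tau> + k * (1 - \<tau>) = t" using \<tau> by (simp add: k_def)
      have "(1 - k) *\<^sub>R (p + \<tau> *\<^sub>R (w' - p)) + k *\<^sub>R w' = p + (\<tau> + k * (1 - \<tau>)) *\<^sub>R (w' - p)"
        by (simp add: algebra_simps)
      then show ?thesis by (simp add: k k_def[symmetric])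
    qed
    also have "\<dots> \<in> ball q \<delta>" by (rule convexD_alt[OF convex_ball a b]) (use t \<tau> in \<open>auto simp: field_simps\<close>)
    finally show ?thesis using a by (intro closed_segment_subset convex_ball)
  qed
  \<comment> \<open>The overlap of \<open>S\<close> and \<open>M\<close> need not be connected a
    priori, so agreement is carried along each ray separately, starting from its base point.\<close>
  have agree: "s y = g y" if y: "y \<in> S" "y \<in> M" for y
  proof -
    obtain w' t where w': "w' \<in> ball q \<delta>'" "\<tau> < t" "t \<le> 1" "y = p + t *\<^sub>R (w' - p)" using MD[OF y(2)] by blast
    let ?a = "p + \<tau> *\<^sub>R (w' - p)"
    have "?a \<in> closed_segment p y"
    proof -
      have "(1 - k) *\<^sub>R p + k *\<^sub>R y = p + (k * t) *\<^sub>R (w' - p)" for k unfolding w'(4) by (simp add: algebra_simps)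
      from this[of "\<tau> / t"] show ?thesis
        unfolding in_segment using w' \<tau> by (intro exI[of _ "\<tau> / t"]) auto
    qed
    then have "closed_segment ?a y \<subseteq> closed_segment p y" by (intro closed_segment_subset convex_closed_segment) auto
    then have sub: "closed_segment ?a y \<subseteq> S" "closed_segment ?a y \<subseteq> ball q \<delta>"
      using S(4)[OF y(1)] segM[OF w'(1), of t] w' by auto
    show ?thesis
    proof (rule lift_unique[of "closed_segment ?a y" s g ?a])
      show "continuous_on (closed_segment ?a y) s" "continuous_on (closed_segment ?a y) g"
        using sub by (auto intro: continuous_on_subset[OF S(5)] continuous_on_subset[OF g(5)])
      show "f (s b) = f (g b)" if "b \<in> closed_segment ?a y" for b using that sub S(6) g(6) by (metis subsetD)
    qed (use sg base[OF w'(1)] in auto)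
  qed
  have MB: "M \<subseteq> ball q \<delta>"
  proof
    fix y assume "y \<in> M"
    then obtain w' t where "w' \<in> ball q \<delta>'" "\<tau> < t" "t \<le> 1" "y = p + t *\<^sub>R (w' - p)" using MD by blast
    then show "y \<in> ball q \<delta>" using segM[of w' t] by auto
  qed
  define s' where "s' y = (if y \<in> S then s y else g y)" for y
  have s'M: "s' y = g y" if "y \<in> M" for y using agree that by (simp add: s'_def)
  have oM: "open M" by (auto simp: M_def)
  have "star_section x (S \<union> M) s'"
    unfolding star_section_def p_def[symmetric]
  proof (intro conjI ballI)
    show "open (S \<union> M)" using S oM by auto
    show "S \<union> M \<subseteq> P" using S MB g(4) by auto
    show "p \<in> S \<union> M" using S by auto
    show "s' p = x" using S by (simp add: s'_def)
    show "f (s' y) = h y" if "y \<in> S \<union> M" for y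
      using that S(6) g(6) MB s'M by (auto simp: s'_def)
    have "continuous_on S s'" by (rule continuous_on_eq[OF S(5)]) (simp add: s'_def)
    moreover have "continuous_on M s'" by (rule continuous_on_eq[OF continuous_on_subset[OF g(5) MB]]) (simp add: s'M)
    ultimately show "continuous_on (S \<union> M) s'" using S(1) oM by (intro continuous_on_open_Un)
    show "closed_segment p y \<subseteq> S \<union> M" if ySM: "y \<in> S \<union> M" for y
    proof (cases "y \<in> S")
      case True then show ?thesis using S(4) by blast
    next
      case False
      then obtain w' t where w': "w' \<in> ball q \<delta>'" "\<tau> < t" "t \<le> 1" "y = p + t *\<^sub>R (w' - p)" using ySM MD by blast
      show ?thesis
      proof
        fix a assume "a \<in> closed_segment p y"
        then obtain r where r: "0 \<le> r" "r \<le> 1" "a = (1 - r) *\<^sub>R p + r *\<^sub>R y" unfolding in_segment by blast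
        have a: "a = p + (r * t) *\<^sub>R (w' - p)" unfolding r(3) w'(4) by (simp add: algebra_simps)
        show "a \<in> S \<union> M"
        \<comment> \<open>The outer part of the segment lies in the cone; the inner part lies on the
          segment to the base point, which belongs to the star-shaped set \<open>S\<close>.\<close>
        proof (cases "r * t > \<tau>")
          case True
          have "r * t \<le> 1" using r w' \<tau> by (simp add: mult_le_one)
          then show ?thesis using MI[OF w'(1) True] a by simp
        next
          case False
          have "a \<in> closed_segment p (p + \<tau> *\<^sub>R (w' - p))"
          proof -
            have "(1 - k) *\<^sub>R p + k *\<^sub>R (p + \<tau> *\<^sub>R (w' - p)) = p + (k * \<tau>) *\<^sub>R (w' - p)" for k by (simp add: algebra_simps)
            from this[of "r * t / \<tau>"] show ?thesis
              unfolding in_segment a using False r w' \<tau> by (intro exI[of _ "r * t / \<tau>"]) auto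
          qed
          moreover have "p + \<tau> *\<^sub>R (w' - p) \<in> S" using base[OF w'(1)] \<eta>(2) by blast
          ultimately show ?thesis using S(4) by blast
        qed
      qed
    qed
  qed
  then have "M \<subseteq> S" using max by blast
  moreover have "q \<in> M" using MI[of q 1] \<tau> \<delta>' by simp
  ultimately show False using q by blast
qed

lemma section_exists:
  assumes x: "f x \<in> V"
  obtains s where "continuous_on V s" "\<And>y. y \<in> V \<Longrightarrow> f (s y) = y" "s (f x) = x"
proof -
  obtain S s where s: "star_section x S s" "\<And>S' s'. star_section x S' s' \<Longrightarrow> S' \<subseteq> S" using maximal_star_section[OF x] by metis
  have S: "S = P" by (rule maximal_star_section_total[OF x s])
  show thesis
  proof (rule that[of "s \<circ> \<psi>"])
    show "continuous_on V (s \<circ> \<psi>)"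
      by (rule continuous_on_compose[OF homeoD(5)]) (use s(1) S homeo in \<open>auto simp: star_section_def homeomorphism_def\<close>)
  qed (use s(1) S homeoD in \<open>auto simp: star_section_def\<close>)
qed

text \<open>The map \<open>f\<close> recovers the base point of a section value, so two sections
  whose images meet agree at a point of \<open>V\<close>, and then everywhere because
  \<open>V\<close> is connected. Hence distinct sheets are disjoint.\<close>

lemma evenly_covered:
  "\<exists>v. \<Union>v = f -` V \<and> (\<forall>u\<in>v. open u) \<and> pairwise disjnt v \<and> (\<forall>u\<in>v. \<exists>q. homeomorphism u V f q)"
proof -
  define sec where "sec s \<longleftrightarrow> continuous_on V s \<and> (\<forall>y\<in>V. f (s y) = y)" for s
  define v where "v = {s ` V |s. sec s}"
  have V_conn: "connected V"
    using homeo convex_connected[OF P(2)] by (metis homeomorphism_def connected_continuous_image)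
  have "\<Union>v = f -` V"
  proof
    show "f -` V \<subseteq> \<Union>v"
    proof
      fix x assume x: "x \<in> f -` V"
      then have "f x \<in> V" by simp
      then obtain s where s: "continuous_on V s" "\<And>y. y \<in> V \<Longrightarrow> f (s y) = y" "s (f x) = x"
        by (rule section_exists) blast
      then have "s ` V \<in> v" by (auto simp: v_def sec_def)
      moreover have "x \<in> s ` V" using s(3) x by force
      ultimately show "x \<in> \<Union>v" by blast
    qed
  qed (auto simp: v_def sec_def)
  moreover have "open (s ` V)" if s: "sec s" for s
  proof (subst open_subopen, intro ballI)
    fix x assume "x \<in> s ` V"
    then obtain y where y: "y \<in> V" "x = s y" by blast
    obtain N where N: "open N" "x \<in> N" "inj_on f N" using local_inj[of x] by blast
    have "openin (top_of_set V) (V \<inter> s -` N)" using s N(1) by (intro continuous_openin_preimage_gen) (auto simp: sec_def)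
    then have oW: "open (V \<inter> s -` N)" using V openin_open_trans by blast
    \<comment> \<open>For a point \<open>a\<close> of this set, both \<open>a\<close> and
      \<open>s (f a)\<close> lie in \<open>N\<close> over the same point, so injectivity on
      \<open>N\<close> puts \<open>a\<close> on the sheet.\<close>
    have "open (N \<inter> f -` (V \<inter> s -` N))" by (intro open_Int[OF N(1)] open_vimage[OF oW cont])
    moreover have "x \<in> N \<inter> f -` (V \<inter> s -` N)" using y N s by (auto simp: sec_def)
    moreover have "N \<inter> f -` (V \<inter> s -` N) \<subseteq> s ` V"
    proof
      fix a assume a: "a \<in> N \<inter> f -` (V \<inter> s -` N)"
      then have "f (s (f a)) = f a" using s by (auto simp: sec_def)
      then have "a = s (f a)" using inj_onD[OF N(3), of a "s (f a)"] a by auto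
      then show "a \<in> s ` V" using a by blast
    qed
    ultimately show "\<exists>T. open T \<and> x \<in> T \<and> T \<subseteq> s ` V" by blast
  qed
  moreover have "s ` V = s' ` V" if s: "sec s" "sec s'" and meet: "s ` V \<inter> s' ` V \<noteq> {}" for s s'
  proof -
    obtain y y' where y: "y \<in> V" "y' \<in> V" "s y = s' y'" using meet by blast
    then have "y = y'" using s by (metis sec_def)
    have "s z = s' z" if "z \<in> V" for z
      by (rule lift_unique[OF V_conn, of s s' y]) (use s y \<open>y = y'\<close> that in \<open>auto simp: sec_def\<close>)
    then show ?thesis by auto
  qed
  moreover have "homeomorphism (s ` V) V f s" if "sec s" for s
    unfolding homeomorphism_def using that continuous_on_subset[OF cont]
    by (auto simp: sec_def image_image)
  moreover have v_elem: "\<exists>s. u = s ` V \<and> sec s" if "u \<in> v" for u using that by (auto simp: v_def)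
  ultimately have "\<forall>u\<in>v. open u" "pairwise disjnt v" "\<forall>u\<in>v. \<exists>q. homeomorphism u V f q"
    unfolding pairwise_def disjnt_def by metis+
  then show ?thesis using \<open>\<Union>v = f -` V\<close> by blast
qed

end

lemma (in local_homeo) covering_spaceI:
  assumes conn: "connected (UNIV :: 'y set)"
    and ex: "\<And>y. \<exists>V P \<psi> h. y \<in> V \<and> star_lift f V (P :: 'b::real_normed_vector set) \<psi> h"
  shows "covering_space UNIV f UNIV"
  unfolding covering_space_def
proof (intro conjI ballI)
  show "continuous_on UNIV f" by (rule cont)
  \<comment> \<open>A neighbourhood \<open>V\<close> that meets the range admits a section and is
    therefore contained in the range. As \<open>f\<close> is also open, connectedness gives
    surjectivity.\<close>
  have "closed (range f)"
    unfolding closed_def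
  proof (subst open_subopen, intro ballI)
    fix y assume y: "y \<in> - range f"
    obtain V and P :: "'b set" and \<psi> h where yV: "y \<in> V" and st: "star_lift f V P \<psi> h" using ex by blast
    interpret star_lift f V P \<psi> h by (rule st)
    have "f x \<notin> V" for x
    proof
      assume "f x \<in> V"
      then obtain s where "\<And>y. y \<in> V \<Longrightarrow> f (s y) = y" using section_exists by metis
      then have "f (s y) = y" using yV by blast
      then show False using y by (metis ComplD rangeI)
    qed
    then show "\<exists>T. open T \<and> y \<in> T \<and> T \<subseteq> - range f" using yV by (intro exI[of _ V]) (use V in auto)
  qed
  moreover have "open (range f)" by (rule open_map) simp
  ultimately show "range f = UNIV" using connected_clopen[THEN iffD1, OF conn] by auto
  fix y :: 'y
  obtain V and P :: "'b set" and \<psi> h where yV: "y \<in> V" and st: "star_lift f V P \<psi> h" using ex by blast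
  interpret star_lift f V P \<psi> h by (rule st)
  show "\<exists>T. y \<in> T \<and> openin (top_of_set UNIV) T \<and>
      (\<exists>v. \<Union> v = UNIV \<inter> f -` T \<and> (\<forall>u\<in>v. openin (top_of_set UNIV) u) \<and> pairwise disjnt v \<and> (\<forall>u\<in>v. \<exists>q. homeomorphism u T f q))"
    using yV V evenly_covered by (intro exI[of _ V]) (simp add: open_openin[symmetric])
qed


section \<open>Local inversion at regular points\<close>

lemma tangent_op_chart_change:
  assumes X: "C1_manifold X" and Y: "C1_manifold Y"
    and c: "c \<in> charts_at X x" "c' \<in> charts_at X x" and d: "d \<in> charts_at Y y" "d' \<in> charts_at Y y"
    and eq: "tangent_op X Y c d x y T = tangent_op X Y c' d' x y T'"
  shows "blinfun_apply T v = d_transition d' d y (blinfun_apply T' (d_transition c c' x v))"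
proof -
  let ?\<xi> = "d_chart_inv X c x v"
  have \<xi>: "?\<xi> \<in> tangent_space X x" by (rule d_chart_inv_tangent[OF X c(1)])
  have "?\<xi> c = v" by (rule d_chart_inv_coord[OF c(1)])
  moreover have "?\<xi> c' = d_transition c c' x v" using c by (simp add: d_chart_inv_def)
  ultimately have "d_chart_inv Y d y (blinfun_apply T v) = d_chart_inv Y d' y (blinfun_apply T' (d_transition c c' x v))"
    using fun_cong[OF eq, of ?\<xi>] \<xi> by (simp add: tangent_op_def)
  from fun_cong[OF this, of d] show ?thesis
    using d by (simp add: d_chart_inv_coord) (simp add: d_chart_inv_def)
qed

lemma linear_tangent_op:
  assumes Y: "C1_manifold Y" and d: "d \<in> charts_at Y y"
  shows "linear (tangent_op X Y c d x y)"
  by (rule linearI)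
     (auto simp: tangent_op_def fun_eq_iff blinfun.add_left blinfun.scaleR_left d_chart_inv_linear[OF Y d] scaleR_fun_def)

lemma tangent_op_inj:
  assumes X: "C1_manifold X" and c: "c \<in> charts_at X x"
    and iso: "linear_isomorphism (tangent_space X x) (tangent_space Y y) (tangent_op X Y c d x y T)"
  shows "inj (blinfun_apply T)"
proof (rule injI)
  fix v w assume "blinfun_apply T v = blinfun_apply T w"
  then have "tangent_op X Y c d x y T (d_chart_inv X c x v) = tangent_op X Y c d x y T (d_chart_inv X c x w)"
    using d_chart_inv_tangent[OF X c] by (simp add: tangent_op_def d_chart_inv_coord[OF c])
  moreover have "inj_on (tangent_op X Y c d x y T) (tangent_space X x)"
    using iso by (simp add: linear_isomorphism_def bij_betw_def)
  ultimately have "d_chart_inv X c x v = d_chart_inv X c x w"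
    using d_chart_inv_tangent[OF X c] by (auto dest: inj_onD)
  then show "v = w" by (metis d_chart_inv_coord[OF c])
qed

text \<open>Translates the index into the lower bound that the variational lemmas require. A
  functional dominated by the chart norm and norming at \<open>w0\<close> becomes a tangent
  functional of dual norm exactly 1, so it is among those over which the index takes its
  infimum.\<close>

lemma C_finsler_functional:
  fixes X :: "('x::t2_space, 'e::banach) finsler" and Y :: "('y::t2_space, 'f::banach) finsler"
  assumes X: "finsler_space X" and Y: "finsler_space Y"
    and c: "c \<in> charts_at X x" and d: "d \<in> charts_at Y y"
    and \<beta>: "ennreal \<beta> < C_finsler X Y x y (tangent_op X Y c d x y T)" "0 \<le> \<beta>"
    and l: "bounded_linear l" "\<And>w. \<bar>l w\<bar> \<le> chart_norm Y d y w" "w0 \<noteq> 0" "l w0 = chart_norm Y d y w0"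
  shows "\<exists>u. chart_norm X c x u \<le> 1 \<and> l (blinfun_apply T u) < - \<beta>"
proof -
  interpret X: finsler_space X by (rule X)
  interpret Y: finsler_space Y by (rule Y)
  note lin = bounded_linear.linear[OF l(1)]
  define L where "L = (\<lambda>\<eta> :: ('y, 'f) tvec. l (\<eta> d))"
  have "linear_between (tangent_space Y y) UNIV L"
    by (auto simp: linear_between_def L_def linear_add[OF lin] linear_scale[OF lin] scaleR_fun_def)
  moreover have "dual_norm (tangent_space Y y) (fnorm Y y) L = 1"
  proof (rule antisym)
    show "dual_norm (tangent_space Y y) (fnorm Y y) L \<le> 1"
      unfolding dual_norm_def
    proof (rule SUP_least)
      fix \<eta> assume \<eta>: "\<eta> \<in> {u \<in> tangent_space Y y. fnorm Y y u \<le> 1}"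
      have "d_chart_inv Y d y (\<eta> d) = \<eta>" using \<eta> by (intro d_chart_inv_of_coord[OF d]) auto
      then have "chart_norm Y d y (\<eta> d) \<le> 1" using \<eta> by (simp add: chart_norm_def)
      then have "\<bar>l (\<eta> d)\<bar> \<le> 1" using l(2)[of "\<eta> d"] by linarith
      then show "ennreal \<bar>L \<eta>\<bar> \<le> 1" by (simp add: L_def)
    qed
    note D = equivalent_normD[OF Y.equivalent_chart_norm[OF d]]
    have n0: "chart_norm Y d y w0 > 0" using D(1)[of w0] D(2)[of w0] l(3) by linarith
    define w where "w = (1 / chart_norm Y d y w0) *\<^sub>R w0"
    have w: "chart_norm Y d y w = 1" "l w = 1" using n0 D(3) by (simp_all add: w_def linear_scale[OF lin] l(4))
    have "ennreal \<bar>L (d_chart_inv Y d y w)\<bar> \<le> dual_norm (tangent_space Y y) (fnorm Y y) L"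
      unfolding dual_norm_def
      by (rule SUP_upper) (use w d_chart_inv_tangent[OF Y.manifold d] in \<open>auto simp: chart_norm_def\<close>)
    then show "1 \<le> dual_norm (tangent_space Y y) (fnorm Y y) L" using w by (simp add: L_def d_chart_inv_coord[OF d])
  qed
  ultimately have "C_finsler X Y x y (tangent_op X Y c d x y T) \<le> dual_norm (tangent_space X x) (fnorm X x) (L \<circ> tangent_op X Y c d x y T)"
    unfolding C_finsler_def by (intro INF_lower) auto
  then have "ennreal \<beta> < dual_norm (tangent_space X x) (fnorm X x) (L \<circ> tangent_op X Y c d x y T)"
    using \<beta> by (meson order.strict_trans2)
  then obtain \<xi> where \<xi>: "\<xi> \<in> tangent_space X x" "fnorm X x \<xi> \<le> 1" "ennreal \<beta> < ennreal \<bar>L (tangent_op X Y c d x y T \<xi>)\<bar>"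
    unfolding dual_norm_def less_SUP_iff by auto
  note D = equivalent_normD[OF X.equivalent_chart_norm[OF c]]
  have "d_chart_inv X c x (\<xi> c) = \<xi>" by (rule d_chart_inv_of_coord[OF c \<xi>(1)])
  then have n: "chart_norm X c x (\<xi> c) \<le> 1" using \<xi>(2) by (simp add: chart_norm_def)
  have "\<beta> < \<bar>l (blinfun_apply T (\<xi> c))\<bar>"
    using \<xi>(1,3) \<beta>(2) by (simp add: L_def tangent_op_def d_chart_inv_coord[OF d] ennreal_less_iff)
  \<comment> \<open>The dual norm controls an absolute value; one of the two opposite unit-ball
    vectors has the desired sign.\<close>
  then have "l (blinfun_apply T (\<xi> c)) < - \<beta> \<or> l (blinfun_apply T (- \<xi> c)) < - \<beta>"
    by (simp add: blinfun.minus_right linear_neg[OF lin]) linarith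
  then show ?thesis using n D(6) by metis
qed

text \<open>For fixed \<open>l\<close>, evaluation is continuous from the weak operator topology to
  pointwise convergence, which is the topology used by \<open>minimax\<close>. The inner map
  \<open>B\<close> leaves room for the transition derivative of a change of charts.\<close>

lemma compact_functional_image:
  fixes B :: "'e::banach \<Rightarrow> 'a::banach" and l :: "'f::banach \<Rightarrow>\<^sub>L real" and J :: "('a \<Rightarrow>\<^sub>L 'f) set"
  assumes J: "convex J" "compactin weak_operator_topology J"
  shows "compact ((\<lambda>T v. l (blinfun_apply T (B v))) ` J)" "convex ((\<lambda>T v. l (blinfun_apply T (B v))) ` J)"
proof -
  define G where "G = (\<lambda>k :: 'a \<times> ('f \<Rightarrow>\<^sub>L real) \<Rightarrow> real. (\<lambda>v. k (B v, l)))"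
  have "continuous_on UNIV G" unfolding G_def
    by (intro continuous_on_coordinatewise_then_product continuous_on_product_coordinates)
  then have "continuous_map euclidean euclidean G" by simp
  then have "continuous_map weak_operator_topology euclidean (G \<circ> (\<lambda>T (v, l). blinfun_apply l (blinfun_apply T v)))"
    unfolding weak_operator_topology_def by (rule continuous_map_pullback)
  moreover have "G \<circ> (\<lambda>T (v, l). blinfun_apply l (blinfun_apply T v)) = (\<lambda>T v. l (blinfun_apply T (B v)))"
    by (auto simp: G_def fun_eq_iff)
  ultimately show "compact ((\<lambda>T v. l (blinfun_apply T (B v))) ` J)"
    using image_compactin[OF J(2)] by (metis compactin_euclidean_iff)
  show "convex ((\<lambda>T v. l (blinfun_apply T (B v))) ` J)"
    by (rule convex_linear_image[OF linearI J(1)])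
       (auto simp: fun_eq_iff blinfun.add_left blinfun.add_right blinfun.scaleR_left blinfun.scaleR_right scaleR_fun_def)
qed

section \<open>Regularity and inversion in frozen norms\<close>

locale finsler_pseudo_jacobian = X: finsler_space X + Y: finsler_space Y
  for X :: "('x::t2_space, 'e::banach) finsler" and Y :: "('y::t2_space, 'f::banach) finsler" +
  fixes f :: "'x \<Rightarrow> 'y" and Jf :: "'x \<Rightarrow> (('x, 'e) tvec \<Rightarrow> ('y, 'f) tvec) set"
  assumes smooth: "smooth_norm Y" and lipschitz: "locally_lipschitz X Y f"
    and strong: "strong_pseudo_jacobian X Y f Jf"
begin

lemma some_rep:
  assumes "some_rep X Y f Jf x = (c, d, J)"
  shows "local_rep X Y f Jf x c d J"
proof -
  obtain c' d' J' where "local_rep X Y f Jf x c' d' J'" using strong unfolding strong_pseudo_jacobian_def by blast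
  then have "case (c', d', J') of (c, d, J) \<Rightarrow> local_rep X Y f Jf x c d J" by simp
  then have "case some_rep X Y f Jf x of (c, d, J) \<Rightarrow> local_rep X Y f Jf x c d J"
    unfolding some_rep_def by (rule someI)
  then show ?thesis using assms by simp
qed

lemma local_repD:
  assumes "local_rep X Y f Jf x c d J"
  shows "c \<in> charts_at X x" "d \<in> charts_at Y (f x)" "\<And>u. u \<in> chart_dom c \<Longrightarrow> f u \<in> chart_dom d"
    "continuous_on (chart_ran c) (chart_map d \<circ> f \<circ> chart_inv c)"
    "\<And>z. z \<in> chart_ran c \<Longrightarrow> pseudo_jacobian_at (chart_map d \<circ> f \<circ> chart_inv c) z (J z)"
    "locally_bounded_mapping (chart_ran c) J"
    "\<And>u. u \<in> chart_dom c \<Longrightarrow> Jf u = tangent_op X Y c d u (f u) ` J (chart_map c u)"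
  using assms by (auto simp: local_rep_def pseudo_jacobian_mapping_def)

text \<open>Weak operator compactness and convexity pass from the charts witnessing strongness to any other charts,
  because the two families of operators differ by fixed transition derivatives.\<close>

lemma functional_image_compact_convex:
  fixes l :: "'f \<Rightarrow>\<^sub>L real"
  assumes rep: "local_rep X Y f Jf x c d J" and u: "u \<in> chart_dom c"
  shows "compact ((\<lambda>T v. blinfun_apply l (blinfun_apply T v)) ` J (chart_map c u))"
    "convex ((\<lambda>T v. blinfun_apply l (blinfun_apply T v)) ` J (chart_map c u))"
proof -
  note R = local_repD[OF rep]
  obtain c' d' J' where rep': "local_rep X Y f Jf u c' d' J'"
    and cc: "\<forall>z\<in>chart_ran c'. convex (J' z) \<and> compactin weak_operator_topology (J' z)"
    using strong unfolding strong_pseudo_jacobian_def by blast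
  note R' = local_repD[OF rep']
  have c: "c \<in> charts_at X u" "c' \<in> charts_at X u" using R(1) R'(1) u by (auto simp: charts_at_iff)
  have d: "d \<in> charts_at Y (f u)" "d' \<in> charts_at Y (f u)" using R(2) R'(2) R(3)[OF u] by (auto simp: charts_at_iff)
  have u': "u \<in> chart_dom c'" using c by (simp add: charts_at_iff)
  have cc': "convex (J' (chart_map c' u))" "compactin weak_operator_topology (J' (chart_map c' u))"
    using cc u' by (auto simp: chart_ran_def)
  \<comment> \<open>The change of charts in Y is absorbed into the functional, that in X into the
    inner map \<open>?B\<close>.\<close>
  define l' where "l' = Blinfun (\<lambda>w. blinfun_apply l (d_transition d' d (f u) w))"
  have bl: "bounded_linear (d_transition d' d (f u))"
    using d_transition_has_derivative[OF Y.manifold d(2,1)] by (rule has_derivative_bounded_linear)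
  have l': "blinfun_apply l' w = blinfun_apply l (d_transition d' d (f u) w)" for w
    unfolding l'_def by (subst bounded_linear_Blinfun_apply)
      (auto intro: bounded_linear_compose[OF blinfun.bounded_linear_right bl])
  let ?B = "d_transition c c' u"
  have eq: "tangent_op X Y c d u (f u) ` J (chart_map c u) = tangent_op X Y c' d' u (f u) ` J' (chart_map c' u)"
    using R(7)[OF u] R'(7)[OF u'] by simp
  have h: "(\<lambda>v. blinfun_apply l (blinfun_apply T v)) = (\<lambda>v. blinfun_apply l' (blinfun_apply T' (?B v)))"
    if "tangent_op X Y c d u (f u) T = tangent_op X Y c' d' u (f u) T'" for T T'
    using tangent_op_chart_change[OF X.manifold Y.manifold c d that] by (simp add: l')
  have "(\<lambda>T v. blinfun_apply l (blinfun_apply T v)) ` J (chart_map c u) = (\<lambda>T v. blinfun_apply l' (blinfun_apply T (?B v))) ` J' (chart_map c' u)"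
  proof (intro equalityI image_subsetI)
    fix T assume "T \<in> J (chart_map c u)"
    then have "tangent_op X Y c d u (f u) T \<in> tangent_op X Y c' d' u (f u) ` J' (chart_map c' u)" using eq by blast
    then obtain T' where "T' \<in> J' (chart_map c' u)" "tangent_op X Y c d u (f u) T = tangent_op X Y c' d' u (f u) T'" by blast
    then show "(\<lambda>v. blinfun_apply l (blinfun_apply T v)) \<in> (\<lambda>T v. blinfun_apply l' (blinfun_apply T (?B v))) ` J' (chart_map c' u)"
      using h by blast
  next
    fix T' assume "T' \<in> J' (chart_map c' u)"
    then have "tangent_op X Y c' d' u (f u) T' \<in> tangent_op X Y c d u (f u) ` J (chart_map c u)" using eq by blast
    then obtain T where T: "T \<in> J (chart_map c u)" "tangent_op X Y c d u (f u) T = tangent_op X Y c' d' u (f u) T'" by force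
    then show "(\<lambda>v. blinfun_apply l' (blinfun_apply T' (?B v))) \<in> (\<lambda>T v. blinfun_apply l (blinfun_apply T v)) ` J (chart_map c u)"
      using h by (intro image_eqI[of _ _ T]) simp_all
  qed
  then show "compact ((\<lambda>T v. blinfun_apply l (blinfun_apply T v)) ` J (chart_map c u))"
    "convex ((\<lambda>T v. blinfun_apply l (blinfun_apply T v)) ` J (chart_map c u))"
    using compact_functional_image[OF cc', of l' ?B] by simp_all
qed

lemma smooth_chart_norm:
  assumes "d \<in> charts_at Y y" "w \<noteq> 0" shows "chart_norm Y d y differentiable (at w)"
  using smooth assms unfolding smooth_norm_def chart_norm_def[abs_def] by blast

lemma continuous: "continuous_on UNIV f"
  unfolding continuous_on_def
proof
  fix x
  obtain r L where r: "r > 0" "\<And>u v. u \<in> fball X x r \<Longrightarrow> v \<in> fball X x r \<Longrightarrow> fdist Y (f u) (f v) \<le> L * fdist X u v"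
    using lipschitz unfolding locally_lipschitz_def by blast
  have "((\<lambda>u. fdist X x u) \<longlongrightarrow> 0) (at x)" using tendsto_ident_at[of x UNIV] by (simp add: X.tendsto_fdist)
  then have lim: "((\<lambda>u. L * fdist X x u) \<longlongrightarrow> 0) (at x)" by (rule tendsto_mult_right_zero)
  have xr: "x \<in> fball X x r" using r by (simp add: fball_def)
  have "\<forall>\<^sub>F u in at x. u \<in> fball X x r"
    by (rule topological_tendstoD[OF tendsto_ident_at X.fball_open xr])
  then have "\<forall>\<^sub>F u in at x. fdist Y (f x) (f u) \<le> L * fdist X x u"
    by eventually_elim (use r(2) xr in blast)
  then have "((\<lambda>u. fdist Y (f x) (f u)) \<longlongrightarrow> 0) (at x)"
    using tendsto_sandwich[OF _ _ tendsto_const[of 0] lim, of "\<lambda>u. fdist Y (f x) (f u)"] Y.fdist_nonneg by simp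
  then show "(f \<longlongrightarrow> f x) (at x)" by (simp add: Y.tendsto_fdist)
qed

text \<open>Regularity and the index each come with a radius, both relative to the charts selected
  by \<open>some_rep\<close>; the smaller radius serves both, because shrinking the ball shrinks the
  hull.\<close>

lemma regular_radius:
  assumes reg: "Jf_regular_at X Y f Jf x" and \<beta>: "0 < \<beta>" "ennreal \<beta> < reg_index X Y f Jf x"
  obtains c d J R where "local_rep X Y f Jf x c d J" "R > 0" "fball X x R \<subseteq> chart_dom c"
    "\<And>T. T \<in> convex hull (\<Union>u\<in>fball X x R. J (chart_map c u)) \<Longrightarrow> inj (blinfun_apply T)"
    "\<And>T l. T \<in> convex hull (\<Union>u\<in>fball X x R. J (chart_map c u)) \<Longrightarrow> bounded_linear l \<Longrightarrow>
      (\<And>w. \<bar>l w\<bar> \<le> chart_norm Y d (f x) w) \<Longrightarrow> (\<exists>w. w \<noteq> 0 \<and> l w = chart_norm Y d (f x) w) \<Longrightarrow>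
      \<exists>u. chart_norm X c x u \<le> 1 \<and> l (blinfun_apply T u) < - \<beta>"
proof -
  obtain c d J where sr: "some_rep X Y f Jf x = (c, d, J)" by (metis prod_cases3)
  note rep = some_rep[OF sr]
  note R = local_repD[OF rep]
  let ?t = "tangent_op X Y c d x (f x)"
  let ?U = "\<lambda>R. \<Union>u\<in>fball X x R. J (chart_map c u)"
  have ball: "Jf_ball X Y f Jf x R = ?t ` ?U R" for R by (auto simp: Jf_ball_def sr)
  \<comment> \<open>The passage from coordinate operators to tangent operators is linear, so it
    commutes with taking convex hulls.\<close>
  have hull: "?t T \<in> convex hull (Jf_ball X Y f Jf x R)" if "T \<in> convex hull (?U R')" "R' \<le> R" for T R R'
  proof -
    have "fball X x R' \<subseteq> fball X x R" using that(2) by (auto simp: fball_def)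
    then have "?U R' \<subseteq> ?U R" by blast
    then have "T \<in> convex hull (?U R)" using hull_mono that(1) by blast
    then show ?thesis unfolding ball convex_hull_linear_image[OF linear_tangent_op[OF Y.manifold R(2)], symmetric] by blast
  qed
  obtain R1 where R1: "small_radius X Y f Jf x R1" "\<And>T. T \<in> convex hull (Jf_ball X Y f Jf x R1) \<Longrightarrow>
    linear_isomorphism (tangent_space X x) (tangent_space Y (f x)) T"
    using reg unfolding Jf_regular_at_def by blast
  obtain R2 where R2: "small_radius X Y f Jf x R2" "ennreal \<beta> < (INF T\<in>convex hull (Jf_ball X Y f Jf x R2). C_finsler X Y x (f x) T)"
    using \<beta>(2) unfolding reg_index_def less_SUP_iff by blast
  have C: "ennreal \<beta> < C_finsler X Y x (f x) T" if "T \<in> convex hull (Jf_ball X Y f Jf x R2)" for T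
    using R2(2) INF_lower[OF that, of "C_finsler X Y x (f x)"] by (rule order.strict_trans2)
  have Rs: "R1 > 0" "R2 > 0" "fball X x R1 \<subseteq> chart_dom c" using R1(1) R2(1) by (auto simp: small_radius_def sr)
  define R0 where "R0 = min R1 R2"
  show thesis
  proof (rule that[OF rep, of R0])
    show "R0 > 0" using Rs by (simp add: R0_def)
    have "fball X x R0 \<subseteq> fball X x R1" by (auto simp: fball_def R0_def)
    then show "fball X x R0 \<subseteq> chart_dom c" using Rs by blast
    fix T assume T: "T \<in> convex hull (?U R0)"
    show "inj (blinfun_apply T)"
      by (rule tangent_op_inj[OF X.manifold R(1) R1(2)[OF hull[OF T]]]) (simp add: R0_def)
    fix l assume l: "bounded_linear l" "\<And>w. \<bar>l w\<bar> \<le> chart_norm Y d (f x) w" "\<exists>w. w \<noteq> 0 \<and> l w = chart_norm Y d (f x) w"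
    obtain w0 where w0: "w0 \<noteq> 0" "l w0 = chart_norm Y d (f x) w0" using l(3) by blast
    have "ennreal \<beta> < C_finsler X Y x (f x) (?t T)" by (rule C[OF hull[OF T]]) (simp add: R0_def)
    from C_finsler_functional[OF X.finsler_space_axioms Y.finsler_space_axioms R(1,2) this less_imp_le[OF \<beta>(1)] l(1,2) w0]
    show "\<exists>u. chart_norm X c x u \<le> 1 \<and> l (blinfun_apply T u) < - \<beta>" .
  qed
qed

text \<open>Expansion on a convex coordinate ball comes from \<open>isomorphism_lower_bound\<close>
  and \<open>pj_expansive\<close>, openness from \<open>pj_descent\<close> and
  \<open>open_core\<close>, all in the norms frozen at \<open>x\<close> and with a constant slightly
  larger than \<beta>.\<close>

lemma local_inversion:
  assumes reg: "Jf_regular_at X Y f Jf x" and \<beta>: "0 < \<beta>" "ennreal \<beta> < reg_index X Y f Jf x"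
  obtains N where "open N" "x \<in> N" "inj_on f N" "\<And>S. open S \<Longrightarrow> S \<subseteq> N \<Longrightarrow> open (f ` S)"
    "\<And>u v. u \<in> N \<Longrightarrow> v \<in> N \<Longrightarrow> \<beta> * fdist X u v \<le> fdist Y (f u) (f v)"
proof -
  obtain b where b: "ennreal \<beta> < b" "b < reg_index X Y f Jf x" using dense[OF \<beta>(2)] by blast
  then obtain \<beta>' where \<beta>'0: "b = ennreal \<beta>'" "\<beta>' \<ge> 0" by (metis ennreal_cases leD top_greatest)
  then have \<beta>': "\<beta> < \<beta>'" "\<beta>' > 0" "ennreal \<beta>' < reg_index X Y f Jf x" using b \<beta> by (auto simp: ennreal_less_iff)
  \<comment> \<open>Returning from frozen norms to distances costs a factor
    \<open>1 + \<epsilon>\<close> in X and another in Y; their product is exactly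
    \<open>\<beta>' / \<beta>\<close>.\<close>
  define \<epsilon> where "\<epsilon> = sqrt (\<beta>' / \<beta>) - 1"
  have \<epsilon>: "\<epsilon> > 0" "\<beta> * ((1 + \<epsilon>) * (1 + \<epsilon>)) = \<beta>'" using \<beta>' \<beta> by (auto simp: \<epsilon>_def)
  obtain c d J R where rep: "local_rep X Y f Jf x c d J" and R: "R > 0" "fball X x R \<subseteq> chart_dom c"
    and inj: "\<And>T. T \<in> convex hull (\<Union>u\<in>fball X x R. J (chart_map c u)) \<Longrightarrow> inj (blinfun_apply T)"
    and low: "\<And>T l. T \<in> convex hull (\<Union>u\<in>fball X x R. J (chart_map c u)) \<Longrightarrow> bounded_linear l \<Longrightarrow>
      (\<And>w. \<bar>l w\<bar> \<le> chart_norm Y d (f x) w) \<Longrightarrow> (\<exists>w. w \<noteq> 0 \<and> l w = chart_norm Y d (f x) w) \<Longrightarrow>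
      \<exists>u. chart_norm X c x u \<le> 1 \<and> l (blinfun_apply T u) < - \<beta>'"
    using regular_radius[OF reg \<beta>'(2,3)] by blast
  note L = local_repD[OF rep]
  let ?n = "chart_norm X c x" and ?m = "chart_norm Y d (f x)"
  let ?F = "chart_map d \<circ> f \<circ> chart_inv c"
  have n: "equivalent_norm ?n" by (rule X.equivalent_chart_norm[OF L(1)])
  have m: "equivalent_norm ?m" by (rule Y.equivalent_chart_norm[OF L(2)])
  note Dn = equivalent_normD[OF n] and Dm = equivalent_normD[OF m]
  have sm: "?m differentiable (at w)" if "w \<noteq> 0" for w by (rule smooth_chart_norm[OF L(2) that])
  have cX: "c \<in> charts X" and x: "x \<in> chart_dom c" using L(1) by (auto simp: charts_at_iff)
  note hc = is_chartD[OF charts_is_chart[OF cX]]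
  have dY: "d \<in> charts Y" using L(2) by (auto simp: charts_at_iff)
  note hd = is_chartD[OF charts_is_chart[OF dY]]
  have xran: "chart_map c x \<in> chart_ran c" using hc x by simp
  obtain rY where rY: "fball Y (f x) rY \<subseteq> UNIV \<inter> chart_dom d"
    "\<And>u v. u \<in> fball Y (f x) rY \<Longrightarrow> v \<in> fball Y (f x) rY \<Longrightarrow> ?m (chart_map d u - chart_map d v) \<le> (1 + \<epsilon>) * fdist Y u v"
    "rY > 0"
    by (rule Y.fdist_chart_comparison[OF L(2) open_UNIV UNIV_I \<epsilon>(1)]) blast
  obtain r0 K where r0: "r0 > 0" "\<And>u v. u \<in> fball X x r0 \<Longrightarrow> v \<in> fball X x r0 \<Longrightarrow> fdist Y (f u) (f v) \<le> K * fdist X u v"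
    using lipschitz unfolding locally_lipschitz_def by blast
  obtain rJ where rJ: "rJ > 0" "bounded (\<Union>z\<in>ball (chart_map c x) rJ. J z)"
    using L(6) xran unfolding locally_bounded_mapping_def by blast
  \<comment> \<open>The four constraints provide, in this order, control of the operator hull, the
    Lipschitz estimate, the norm comparison in Y and local boundedness of \<open>J\<close>.\<close>
  let ?Q = "(fball X x R \<inter> fball X x r0) \<inter> (f -` fball Y (f x) rY \<inter> (chart_dom c \<inter> chart_map c -` ball (chart_map c x) rJ))"
  have "open (chart_dom c \<inter> chart_map c -` ball (chart_map c x) rJ)"
    by (rule continuous_open_preimage[OF hc(7) hc(1) open_ball])
  then have Q: "open ?Q"
    by (intro open_Int[OF open_Int[OF X.fball_open X.fball_open] open_Int[OF open_vimage[OF Y.fball_open continuous]]])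
  have xO: "x \<in> ?Q" using R r0 rY rJ x by (simp add: fball_def)
  obtain r where r: "fball X x r \<subseteq> ?Q \<inter> chart_dom c"
    "\<And>u v. u \<in> fball X x r \<Longrightarrow> v \<in> fball X x r \<Longrightarrow> fdist X u v \<le> (1 + \<epsilon>) * ?n (chart_map c u - chart_map c v)"
    "\<exists>T. open T \<and> x \<in> T \<and> T \<subseteq> fball X x r"
    by (rule X.fdist_chart_comparison[OF L(1) Q xO \<epsilon>(1)]) blast
  obtain T0 where T0: "open T0" "x \<in> T0" "T0 \<subseteq> fball X x r" using r(3) by blast
  obtain \<rho> where \<rho>: "\<rho> > 0" "\<And>z. ?n (z - chart_map c x) < \<rho> \<Longrightarrow> z \<in> chart_ran c \<and> chart_inv c z \<in> T0"
    by (rule X.chart_ball_exists[OF L(1) T0(1,2)]) blast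
  define B where "B = {z. ?n (z - chart_map c x) < \<rho>}"
  have Bran: "z \<in> chart_ran c" and Bball: "chart_inv c z \<in> fball X x r" if "z \<in> B" for z
    using \<rho>(2)[of z] T0(3) that by (auto simp: B_def)
  have BO: "chart_inv c z \<in> ?Q" if "z \<in> B" for z using Bball[OF that] r(1) by blast
  have Bconv: "convex B" unfolding B_def by (rule X.chart_norm_ball_convex[OF L(1)])
  have hullB: "T \<in> convex hull (\<Union>u\<in>fball X x R. J (chart_map c u))" if T: "T \<in> convex hull (\<Union>z\<in>A. J z)" and AB: "A \<subseteq> B" for T A
  proof -
    have "(\<Union>z\<in>A. J z) \<subseteq> (\<Union>u\<in>fball X x R. J (chart_map c u))"
    proof
      fix T' assume "T' \<in> (\<Union>z\<in>A. J z)"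
      then obtain z where z: "z \<in> B" "T' \<in> J z" using AB by blast
      have "chart_map c (chart_inv c z) = z" "chart_inv c z \<in> fball X x R" using hc Bran[OF z(1)] BO[OF z(1)] by auto
      then show "T' \<in> (\<Union>u\<in>fball X x R. J (chart_map c u))" using z(2) by (metis UN_I)
    qed
    then show ?thesis using hull_mono T by blast
  qed
  define N where "N = {u\<in>chart_dom c. ?n (chart_map c u - chart_map c x) < \<rho>}"
  have oN: "open N" unfolding N_def by (rule X.open_chart_ball[OF L(1)])
  have xN: "x \<in> N" using x \<rho>(1) Dn(5) by (simp add: N_def)
  have NB: "chart_map c u \<in> B" "chart_inv c (chart_map c u) = u" "u \<in> chart_dom c" if "u \<in> N" for u
    using that hc by (auto simp: N_def B_def)
  have NO: "u \<in> ?Q" "u \<in> fball X x r" if "u \<in> N" for u using BO[OF NB(1)[OF that]] Bball[OF NB(1)[OF that]] NB(2)[OF that] by simp_all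
  have contF: "continuous_on B ?F" using continuous_on_subset[OF L(4)] Bran by blast
  have pj: "pseudo_jacobian_at ?F z (J z)" if "z \<in> B" for z by (rule L(5)[OF Bran[OF that]])
  have expand: "\<beta>' * ?n (v - u) \<le> ?m (?F v - ?F u)" if uv: "u \<in> B" "v \<in> B" for u v
  proof (rule pj_expansive[OF n m sm])
    have seg: "closed_segment u v \<subseteq> B" by (rule closed_segment_subset[OF uv Bconv])
    show "pseudo_jacobian_at ?F z (J z)" if "z \<in> closed_segment u v" for z using pj seg that by blast
    show "continuous_on (closed_segment u v) ?F" by (rule continuous_on_subset[OF contF seg])
    have "closed_segment u v \<subseteq> ball (chart_map c x) rJ"
    proof
      fix z assume "z \<in> closed_segment u v"
      then have "z \<in> B" using seg by blast
      then show "z \<in> ball (chart_map c x) rJ" using BO[of z] hc(5)[OF Bran[of z]] by simp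
    qed
    then have "(\<Union>z\<in>closed_segment u v. J z) \<subseteq> (\<Union>z\<in>ball (chart_map c x) rJ. J z)" by blast
    then show "bounded (\<Union>z\<in>closed_segment u v. J z)" using rJ(2) bounded_subset by blast
    fix T w assume "T \<in> convex hull (\<Union>z\<in>closed_segment u v. J z)"
    then have T: "T \<in> convex hull (\<Union>u\<in>fball X x R. J (chart_map c u))" using seg by (rule hullB)
    show "\<beta>' * ?n w \<le> ?m (blinfun_apply T w)"
      by (rule isomorphism_lower_bound[OF n m sm \<beta>'(2) inj[OF T] low[OF T]])
  qed
  have expand_fdist: "\<beta> * fdist X u v \<le> fdist Y (f u) (f v)" if uv: "u \<in> N" "v \<in> N" for u v
  proof -
    have "\<beta>' * ?n (chart_map c u - chart_map c v) \<le> ?m (chart_map d (f u) - chart_map d (f v))"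
      using expand[OF NB(1)[OF uv(2)] NB(1)[OF uv(1)]] NB(2) uv by simp
    also have "\<dots> \<le> (1 + \<epsilon>) * fdist Y (f u) (f v)" using rY(2) NO(1)[OF uv(1)] NO(1)[OF uv(2)] by auto
    finally have 1: "\<beta>' * ?n (chart_map c u - chart_map c v) \<le> (1 + \<epsilon>) * fdist Y (f u) (f v)" .
    have "\<beta>' * fdist X u v \<le> \<beta>' * ((1 + \<epsilon>) * ?n (chart_map c u - chart_map c v))"
      using r(2) NO(2) uv \<beta>'(2) by (intro mult_left_mono) auto
    also have "\<dots> = (1 + \<epsilon>) * (\<beta>' * ?n (chart_map c u - chart_map c v))" by simp
    also have "\<dots> \<le> (1 + \<epsilon>) * ((1 + \<epsilon>) * fdist Y (f u) (f v))" using 1 \<epsilon>(1) by (intro mult_left_mono) auto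
    finally have "(1 + \<epsilon>) * (1 + \<epsilon>) * (\<beta> * fdist X u v) \<le> (1 + \<epsilon>) * (1 + \<epsilon>) * fdist Y (f u) (f v)"
      unfolding \<epsilon>(2)[symmetric] by (simp add: mult_ac)
    moreover have "(1 + \<epsilon>) * (1 + \<epsilon>) > 0" using \<epsilon>(1) by simp
    ultimately show ?thesis by (simp only: mult_le_cancel_left_pos)
  qed
  have "inj_on f N"
  proof (rule inj_onI)
    fix u v assume "u \<in> N" "v \<in> N" "f u = f v"
    then have "\<beta> * fdist X u v \<le> 0" using expand_fdist[of u v] by simp
    then show "u = v" using \<beta>(1) X.fdist_nonneg[of u v] X.fdist_eq_0[of u v] by (simp add: mult_le_0_iff)
  qed
  moreover have "open (f ` S)" if S: "open S" "S \<subseteq> N" for S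
  proof (subst open_subopen, intro ballI)
    fix y assume "y \<in> f ` S"
    then obtain u where u: "u \<in> S" "y = f u" by blast
    have uN: "u \<in> N" using u S by blast
    define p where "p = chart_map c u"
    have "open (chart_map c ` (chart_dom c \<inter> S))" by (rule overlap_open[OF charts_is_chart[OF cX] S(1)])
    moreover have "p \<in> chart_map c ` (chart_dom c \<inter> S)" using u NB(3)[OF uN] by (auto simp: p_def)
    ultimately obtain e where e: "e > 0" "ball p e \<subseteq> chart_map c ` (chart_dom c \<inter> S)" unfolding open_contains_ball by blast
    obtain k M where k: "k > 0" "\<And>v. k * norm v \<le> ?n v" using equivalent_norm_bounds[OF n] by metis
    define s where "s = k * e / 2"
    have s: "s > 0" using k e by (simp add: s_def)
    have near: "z \<in> chart_map c ` (chart_dom c \<inter> S)" if "?n (z - p) \<le> s" for z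
    proof -
      have "k * norm (z - p) \<le> k * (e / 2)" using k(2)[of "z - p"] that by (simp add: s_def)
      then have "norm (z - p) < e" using k(1) e(1) by simp
      then have "z \<in> ball p e" by (simp add: dist_norm norm_minus_commute)
      then show ?thesis using e(2) by blast
    qed
    have nearB: "z \<in> B" if "?n (z - p) \<le> s" for z
      using near[OF that] S(2) NB(1) by blast
    let ?T = "{y\<in>chart_dom d. ?m (chart_map d y - chart_map d (f u)) < \<beta>' * s}"
    have Fp: "?F p = chart_map d (f u)" using NB(2)[OF uN] by (simp add: p_def)
    have "open ?T" by (rule Y.open_chart_ball[OF L(2)])
    moreover have "y \<in> ?T" using u(2) L(3)[OF NB(3)[OF uN]] Dm(5) \<beta>'(2) s by simp
    moreover have "?T \<subseteq> f ` S"
    proof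
      fix y' assume y': "y' \<in> ?T"
      \<comment> \<open>Openness with rate \<open>\<beta>'\<close> about the coordinates of
        \<open>u\<close>: every target closer than \<open>\<beta>' * s\<close> is reached within the
        \<open>s\<close>-ball, which lies over \<open>S\<close>.\<close>
      have "\<exists>z. ?n (z - p) \<le> ?m (chart_map d y' - ?F p) / \<beta>' \<and> ?F z = chart_map d y'"
      proof (rule open_core[OF n m sm \<beta>'(2), where r = s])
        show "continuous_on {z. ?n (z - p) \<le> s} ?F" by (rule continuous_on_subset[OF contF]) (use nearB in blast)
        show "?m (chart_map d y' - ?F p) < \<beta>' * s" using y' Fp by simp
      next
        fix z l assume z: "?n (z - p) < s" and l: "bounded_linear l" "\<And>w. \<bar>l w\<bar> \<le> ?m w" "\<exists>w. w \<noteq> 0 \<and> l w = ?m w"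
        have zB: "z \<in> B" using nearB z by simp
        have zi: "chart_inv c z \<in> chart_dom c" "chart_map c (chart_inv c z) = z" using hc Bran[OF zB] by auto
        have bl: "blinfun_apply (Blinfun l) = l" by (rule bounded_linear_Blinfun_apply[OF l(1)])
        note K = functional_image_compact_convex[OF rep zi(1), of "Blinfun l", unfolded zi(2)]
        have "\<exists>w. ?n w \<le> 1 \<and> blinfun_apply (Blinfun l) (blinfun_apply T w) < - \<beta>'" if "T \<in> J z" for T
        proof -
          have "T \<in> convex hull (\<Union>z\<in>{z}. J z)" using that by (intro hull_inc) simp
          then have "T \<in> convex hull (\<Union>u\<in>fball X x R. J (chart_map c u))" by (rule hullB) (use zB in simp)
          from low[OF this l] show ?thesis by (simp add: bl)
        qed
        from pj_descent[OF pj[OF zB] n less_imp_le[OF \<beta>'(2)] K this]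
        show "\<exists>v \<kappa>. \<beta>' * ?n v < \<kappa> \<and> (\<forall>\<^sub>F t in at_right 0. l (?F (z + t *\<^sub>R v)) - l (?F z) \<le> - \<kappa> * t)"
          by (simp add: bl)
      next
        fix z v assume z: "?n (z - p) < s"
        have zB: "z \<in> B" using nearB z by simp
        obtain k' where k': "k' > 0" "\<And>v. k' * norm v \<le> ?m v" using equivalent_norm_bounds[OF m] by metis
        \<comment> \<open>The Lipschitz property is given for distances. The comparison in X, the
          comparison in Y and the equivalence constant \<open>k'\<close> convert it into a bound in
          coordinates.\<close>
        have lip: "norm (?F z' - ?F z) \<le> (1 + \<epsilon>) * (\<bar>K\<bar> * ((1 + \<epsilon>) * ?n (z' - z))) / k'" if z': "z' \<in> B" for z'
        proof -
          let ?a = "chart_inv c z'" and ?b = "chart_inv c z"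
          have ab: "chart_map c ?a = z'" "chart_map c ?b = z" using hc(5) Bran z' zB by auto
          have "fdist Y (f ?a) (f ?b) \<le> \<bar>K\<bar> * fdist X ?a ?b"
            using r0(2)[of ?a ?b] BO[OF z'] BO[OF zB] mult_right_mono[OF abs_ge_self X.fdist_nonneg, of K ?a ?b] by simp
          also have "\<dots> \<le> \<bar>K\<bar> * ((1 + \<epsilon>) * ?n (z' - z))"
            using r(2)[OF Bball[OF z'] Bball[OF zB]] ab by (intro mult_left_mono) auto
          finally have "(1 + \<epsilon>) * fdist Y (f ?a) (f ?b) \<le> (1 + \<epsilon>) * (\<bar>K\<bar> * ((1 + \<epsilon>) * ?n (z' - z)))"
            using \<epsilon>(1) by (intro mult_left_mono) auto
          moreover have "?m (?F z' - ?F z) \<le> (1 + \<epsilon>) * fdist Y (f ?a) (f ?b)"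
            using rY(2)[of "f ?a" "f ?b"] BO[OF z'] BO[OF zB] by simp
          moreover have "k' * norm (?F z' - ?F z) \<le> ?m (?F z' - ?F z)" by (rule k'(2))
          ultimately have "k' * norm (?F z' - ?F z) \<le> (1 + \<epsilon>) * (\<bar>K\<bar> * ((1 + \<epsilon>) * ?n (z' - z)))" by linarith
          then show ?thesis using k'(1) by (simp only: pos_le_divide_eq mult.commute)
        qed
        have "\<forall>\<^sub>F t in at_right 0. z + t *\<^sub>R v \<in> {z. ?n (z - p) < s}"
        proof -
          have "((\<lambda>t. z + t *\<^sub>R v) \<longlongrightarrow> z + 0 *\<^sub>R v) (at_right 0)" by (intro tendsto_intros)
          moreover have "open {z. ?n (z - p) < s}"
            by (intro open_Collect_less continuous_on_compose2[OF equivalent_norm_continuous[OF n, of UNIV]]) (auto intro!: continuous_intros)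
          ultimately show ?thesis using topological_tendstoD z by fastforce
        qed
        then have "\<forall>\<^sub>F t in at_right 0. norm (?F (z + t *\<^sub>R v) - ?F z) \<le> (1 + \<epsilon>) * (\<bar>K\<bar> * ((1 + \<epsilon>) * ?n v)) / k' * t"
          using eventually_at_right_less[of 0]
        proof eventually_elim
          case (elim t)
          have "z + t *\<^sub>R v \<in> B" using elim nearB by simp
          from lip[OF this] show ?case using elim Dn(3)[of t v] by (simp add: mult_ac)
        qed
        then show "\<exists>K. \<forall>\<^sub>F t in at_right 0. norm (?F (z + t *\<^sub>R v) - ?F z) \<le> K * t" by blast
      qed
      then obtain z where z: "?n (z - p) \<le> ?m (chart_map d y' - ?F p) / \<beta>'" "?F z = chart_map d y'" by blast
      have "?m (chart_map d y' - ?F p) / \<beta>' \<le> s" using y' Fp \<beta>'(2) by (simp add: field_simps)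
      then have "z \<in> chart_map c ` (chart_dom c \<inter> S)" using z(1) near by simp
      then obtain a where a: "a \<in> chart_dom c" "a \<in> S" "z = chart_map c a" by blast
      have "chart_map d (f a) = chart_map d y'" using z(2) a hc by simp
      then have "f a = y'" using hd(3)[OF L(3)[OF a(1)]] hd(3)[of y'] y' by (metis (no_types, lifting) mem_Collect_eq)
      then show "y' \<in> f ` S" using a by blast
    qed
    ultimately show "\<exists>T. open T \<and> y \<in> T \<and> T \<subseteq> f ` S" by blast
  qed
  ultimately show thesis using that[OF oN xN] expand_fdist by blast
qed

end


section \<open>Weights and global lifts\<close>

lemma ennreal_inverse_antimono: "a \<le> b \<Longrightarrow> inverse b \<le> inverse (a :: ennreal)"
proof (cases a; cases b)
  fix r s assume "a \<le> b" and r: "a = ennreal r" "0 \<le> r" and s: "b = ennreal s" "0 \<le> s"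
  then have "r \<le> s" by simp
  then show ?thesis using r s by (cases "r = 0") (auto simp: inverse_ennreal intro!: ennreal_leI)
qed (auto simp: top_unique)

lemma ennreal_inverse_inverse: "inverse (inverse a) = (a :: ennreal)"
proof (cases a)
  case (real r)
  then show ?thesis by (cases "r = 0") (simp_all add: inverse_ennreal)
qed simp

text \<open>The primitive \<open>\<Omega>\<close> of \<open>1 / \<omega>\<close>: it turns the differential inequality \<open>\<eta>' \<le> B \<omega>(\<eta>)\<close> into \<open>(\<Omega> \<circ> \<eta>)' \<le> B\<close>.\<close>

lemma weight_primitive:
  assumes \<omega>: "weight \<omega>"
  obtains \<Omega> :: "real \<Rightarrow> real" where
    "\<And>r s. 0 \<le> r \<Longrightarrow> r \<le> s \<Longrightarrow> \<Omega> r \<le> \<Omega> s"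
    "\<And>r s. 0 \<le> r \<Longrightarrow> r \<le> s \<Longrightarrow> \<Omega> s \<le> \<Omega> r + (s - r) / \<omega> r"
    "\<And>C. \<exists>n::nat. C < \<Omega> (real n)"
proof -
  have mono: "mono_on {0..} \<omega>" and pos: "\<And>\<rho>. \<rho> \<ge> 0 \<Longrightarrow> \<omega> \<rho> > 0"
    and inf: "(\<integral>\<^sup>+\<rho>\<in>{0..}. ennreal (1 / \<omega> \<rho>) \<partial>lborel) = \<infinity>"
    using \<omega> by (auto simp: weight_def)
  \<comment> \<open>The weight is continued constantly to negative arguments, which makes it
    monotone on the whole line and hence Borel measurable.\<close>
  define h where "h \<rho> = ennreal (1 / \<omega> (max 0 \<rho>))" for \<rho>
  have "mono (\<lambda>\<rho>. \<omega> (max 0 \<rho>))"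
    by (intro monoI mono_onD[OF mono]) auto
  then have "(\<lambda>\<rho>. \<omega> (max 0 \<rho>)) \<in> borel_measurable borel" by (rule borel_measurable_mono)
  then have [measurable]: "h \<in> borel_measurable lborel" unfolding h_def by measurable
  define W where "W r = (\<integral>\<^sup>+\<rho>. h \<rho> * indicator {0..r} \<rho> \<partial>lborel)" for r :: real
  \<comment> \<open>Beyond \<open>r\<close> the integrand is at most \<open>1 / \<omega> r\<close>
    by monotonicity of the weight.\<close>
  have step: "W s \<le> W r + ennreal ((s - r) / \<omega> r)" if r: "0 \<le> r" "r \<le> s" for r s
  proof -
    have "W s \<le> (\<integral>\<^sup>+\<rho>. h \<rho> * indicator {0..r} \<rho> + ennreal (1 / \<omega> r) * indicator {r<..s} \<rho> \<partial>lborel)"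
      unfolding W_def
    proof (rule nn_integral_mono)
      fix \<rho> :: real
      have "h \<rho> \<le> ennreal (1 / \<omega> r)" if "r < \<rho>"
        using that r pos[of r] mono_onD[OF mono, of r \<rho>] by (auto simp: h_def intro!: ennreal_leI divide_left_mono)
      then show "h \<rho> * indicator {0..s} \<rho> \<le> h \<rho> * indicator {0..r} \<rho> + ennreal (1 / \<omega> r) * indicator {r<..s} \<rho>"
        using r by (auto simp: indicator_def)
    qed
    also have "\<dots> = W r + (\<integral>\<^sup>+\<rho>. ennreal (1 / \<omega> r) * indicator {r<..s} \<rho> \<partial>lborel)"
      unfolding W_def by (rule nn_integral_add) measurable
    also have "(\<integral>\<^sup>+\<rho>. ennreal (1 / \<omega> r) * indicator {r<..s} \<rho> \<partial>lborel) = ennreal (1 / \<omega> r) * ennreal (s - r)"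
      using r by (subst nn_integral_cmult_indicator) auto
    also have "\<dots> = ennreal ((s - r) / \<omega> r)" using r pos[of r] by (simp flip: ennreal_mult)
    finally show ?thesis .
  qed
  have fin: "W r < \<infinity>" if r: "0 \<le> r" for r
  proof -
    have "W r \<le> (\<integral>\<^sup>+\<rho>. ennreal (1 / \<omega> 0) * indicator {0..r} \<rho> \<partial>lborel)"
      unfolding W_def
    proof (rule nn_integral_mono)
      fix \<rho> :: real
      have "h \<rho> \<le> ennreal (1 / \<omega> 0)"
        using pos[of 0] mono_onD[OF mono, of 0 "max 0 \<rho>"] by (auto simp: h_def intro!: ennreal_leI divide_left_mono)
      then show "h \<rho> * indicator {0..r} \<rho> \<le> ennreal (1 / \<omega> 0) * indicator {0..r} \<rho>"
        by (intro mult_right_mono) auto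
    qed
    also have "\<dots> = ennreal (1 / \<omega> 0) * ennreal (r - 0)"
      using r by (subst nn_integral_cmult_indicator) auto
    also have "\<dots> < \<infinity>" by (simp add: ennreal_mult_less_top)
    finally show ?thesis .
  qed
  have Wmono: "W r \<le> W s" if "r \<le> s" for r s
    unfolding W_def by (intro nn_integral_mono) (use that in \<open>auto simp: indicator_def\<close>)
  have Winf: "(SUP n. W (real n)) = \<infinity>"
  proof -
    have "(SUP n. W (real n)) = (\<integral>\<^sup>+\<rho>. (SUP n. h \<rho> * indicator {0..real n} \<rho>) \<partial>lborel)"
      unfolding W_def
      by (rule nn_integral_monotone_convergence_SUP[symmetric])
         (auto simp: incseq_def le_fun_def indicator_def)
    also have "\<dots> = (\<integral>\<^sup>+\<rho>\<in>{0..}. ennreal (1 / \<omega> \<rho>) \<partial>lborel)"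
    proof (rule nn_integral_cong)
      fix \<rho> :: real
      show "(SUP n. h \<rho> * indicator {0..real n} \<rho>) = ennreal (1 / \<omega> \<rho>) * indicator {0..} \<rho>"
      proof (cases "0 \<le> \<rho>")
        case True
        obtain n where n: "\<rho> \<le> real n" using real_arch_simple by blast
        show ?thesis
        proof (rule antisym)
          show "(SUP n. h \<rho> * indicator {0..real n} \<rho>) \<le> ennreal (1 / \<omega> \<rho>) * indicator {0..} \<rho>"
            by (rule SUP_least) (use True in \<open>auto simp: h_def indicator_def\<close>)
          show "ennreal (1 / \<omega> \<rho>) * indicator {0..} \<rho> \<le> (SUP n. h \<rho> * indicator {0..real n} \<rho>)"
            by (rule SUP_upper2[of n]) (use True n in \<open>auto simp: h_def indicator_def\<close>)
        qed
      qed (auto simp: indicator_def)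
    qed
    finally show ?thesis using inf by simp
  qed
  define \<Omega> where "\<Omega> r = enn2real (W r)" for r
  have \<Omega>: "ennreal (\<Omega> r) = W r" "0 \<le> \<Omega> r" if "0 \<le> r" for r using fin[OF that] by (auto simp: \<Omega>_def)
  show thesis
  proof (rule that[of \<Omega>])
    show "\<Omega> r \<le> \<Omega> s" if "0 \<le> r" "r \<le> s" for r s
      unfolding \<Omega>_def by (rule enn2real_mono[OF Wmono[OF that(2)]]) (use fin[of s] that in auto)
    show "\<Omega> s \<le> \<Omega> r + (s - r) / \<omega> r" if "0 \<le> r" "r \<le> s" for r s
    proof -
      have "ennreal (\<Omega> s) \<le> ennreal (\<Omega> r + (s - r) / \<omega> r)"
        using step[OF that] that pos[of r] \<Omega>(2)[of r] by (simp add: \<Omega>(1) ennreal_plus)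
      moreover have "0 \<le> \<Omega> r + (s - r) / \<omega> r" using that pos[of r] \<Omega>(2)[of r] by simp
      ultimately show ?thesis by (simp add: ennreal_le_iff)
    qed
    show "\<exists>n::nat. C < \<Omega> (real n)" for C
    proof (rule ccontr)
      assume "\<not> ?thesis"
      then have "W (real n) \<le> ennreal C" for n using \<Omega>(1)[of "real n"] by (metis ennreal_leI not_less of_nat_0_le_iff)
      then have "(SUP n. W (real n)) \<le> ennreal C" by (rule SUP_least)
      then show False using Winf by (simp add: top_unique)
    qed
  qed
qed

text \<open>Composing with the primitive \<Omega> of the reciprocal weight turns the hypothesis into
  growth of rate at most \<open>B\<close>, so \<open>\<Omega> \<circ> \<eta>\<close> stays below a
  constant on the bounded interval. Divergence of the integral makes \<Omega> unbounded, which
  bounds \<eta>.\<close>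

lemma weighted_growth_bound:
  assumes \<omega>: "weight \<omega>" and \<eta>: "continuous_on {0..<b} \<eta>" "\<And>t. t \<in> {0..<b} \<Longrightarrow> 0 \<le> \<eta> t" and B: "B \<ge> 0"
    and growth: "\<And>t. t \<in> {0..<b} \<Longrightarrow> \<exists>\<delta>>0. \<forall>s. t < s \<longrightarrow> s < t + \<delta> \<longrightarrow> s < b \<longrightarrow> \<eta> s - \<eta> t \<le> B * \<omega> (\<eta> t) * (s - t)"
  shows "\<exists>M\<ge>0. \<forall>t\<in>{0..<b}. \<eta> t \<le> M"
proof -
  have pos: "\<And>\<rho>. \<rho> \<ge> 0 \<Longrightarrow> \<omega> \<rho> > 0" and mono: "mono_on {0..} \<omega>" using \<omega> by (auto simp: weight_def)
  obtain \<Omega> :: "real \<Rightarrow> real" where \<Omega>: "\<And>r s. 0 \<le> r \<Longrightarrow> r \<le> s \<Longrightarrow> \<Omega> r \<le> \<Omega> s"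
    "\<And>r s. 0 \<le> r \<Longrightarrow> r \<le> s \<Longrightarrow> \<Omega> s \<le> \<Omega> r + (s - r) / \<omega> r" "\<And>C. \<exists>n::nat. C < \<Omega> (real n)"
    using weight_primitive[OF \<omega>] by metis
  have "(1 / \<omega> 0)-lipschitz_on {0..} \<Omega>"
  proof (rule lipschitz_on_leI)
    fix r s :: real assume rs: "r \<in> {0..}" "s \<in> {0..}" "r \<le> s"
    have "(s - r) / \<omega> r \<le> (s - r) / \<omega> 0" using rs pos mono_onD[OF mono, of 0 r] by (intro divide_left_mono) auto
    then show "dist (\<Omega> r) (\<Omega> s) \<le> 1 / \<omega> 0 * dist r s" using \<Omega>(1,2)[of r s] rs by (simp add: dist_real_def)
  qed (use pos[of 0] in simp)
  then have cont: "continuous_on {0..} \<Omega>" by (rule lipschitz_on_continuous_on)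
  have bound: "\<Omega> (\<eta> t) \<le> \<Omega> (\<eta> 0) + B * b" if t: "t \<in> {0..<b}" for t
  proof -
    have "\<Omega> (\<eta> t) \<le> \<Omega> (\<eta> 0) + B * (t - 0)"
    proof (rule dini_le[where g = "\<lambda>t. \<Omega> (\<eta> t)"])
      show "continuous_on {0..t} (\<lambda>t. \<Omega> (\<eta> t))"
        by (rule continuous_on_compose2[OF cont continuous_on_subset[OF \<eta>(1)]]) (use t \<eta>(2) in auto)
      fix \<tau> assume \<tau>: "0 \<le> \<tau>" "\<tau> < t"
      then have \<tau>b: "\<tau> \<in> {0..<b}" using t by auto
      obtain \<delta> where \<delta>: "\<delta> > 0" "\<And>s. \<tau> < s \<Longrightarrow> s < \<tau> + \<delta> \<Longrightarrow> s < b \<Longrightarrow> \<eta> s - \<eta> \<tau> \<le> B * \<omega> (\<eta> \<tau>) * (s - \<tau>)"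
        using growth[OF \<tau>b] by blast
      show "\<exists>\<delta>>0. \<forall>s>\<tau>. s < \<tau> + \<delta> \<longrightarrow> s \<le> t \<longrightarrow> \<Omega> (\<eta> s) \<le> \<Omega> (\<eta> \<tau>) + B * (s - \<tau>)"
      proof (intro exI[of _ \<delta>] conjI allI impI)
        fix s assume s: "\<tau> < s" "s < \<tau> + \<delta>" "s \<le> t"
        have sb: "s \<in> {0..<b}" using s t \<tau> by auto
        show "\<Omega> (\<eta> s) \<le> \<Omega> (\<eta> \<tau>) + B * (s - \<tau>)"
        \<comment> \<open>The increment estimate for \<Omega> compares with larger arguments only;
          where \<eta> has decreased, monotonicity of \<Omega> is enough.\<close>
        proof (cases "\<eta> \<tau> \<le> \<eta> s")
          case True
          have "(\<eta> s - \<eta> \<tau>) / \<omega> (\<eta> \<tau>) \<le> B * (s - \<tau>)"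
            using \<delta>(2)[of s] s sb pos[OF \<eta>(2)[OF \<tau>b]] by (simp add: field_simps)
          then show ?thesis using \<Omega>(2)[OF \<eta>(2)[OF \<tau>b] True] by simp
        next
          case False
          then have "\<Omega> (\<eta> s) \<le> \<Omega> (\<eta> \<tau>)" using \<Omega>(1)[OF \<eta>(2)[OF sb]] by simp
          moreover have "0 \<le> B * (s - \<tau>)" using B s by simp
          ultimately show ?thesis by linarith
        qed
      qed (use \<delta> in auto)
    qed (use t in auto)
    also have "B * (t - 0) \<le> B * b" using t B by (intro mult_left_mono) auto
    finally show ?thesis by simp
  qed
  obtain n :: nat where n: "\<Omega> (\<eta> 0) + B * b < \<Omega> (real n)" using \<Omega>(3) by blast
  have "\<eta> t \<le> real n" if t: "t \<in> {0..<b}" for t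
  proof (rule ccontr)
    assume "\<not> ?thesis"
    then have "\<Omega> (real n) \<le> \<Omega> (\<eta> t)" by (intro \<Omega>(1)) auto
    then show False using bound[OF t] n by simp
  qed
  then show ?thesis by (intro exI[of _ "real n"]) auto
qed

context finsler_space
begin

text \<open>Right-local bounds with a common constant add up to a global Lipschitz bound.
  Completeness gives a limit along one sequence approaching \<open>b\<close>, and the Lipschitz
  bound extends it to all times.\<close>

lemma lipschitz_curve_limit:
  assumes complete: "finsler_complete X" and b: "0 < b" and \<gamma>: "continuous_on {0..<b} \<gamma>"
    and K: "K \<ge> 0" "\<And>t. t \<in> {0..<b} \<Longrightarrow> \<exists>\<delta>>0. \<forall>s. t < s \<longrightarrow> s < t + \<delta> \<longrightarrow> s < b \<longrightarrow> fdist X (\<gamma> t) (\<gamma> s) \<le> K * (s - t)"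
  shows "\<exists>x. (\<gamma> \<longlongrightarrow> x) (at_left b)"
proof -
  have lip: "fdist X (\<gamma> s) (\<gamma> t) \<le> K * (t - s)" if st: "0 \<le> s" "s \<le> t" "t < b" for s t
  proof -
    have "fdist X (\<gamma> s) (\<gamma> t) \<le> fdist X (\<gamma> s) (\<gamma> s) + K * (t - s)"
    proof (rule dini_le[where g = "\<lambda>\<tau>. fdist X (\<gamma> s) (\<gamma> \<tau>)"])
      show "continuous_on {s..t} (\<lambda>\<tau>. fdist X (\<gamma> s) (\<gamma> \<tau>))"
        by (rule continuous_on_compose2[OF continuous_fdist[of UNIV] continuous_on_subset[OF \<gamma>]]) (use st in auto)
      fix \<tau> assume \<tau>: "s \<le> \<tau>" "\<tau> < t"
      obtain \<delta> where \<delta>: "\<delta> > 0" "\<And>s. \<tau> < s \<Longrightarrow> s < \<tau> + \<delta> \<Longrightarrow> s < b \<Longrightarrow> fdist X (\<gamma> \<tau>) (\<gamma> s) \<le> K * (s - \<tau>)"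
        using K(2)[of \<tau>] \<tau> st by auto
      show "\<exists>\<delta>>0. \<forall>y>\<tau>. y < \<tau> + \<delta> \<longrightarrow> y \<le> t \<longrightarrow> fdist X (\<gamma> s) (\<gamma> y) \<le> fdist X (\<gamma> s) (\<gamma> \<tau>) + K * (y - \<tau>)"
      proof (intro exI[of _ \<delta>] conjI allI impI)
        fix y assume "\<tau> < y" "y < \<tau> + \<delta>" "y \<le> t"
        then show "fdist X (\<gamma> s) (\<gamma> y) \<le> fdist X (\<gamma> s) (\<gamma> \<tau>) + K * (y - \<tau>)"
          using \<delta>(2)[of y] st fdist_triangle[of "\<gamma> s" "\<gamma> y" "\<gamma> \<tau>"] by linarith
      qed (use \<delta> in auto)
    qed (use st in auto)
    then show ?thesis by simp
  qed
  have lip': "fdist X (\<gamma> s) (\<gamma> t) \<le> K * \<bar>t - s\<bar>" if "s \<in> {0..<b}" "t \<in> {0..<b}" for s t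
    using lip[of s t] lip[of t s] that fdist_commute[of "\<gamma> s" "\<gamma> t"] by (cases "s \<le> t") auto
  define t where "t k = b - b / real (k + 2)" for k
  have t: "t k \<in> {0..<b}" for k
    using b mult_left_mono[of 1 "real (k + 2)" b] by (auto simp: t_def field_simps)
  have tlim: "t \<longlonglongrightarrow> b"
  proof -
    have "(\<lambda>k. b / real (k + 2)) \<longlonglongrightarrow> 0"
      by (rule LIMSEQ_ignore_initial_segment[OF lim_const_over_n])
    then show ?thesis unfolding t_def[abs_def] using tendsto_diff[OF tendsto_const] by fastforce
  qed
  have "\<exists>N. \<forall>i\<ge>N. \<forall>j\<ge>N. fdist X (\<gamma> (t i)) (\<gamma> (t j)) < e" if e: "e > 0" for e
  proof -
    have "e / (K + 1) > 0" using e K by simp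
    then obtain N where N: "\<And>i j. i \<ge> N \<Longrightarrow> j \<ge> N \<Longrightarrow> norm (t i - t j) < e / (K + 1)"
      using CauchyD[OF LIMSEQ_imp_Cauchy[OF tlim]] by metis
    have "fdist X (\<gamma> (t i)) (\<gamma> (t j)) < e" if "i \<ge> N" "j \<ge> N" for i j
    proof -
      have "fdist X (\<gamma> (t i)) (\<gamma> (t j)) \<le> K * \<bar>t j - t i\<bar>" by (rule lip'[OF t t])
      also have "\<dots> \<le> (K + 1) * \<bar>t j - t i\<bar>" by (intro mult_right_mono) auto
      also have "\<dots> < (K + 1) * (e / (K + 1))" using N[OF that(2,1)] K by (intro mult_strict_left_mono) auto
      finally show ?thesis using K by simp
    qed
    then show ?thesis by blast
  qed
  then obtain x where x: "(\<lambda>k. \<gamma> (t k)) \<longlonglongrightarrow> x" using complete_convergent[OF complete] by metis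
  have dx: "fdist X x (\<gamma> s) \<le> K * (b - s)" if s: "s \<in> {0..<b}" for s
  proof -
    have "(\<lambda>k. fdist X (\<gamma> s) (\<gamma> (t k))) \<longlonglongrightarrow> fdist X (\<gamma> s) x"
      by (rule continuous_on_tendsto_compose[OF continuous_fdist[of UNIV] x]) auto
    moreover have "(\<lambda>k. K * \<bar>t k - s\<bar>) \<longlonglongrightarrow> K * \<bar>b - s\<bar>" by (intro tendsto_intros tlim)
    ultimately have "fdist X (\<gamma> s) x \<le> K * \<bar>b - s\<bar>" using lip'[OF s t] by (intro LIMSEQ_le) auto
    then show ?thesis using s fdist_commute[of x "\<gamma> s"] by simp
  qed
  have ev: "\<forall>\<^sub>F s in at_left b. s \<in> {0..<b}"
    using eventually_at_left_real[OF b] by (rule eventually_mono) auto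
  have "((\<lambda>s. K * (b - s)) \<longlongrightarrow> K * (b - b)) (at_left b)" by (intro tendsto_intros)
  then have lim: "((\<lambda>s. K * (b - s)) \<longlongrightarrow> 0) (at_left b)" by simp
  have "((\<lambda>s. fdist X x (\<gamma> s)) \<longlongrightarrow> 0) (at_left b)"
    by (rule tendsto_sandwich[OF _ _ tendsto_const lim])
       (use ev dx in \<open>auto simp: fdist_nonneg elim: eventually_mono\<close>)
  then show ?thesis by (auto simp: tendsto_fdist)
qed

end

section \<open>Covering property and Lipschitz modulus of the inverse\<close>

context finsler_pseudo_jacobian
begin

text \<open>If no radius and constant worked around \<open>y\<close>, points chosen for the
  constants \<open>1 / real (Suc n)\<close> would form a forbidden sequence. The sequential
  condition thus becomes a uniform bound over a neighbourhood of \<open>y\<close>.\<close>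

lemma weighted_lower_bound:
  assumes no: "\<not> (\<exists>(s :: nat \<Rightarrow> 'x) y. (\<lambda>n. f (s n)) \<longlonglongrightarrow> y \<and>
                    (\<lambda>n. reg_index X Y f Jf (s n) * ennreal (\<omega> (fdist X x' (s n)))) \<longlonglongrightarrow> 0)"
  obtains V c where "open V" "y \<in> V" "c > 0"
    "\<And>x. f x \<in> V \<Longrightarrow> ennreal c \<le> reg_index X Y f Jf x * ennreal (\<omega> (fdist X x' x))"
proof -
  let ?q = "\<lambda>x. reg_index X Y f Jf x * ennreal (\<omega> (fdist X x' x))"
  have "\<exists>c>0. \<forall>x. f x \<in> fball Y y c \<longrightarrow> ennreal c \<le> ?q x"
  proof (rule ccontr)
    assume "\<not> ?thesis"
    then have "\<exists>x. f x \<in> fball Y y (1 / real (Suc n)) \<and> ?q x < ennreal (1 / real (Suc n))" for n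
      by (metis not_le of_nat_0_less_iff zero_less_Suc zero_less_divide_1_iff)
    then obtain s where s: "\<And>n. f (s n) \<in> fball Y y (1 / real (Suc n))" "\<And>n. ?q (s n) < ennreal (1 / real (Suc n))" by metis
    have lim: "(\<lambda>n. 1 / real (Suc n)) \<longlonglongrightarrow> 0" by (rule LIMSEQ_Suc[OF lim_1_over_n])
    have "(\<lambda>n. fdist Y y (f (s n))) \<longlonglongrightarrow> 0"
      by (rule tendsto_sandwich[OF _ _ tendsto_const lim])
         (use s(1) in \<open>auto simp: fball_def Y.fdist_nonneg less_imp_le\<close>)
    then have "(\<lambda>n. f (s n)) \<longlonglongrightarrow> y" by (simp add: Y.tendsto_fdist)
    moreover have "(\<lambda>n. ?q (s n)) \<longlonglongrightarrow> 0"
    proof (rule tendsto_sandwich[OF _ _ tendsto_const])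
      show "(\<lambda>n. ennreal (1 / real (Suc n))) \<longlonglongrightarrow> 0" using tendsto_ennrealI[OF lim] by simp
    qed (use s(2) in \<open>auto simp: less_imp_le\<close>)
    ultimately show False using no by blast
  qed
  then obtain c where "c > 0" "\<And>x. f x \<in> fball Y y c \<Longrightarrow> ennreal c \<le> ?q x" by blast
  then show thesis using that[of "fball Y y c" c] Y.fball_open by (simp add: fball_def)
qed

text \<open>The local expansion constant at \<open>\<gamma> t\<close> may degenerate as the curve
  moves away from \<open>x'\<close>, but no faster than the reciprocal weight, and
  \<open>weighted_growth_bound\<close> keeps the curve at bounded distance.\<close>

lemma lift_limit:
  assumes complete: "finsler_complete X" and reg: "\<And>x. Jf_regular_at X Y f Jf x" and \<omega>: "weight \<omega>"
    and c: "c > 0" "\<And>x. f x \<in> V \<Longrightarrow> ennreal c \<le> reg_index X Y f Jf x * ennreal (\<omega> (fdist X x' x))"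
    and b: "0 < b" and \<gamma>: "continuous_on {0..<b} \<gamma>"
    and A: "A \<ge> 0" "\<And>s t. s \<in> {0..<b} \<Longrightarrow> t \<in> {0..<b} \<Longrightarrow> fdist Y (f (\<gamma> s)) (f (\<gamma> t)) \<le> A * \<bar>t - s\<bar>"
    and V: "\<And>t. t \<in> {0..<b} \<Longrightarrow> f (\<gamma> t) \<in> V"
  shows "\<exists>x. (\<gamma> \<longlongrightarrow> x) (at_left b)"
proof -
  have pos: "\<And>\<rho>. \<rho> \<ge> 0 \<Longrightarrow> \<omega> \<rho> > 0" and mono: "mono_on {0..} \<omega>" using \<omega> by (auto simp: weight_def)
  define \<eta> where "\<eta> t = fdist X x' (\<gamma> t)" for t
  have \<eta>0: "0 \<le> \<eta> t" for t by (simp add: \<eta>_def X.fdist_nonneg)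
  define B where "B = 2 * A / c"
  have B: "B \<ge> 0" using A c by (simp add: B_def)
  have local: "\<exists>\<delta>>0. \<forall>s. t < s \<longrightarrow> s < t + \<delta> \<longrightarrow> s < b \<longrightarrow> fdist X (\<gamma> t) (\<gamma> s) \<le> B * \<omega> (\<eta> t) * (s - t)"
    if t: "t \<in> {0..<b}" for t
  proof -
    \<comment> \<open>Half of what the submersion bound allows, to be strictly below the index; this
      is the origin of the factor 2 in \<open>B\<close>.\<close>
    define \<beta> where "\<beta> = c / (2 * \<omega> (\<eta> t))"
    have w: "\<omega> (\<eta> t) > 0" using pos \<eta>0 by simp
    have \<beta>: "\<beta> > 0" using c w by (simp add: \<beta>_def)
    have "ennreal \<beta> < reg_index X Y f Jf (\<gamma> t)"
    proof (rule ccontr)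
      assume "\<not> ?thesis"
      then have "reg_index X Y f Jf (\<gamma> t) * ennreal (\<omega> (\<eta> t)) \<le> ennreal \<beta> * ennreal (\<omega> (\<eta> t))"
        by (intro mult_right_mono) auto
      also have "\<dots> = ennreal (c / 2)" using \<beta> w by (simp add: \<beta>_def flip: ennreal_mult)
      also have "\<dots> < ennreal c" using c by (simp add: ennreal_less_iff)
      finally show False using c(2)[OF V[OF t]] by (simp add: \<eta>_def)
    qed
    then obtain N where N: "open N" "\<gamma> t \<in> N" "\<And>u v. u \<in> N \<Longrightarrow> v \<in> N \<Longrightarrow> \<beta> * fdist X u v \<le> fdist Y (f u) (f v)"
      using local_inversion[OF reg \<beta>] by metis
    have "openin (top_of_set {0..<b}) ({0..<b} \<inter> \<gamma> -` N)" by (rule continuous_openin_preimage_gen[OF \<gamma> N(1)])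
    then obtain \<delta> where \<delta>: "\<delta> > 0" "\<And>s. s \<in> {0..<b} \<Longrightarrow> dist s t < \<delta> \<Longrightarrow> \<gamma> s \<in> N"
      using t N(2) unfolding openin_euclidean_subtopology_iff by blast
    show ?thesis
    proof (intro exI[of _ \<delta>] conjI allI impI)
      fix s assume s: "t < s" "s < t + \<delta>" "s < b"
      have sb: "s \<in> {0..<b}" using s t by auto
      have "\<gamma> s \<in> N" using \<delta>(2)[OF sb] s by (simp add: dist_real_def)
      then have "\<beta> * fdist X (\<gamma> t) (\<gamma> s) \<le> A * (s - t)" using N(2,3) A(2)[OF t sb] s by force
      then have "c * fdist X (\<gamma> t) (\<gamma> s) \<le> 2 * A * \<omega> (\<eta> t) * (s - t)" using w by (simp add: \<beta>_def field_simps)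
      then show "fdist X (\<gamma> t) (\<gamma> s) \<le> B * \<omega> (\<eta> t) * (s - t)" using c(1) by (simp add: B_def field_simps)
    qed (use \<delta> in auto)
  qed
  have "\<exists>M\<ge>0. \<forall>t\<in>{0..<b}. \<eta> t \<le> M"
  proof (rule weighted_growth_bound[OF \<omega> _ _ B])
    show "continuous_on {0..<b} \<eta>" unfolding \<eta>_def
      by (rule continuous_on_compose2[OF X.continuous_fdist[of UNIV] \<gamma>]) auto
    fix t assume t: "t \<in> {0..<b}"
    show "\<exists>\<delta>>0. \<forall>s. t < s \<longrightarrow> s < t + \<delta> \<longrightarrow> s < b \<longrightarrow> \<eta> s - \<eta> t \<le> B * \<omega> (\<eta> t) * (s - t)"
    proof -
      have "\<eta> s - \<eta> t \<le> fdist X (\<gamma> t) (\<gamma> s)" for s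
        using X.abs_fdist_diff[of x' "\<gamma> s" "\<gamma> t"] X.fdist_commute[of "\<gamma> s" "\<gamma> t"] by (simp add: \<eta>_def)
      then show ?thesis using local[OF t] by (meson order_trans)
    qed
  qed (use \<eta>0 in auto)
  then obtain M where M: "M \<ge> 0" "\<And>t. t \<in> {0..<b} \<Longrightarrow> \<eta> t \<le> M" by blast
  show ?thesis
  proof (rule X.lipschitz_curve_limit[OF complete b \<gamma>])
    show "0 \<le> B * \<omega> M" using B pos[OF M(1)] by simp
    fix t assume t: "t \<in> {0..<b}"
    obtain \<delta> where \<delta>: "\<delta> > 0" "\<And>s. t < s \<Longrightarrow> s < t + \<delta> \<Longrightarrow> s < b \<Longrightarrow> fdist X (\<gamma> t) (\<gamma> s) \<le> B * \<omega> (\<eta> t) * (s - t)"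
      using local[OF t] by blast
    \<comment> \<open>Once the distance is bounded, monotonicity of the weight replaces the varying
      constant by a uniform one.\<close>
    have "\<omega> (\<eta> t) \<le> \<omega> M" using mono_onD[OF mono, of "\<eta> t" M] \<eta>0 M t by auto
    then have "B * \<omega> (\<eta> t) * (s - t) \<le> B * \<omega> M * (s - t)" if "t < s" for s
      using B that by (intro mult_right_mono mult_left_mono) auto
    then show "\<exists>\<delta>>0. \<forall>s. t < s \<longrightarrow> s < t + \<delta> \<longrightarrow> s < b \<longrightarrow> fdist X (\<gamma> t) (\<gamma> s) \<le> B * \<omega> M * (s - t)"
      using \<delta> by (intro exI[of _ \<delta>]) (meson order_trans)
  qed
qed

text \<open>Each \<open>y\<close> receives a chart ball inside the neighbourhood on which the
  weighted bound holds. Its coordinate segments are Lipschitz curves in Y, so their partial lifts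
  converge and the hypotheses of \<open>star_lift\<close> are met.\<close>

lemma covering:
  assumes complete: "finsler_complete X" and reg: "\<And>x. Jf_regular_at X Y f Jf x"
    and wss: "weighted_strong_submersion X Y f Jf"
  shows "covering_space UNIV f UNIV"
proof -
  have idx: "\<exists>\<beta>>0. ennreal \<beta> < reg_index X Y f Jf x" for x
  proof -
    have "0 < reg_index X Y f Jf x" using reg[of x] by (simp add: Jf_regular_at_def)
    then obtain b where b: "0 < b" "b < reg_index X Y f Jf x" using dense by blast
    then obtain \<beta> where "b = ennreal \<beta>" "\<beta> \<ge> 0" by (metis ennreal_cases leD top_greatest)
    then show ?thesis using b by (intro exI[of _ \<beta>]) (auto simp: ennreal_less_zero_iff)
  qed
  interpret local_homeo f
  proof
    show "continuous_on UNIV f" by (rule continuous)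
    fix x
    obtain \<beta> where \<beta>: "\<beta> > 0" "ennreal \<beta> < reg_index X Y f Jf x" using idx by blast
    show "\<exists>N. open N \<and> x \<in> N \<and> inj_on f N \<and> (\<forall>S. open S \<longrightarrow> S \<subseteq> N \<longrightarrow> open (f ` S))"
      using local_inversion[OF reg \<beta>] by metis
  qed
  obtain x' \<omega> where \<omega>: "weight \<omega>" and no: "\<not> (\<exists>(s :: nat \<Rightarrow> 'x) y. (\<lambda>n. f (s n)) \<longlonglongrightarrow> y \<and>
        (\<lambda>n. reg_index X Y f Jf (s n) * ennreal (\<omega> (fdist X x' (s n)))) \<longlonglongrightarrow> 0)"
    using wss unfolding weighted_strong_submersion_def by blast
  show ?thesis
  proof (rule covering_spaceI)
    show "connected (UNIV :: 'y set)" using Y.finsler by (simp add: finsler_manifold_def)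
    fix y
    obtain V0 c where V0: "open V0" "y \<in> V0" and c: "c > 0"
      "\<And>x. f x \<in> V0 \<Longrightarrow> ennreal c \<le> reg_index X Y f Jf x * ennreal (\<omega> (fdist X x' x))"
      using weighted_lower_bound[OF no, of y] by metis
    obtain d where d: "d \<in> charts_at Y y" using Y.chart_exists by blast
    have dY: "d \<in> charts Y" "y \<in> chart_dom d" using d by (auto simp: charts_at_iff)
    note hd = is_chartD[OF charts_is_chart[OF dY(1)]]
    let ?m = "chart_norm Y d y"
    note m = Y.equivalent_chart_norm[OF d]
    note D = equivalent_normD[OF m]
    obtain r where r: "fball Y y r \<subseteq> V0 \<inter> chart_dom d"
      "\<And>u v. u \<in> fball Y y r \<Longrightarrow> v \<in> fball Y y r \<Longrightarrow> fdist Y u v \<le> (1 + 1) * ?m (chart_map d u - chart_map d v)"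
      "\<exists>T. open T \<and> y \<in> T \<and> T \<subseteq> fball Y y r"
      by (rule Y.fdist_chart_comparison[OF d V0 zero_less_one]) blast
    obtain T where T: "open T" "y \<in> T" "T \<subseteq> fball Y y r" using r(3) by blast
    obtain \<rho> where \<rho>: "\<rho> > 0" "\<And>z. ?m (z - chart_map d y) < \<rho> \<Longrightarrow> z \<in> chart_ran d \<and> chart_inv d z \<in> T"
      by (rule Y.chart_ball_exists[OF d T(1,2)]) blast
    define P where "P = {z. ?m (z - chart_map d y) < \<rho>}"
    define V where "V = {u\<in>chart_dom d. ?m (chart_map d u - chart_map d y) < \<rho>}"
    have P: "z \<in> chart_ran d" "chart_inv d z \<in> fball Y y r" if "z \<in> P" for z using \<rho>(2)[of z] T(3) that by (auto simp: P_def)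
    have PV: "chart_inv d z \<in> V" if "z \<in> P" for z using P(1)[OF that] that hd by (simp add: V_def P_def)
    have VV0: "V \<subseteq> V0"
    proof
      fix u assume "u \<in> V"
      then have "chart_map d u \<in> P" "chart_inv d (chart_map d u) = u" using hd by (auto simp: V_def P_def)
      then show "u \<in> V0" using P(2)[of "chart_map d u"] r(1) by auto
    qed
    have "star_lift f V P (chart_map d) (chart_inv d)"
    proof
      show "homeomorphism V P (chart_map d) (chart_inv d)"
        unfolding homeomorphism_def
      proof (intro conjI ballI)
        show "continuous_on V (chart_map d)" by (rule continuous_on_subset[OF hd(7)]) (auto simp: V_def)
        show "continuous_on P (chart_inv d)" by (rule continuous_on_subset[OF hd(8)]) (use P in auto)
        show "chart_inv d (chart_map d u) = u" if "u \<in> V" for u using that hd by (auto simp: V_def)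
        show "chart_map d (chart_inv d z) = z" if "z \<in> P" for z using P[OF that] hd by auto
        then show "chart_map d ` V = P" using PV by (force simp: V_def P_def image_iff)
        show "chart_inv d ` P = V" using PV hd by (force simp: V_def P_def image_iff)
      qed
      show "open V" unfolding V_def by (rule Y.open_chart_ball[OF d])
      show "open P" unfolding P_def
        by (intro open_Collect_less continuous_on_compose2[OF equivalent_norm_continuous[OF m, of UNIV]]) (auto intro!: continuous_intros)
      show "convex P" unfolding P_def by (rule Y.chart_norm_ball_convex[OF d])
      fix p w b and \<gamma> :: "real \<Rightarrow> 'x"
      assume b: "0 < b" and inP: "\<And>t. t \<in> {0..b} \<Longrightarrow> p + t *\<^sub>R w \<in> P" and \<gamma>: "continuous_on {0..<b} \<gamma>"
        and lift: "\<And>t. t \<in> {0..<b} \<Longrightarrow> f (\<gamma> t) = chart_inv d (p + t *\<^sub>R w)"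
      show "\<exists>x. (\<gamma> \<longlongrightarrow> x) (at_left b)"
      proof (rule lift_limit[OF complete reg \<omega> c b \<gamma>, where A = "2 * ?m w"])
        show "0 \<le> 2 * ?m w" using D(1) by simp
        show "f (\<gamma> t) \<in> V0" if "t \<in> {0..<b}" for t using lift[OF that] PV[OF inP[of t]] VV0 that by auto
        show "fdist Y (f (\<gamma> s)) (f (\<gamma> t)) \<le> 2 * ?m w * \<bar>t - s\<bar>" if st: "s \<in> {0..<b}" "t \<in> {0..<b}" for s t
        proof -
          let ?u = "p + s *\<^sub>R w" and ?v = "p + t *\<^sub>R w"
          have uv: "?u \<in> P" "?v \<in> P" using inP st by auto
          have "fdist Y (chart_inv d ?u) (chart_inv d ?v) \<le> (1 + 1) * ?m (?u - ?v)"
            using r(2)[OF P(2)[OF uv(1)] P(2)[OF uv(2)]] hd(5)[OF P(1)[OF uv(1)]] hd(5)[OF P(1)[OF uv(2)]] by simp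
          also have "?u - ?v = (s - t) *\<^sub>R w" by (simp add: algebra_simps)
          finally show ?thesis using lift st D(3)[of "s - t" w] by (simp add: abs_minus_commute mult_ac)
        qed
      qed
    qed
    moreover have "y \<in> V" using dY D(5) \<rho>(1) by (simp add: V_def)
    ultimately show "\<exists>V P \<psi> h. y \<in> V \<and> star_lift f V (P :: 'f set) \<psi> h" by blast
  qed
qed

lemma pseudo_lipschitz_const_inverse:
  assumes reg: "Jf_regular_at X Y f Jf x" and \<beta>: "0 < \<beta>" "ennreal \<beta> < reg_index X Y f Jf x"
  shows "pseudo_lipschitz_const X Y (\<lambda>z. f -` {z}) (f x) x (1 / \<beta>)"
proof -
  obtain N where N: "open N" "x \<in> N" "\<And>S. open S \<Longrightarrow> S \<subseteq> N \<Longrightarrow> open (f ` S)"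
    "\<And>u v. u \<in> N \<Longrightarrow> v \<in> N \<Longrightarrow> \<beta> * fdist X u v \<le> fdist Y (f u) (f v)"
    using local_inversion[OF reg \<beta>] by metis
  show ?thesis
    unfolding pseudo_lipschitz_const_def
  proof (intro conjI exI[of _ "f ` N"] exI[of _ N] ballI impI)
    fix w z u assume z: "z \<in> f ` N" and u: "u \<in> N" "u \<in> f -` {w}"
    obtain v where v: "v \<in> N" "z = f v" using z by blast
    have "set_fdist X u (f -` {z}) \<le> ennreal (fdist X u v)"
      unfolding set_fdist_def by (rule INF_lower) (use v in simp)
    also have "fdist X u v \<le> 1 / \<beta> * fdist Y w z" using N(4)[OF u(1) v(1)] u(2) v(2) \<beta>(1) by (simp add: field_simps)
    finally show "set_fdist X u (f -` {z}) \<le> ennreal (1 / \<beta> * fdist Y w z)" by (simp add: ennreal_leI)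
  qed (use N \<beta> in auto)
qed

text \<open>The constants \<open>1 / \<beta>\<close> are admissible for all positive \<beta> below
  the index. The infimum is compared with the inverse in the extended reals by density, which
  includes an infinite index with bound 0.\<close>

lemma lip_inverse_le:
  assumes reg: "Jf_regular_at X Y f Jf x"
  shows "pseudo_lipschitz_around X Y (\<lambda>z. f -` {z}) (f x) x"
    "lip X Y (\<lambda>z. f -` {z}) (f x) x \<le> inverse (reg_index X Y f Jf x)"
proof -
  let ?C = "reg_index X Y f Jf x" and ?g = "\<lambda>z. f -` {z}"
  have lt: "\<exists>\<beta>>0. b \<le> ennreal \<beta> \<and> ennreal \<beta> < ?C" if "b < ?C" for b
  proof -
    obtain b' where b': "b < b'" "b' < ?C" using dense[OF \<open>b < ?C\<close>] by blast
    then obtain \<beta> where \<beta>: "b' = ennreal \<beta>" "\<beta> \<ge> 0" by (metis ennreal_cases leD top_greatest)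
    have "0 < b'" using b'(1) zero_le by (rule le_less_trans[rotated])
    then show ?thesis using b' \<beta> by (intro exI[of _ \<beta>]) (auto simp: ennreal_less_zero_iff)
  qed
  have "0 < ?C" using reg by (simp add: Jf_regular_at_def)
  from lt[OF this] show "pseudo_lipschitz_around X Y ?g (f x) x"
    unfolding pseudo_lipschitz_around_def using pseudo_lipschitz_const_inverse[OF reg] by blast
  show "lip X Y ?g (f x) x \<le> inverse ?C"
  proof (rule ccontr)
    assume "\<not> ?thesis"
    then have l: "inverse ?C < lip X Y ?g (f x) x" by simp
    then obtain e where e: "inverse ?C < e" "e < lip X Y ?g (f x) x" using dense by blast
    \<comment> \<open>Inversion is antitone and involutive on the extended reals, so a value
      \<open>e\<close> above \<open>inverse ?C\<close> leaves room for some \<beta> between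
      \<open>inverse e\<close> and \<open>?C\<close>.\<close>
    have "inverse e < ?C"
    proof (rule ccontr)
      assume "\<not> ?thesis"
      then have "inverse (inverse e) \<le> inverse ?C" by (intro ennreal_inverse_antimono) simp
      then show False using e(1) by (simp add: ennreal_inverse_inverse)
    qed
    then obtain \<beta> where \<beta>: "\<beta> > 0" "inverse e \<le> ennreal \<beta>" "ennreal \<beta> < ?C" using lt by blast
    have "lip X Y ?g (f x) x \<le> ennreal (1 / \<beta>)"
      unfolding lip_def by (rule INF_lower) (use pseudo_lipschitz_const_inverse[OF reg \<beta>(1,3)] in simp)
    also have "\<dots> = inverse (ennreal \<beta>)" using \<beta>(1) by (simp add: inverse_ennreal inverse_eq_divide)
    also have "\<dots> \<le> e" using ennreal_inverse_antimono[OF \<beta>(2)] by (simp add: ennreal_inverse_inverse)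
    finally show False using e(2) by simp
  qed
qed

end

theorem theorem25:
  fixes X :: "('x::t2_space, 'e::banach) finsler"
    and Y :: "('y::t2_space, 'f::banach) finsler"
    and f :: "'x \<Rightarrow> 'y"
    and Jf :: "'x \<Rightarrow> (('x, 'e) tvec \<Rightarrow> ('y, 'f) tvec) set"
  assumes "finsler_manifold X" and "finsler_manifold Y"
    and "finsler_complete X"
    and "smooth_norm Y"
    and "locally_lipschitz X Y f"
    and "strong_pseudo_jacobian X Y f Jf"
    and "\<forall>x. Jf_regular_at X Y f Jf x"
    and "weighted_strong_submersion X Y f Jf"
  shows "covering_space UNIV f UNIV \<and>
         (\<forall>y. \<forall>x\<in>f -` {y}.
            pseudo_lipschitz_around X Y (\<lambda>z. f -` {z}) y x \<and>
            lip X Y (\<lambda>z. f -` {z}) y x \<le> inverse (reg_index X Y f Jf x))"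
proof -
  interpret finsler_pseudo_jacobian X Y f Jf
    using assms by unfold_locales
  show ?thesis using covering lip_inverse_le assms(3,7,8) by auto
qed

end
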